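(* Let $g,r,d$ and ramification sequences $\alpha,\beta$ satisfy $\rho(g,r,d,\alpha,\beta)=0$, $r\ge2$ and $\alpha_r+\beta_r+g-d+r>r+1$, and let $N=|YT(g,r,d,\alpha,\beta)|$. Suppose moreover that: (1) $\max\{\alpha_0-\alpha_r,1\}<\min_{0\le j<r}\{\alpha_{r-j-1}+\beta_j\}+g-d$; (2) $\sum_{i=0}^r(\alpha_i-\alpha_r)<\alpha_r+g-d+r+\beta_r$; (3) for every $0\le i<r$, $\alpha_{r-i}+\beta_i-1<\min_{i\le j<r}\{\alpha_{r-i-j-1}+\beta_j\}$ (minimum over those $j$ with $r-i-j-1\in\{0,\dots,r\}$; empty minimum $=+\infty$); (4) for every $0<i<r$, $\alpha_{r-i}+\beta_i=\alpha_{r-1}+\beta_1\ge\alpha_r+\beta_0$. Then the EH group, as a subgroup of the symmetric group on $YT(g,r,d,\alpha,\beta)$, is either the alternating group $A_N$ or the full symmetric group $S_N$.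
   Context: Ramification sequences: $\alpha=(\alpha_0,\dots,\alpha_r)$ integers with $d-r\ge\alpha_0\ge\cdots\ge\alpha_r\ge0$, $|\alpha|=\sum\alpha_i$; $g-d+r\ge0$; $\rho(g,r,d,\alpha,\beta)=g-(r+1)(g-d+r)-|\alpha|-|\beta|$. Skew diagram $\sigma(g,r,d,\alpha,\beta)$ (with $m=g-d+r$): rows $k=1,\dots,r+1$ numbered top to bottom, row $k$ consisting of boxes $(k,c)$ with $\alpha_0-\alpha_{r+1-k}<c\le\alpha_0+m+\beta_{k-1}$ (columns numbered left to right); it has $g$ boxes when $\rho=0$. $YT(g,r,d,\alpha,\beta)$ is the set of standard Young tableaux of this shape: bijective fillings with $1,\dots,g$ strictly increasing along rows (left to right) and columns (top to bottom). The distance between boxes $(i,j),(i',j')$ is $|i-i'|+|j-j'|$. For $1\le t<g$ and $a>0$, $\pi_{t,a}$ is the permutation of $YT(g,r,d,\alpha,\beta)$ exchanging the entries $t$ and $t+1$ in every tableau where they lie in different rows and different columns at distance exactly $a$, and fixing all other tableaux. The EH group is the subgroup of the symmetric group on $YT(g,r,d,\alpha,\beta)$ generated by all $\pi_{t,a}$. *)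

theory Defs
  imports "HOL-Algebra.Generated_Groups" "HOL-Combinatorics.Permutations"
begin

definition ram_seq :: "int \<Rightarrow> nat \<Rightarrow> int \<Rightarrow> (nat \<Rightarrow> int) \<Rightarrow> bool" where
  "ram_seq g r d \<alpha> \<longleftrightarrow> d - int r \<ge> \<alpha> 0 \<and> (\<forall>i<r. \<alpha> i \<ge> \<alpha> (Suc i)) \<and> \<alpha> r \<ge> 0"

definition rho :: "int \<Rightarrow> nat \<Rightarrow> int \<Rightarrow> (nat \<Rightarrow> int) \<Rightarrow> (nat \<Rightarrow> int) \<Rightarrow> int" where
  "rho g r d \<alpha> \<beta> = g - (int r + 1) * (g - d + int r) - (\<Sum>i\<le>r. \<alpha> i) - (\<Sum>i\<le>r. \<beta> i)"

text \<open>The skew diagram sigma(g,r,d,alpha,beta): boxes (k,c), rows k = 1..r+1 top to bottom,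
  columns c left to right.\<close>
definition skew_diagram :: "int \<Rightarrow> nat \<Rightarrow> int \<Rightarrow> (nat \<Rightarrow> int) \<Rightarrow> (nat \<Rightarrow> int) \<Rightarrow> (int \<times> int) set" where
  "skew_diagram g r d \<alpha> \<beta> =
     {(k, c). 1 \<le> k \<and> k \<le> int r + 1 \<and>
              \<alpha> 0 - \<alpha> (nat (int r + 1 - k)) < c \<and>
              c \<le> \<alpha> 0 + (g - d + int r) + \<beta> (nat (k - 1))}"

definition YT :: "int \<Rightarrow> nat \<Rightarrow> int \<Rightarrow> (nat \<Rightarrow> int) \<Rightarrow> (nat \<Rightarrow> int) \<Rightarrow> ((int \<times> int) \<Rightarrow> int) set" where
  "YT g r d \<alpha> \<beta> =
     (let S = skew_diagram g r d \<alpha> \<beta> in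
      {T. bij_betw T S {1..g} \<and> (\<forall>x. x \<notin> S \<longrightarrow> T x = 0) \<and>
          (\<forall>i j j'. (i, j) \<in> S \<longrightarrow> (i, j') \<in> S \<longrightarrow> j < j' \<longrightarrow> T (i, j) < T (i, j')) \<and>
          (\<forall>i i' j. (i, j) \<in> S \<longrightarrow> (i', j) \<in> S \<longrightarrow> i < i' \<longrightarrow> T (i, j) < T (i', j))})"

definition pi_EH :: "int \<Rightarrow> nat \<Rightarrow> int \<Rightarrow> (nat \<Rightarrow> int) \<Rightarrow> (nat \<Rightarrow> int) \<Rightarrow> int \<Rightarrow> int
                      \<Rightarrow> ((int \<times> int) \<Rightarrow> int) \<Rightarrow> ((int \<times> int) \<Rightarrow> int)" where
  "pi_EH g r d \<alpha> \<beta> t a T =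
     (if T \<in> YT g r d \<alpha> \<beta> \<and>
         (\<exists>i j i' j'. T (i, j) = t \<and> T (i', j') = t + 1 \<and>
                      (i, j) \<in> skew_diagram g r d \<alpha> \<beta> \<and> (i', j') \<in> skew_diagram g r d \<alpha> \<beta> \<and>
                      i \<noteq> i' \<and> j \<noteq> j' \<and> \<bar>i - i'\<bar> + \<bar>j - j'\<bar> = a)
      then (\<lambda>x. if T x = t then t + 1 else if T x = t + 1 then t else T x)
      else T)"

definition perm_group :: "'a set \<Rightarrow> ('a \<Rightarrow> 'a) monoid" where
  "perm_group S = \<lparr>carrier = {p. p permutes S}, monoid.mult = (\<circ>), one = id\<rparr>"

definition EH_group :: "int \<Rightarrow> nat \<Rightarrow> int \<Rightarrow> (nat \<Rightarrow> int) \<Rightarrow> (nat \<Rightarrow> int)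
                        \<Rightarrow> (((int \<times> int) \<Rightarrow> int) \<Rightarrow> ((int \<times> int) \<Rightarrow> int)) set" where
  "EH_group g r d \<alpha> \<beta> =
     generate (perm_group (YT g r d \<alpha> \<beta>))
              {pi_EH g r d \<alpha> \<beta> t a | t a. 1 \<le> t \<and> t < g \<and> a > 0}"

end

theory Submission
  imports Defs
begin

text \<open>A standard filling is a word in the boxes, and a generator exchanges adjacent letters of the word
  whose contents differ by a fixed amount. For order ideals \<open>I \<subseteq> J\<close> the section \<open>(I, J)\<close> consists
  of the words that fill \<open>I\<close> first and \<open>J\<close> next; it is good if every 3-cycle of the fillings of
  \<open>J - I\<close>, extended by the identity to all other words, lies in the group. The top right and bottom left
  corners are the only boxes at maximal distance, so the generator for this distance at the first possible
  time is an isolated transposition. The commutator of an isolated permutation with a generator that moves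
  just one of its points is an isolated 3-cycle on a section with one more box. Adding boxes one at a time
  makes the section \<open>({}, D)\<close> good, so the group contains all 3-cycles. Boxes are added in an order
  in which some extremal corner stays available; the inequality (1) excludes coincidences of distances.\<close>

section \<open>Isolated 3-cycles\<close>

text \<open>A generator acts on all words at once, whatever surrounds the two places it exchanges,
  while a 3-cycle on a small section is useful only when nothing else moves. So
  \<open>realizes\<close> asks for an action that is the same in every surrounding, and
  \<open>isolated\<close> adds that all other words stay put. A conjugate of an isolated 3-cycle is
  isolated even when the conjugating element is not, so one isolated 3-cycle spreads over its
  section: the fillings are connected under exchanges, and blocks on which all 3-cycles are
  available merge when they meet. Contents replace distances because boxes that can be exchanged are
  incomparable, with row and column differing in opposite directions; their contents differ by at
  least 2, hence the bound \<open>2 \<le> b\<close> throughout. Commutators are even. Therefore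
  3-cycles rather than transpositions are propagated, and the parity of the generators stays open,
  which leaves the two groups of the theorem.\<close>

definition cyc3 :: "'a \<Rightarrow> 'a \<Rightarrow> 'a \<Rightarrow> 'a \<Rightarrow> 'a" where
  "cyc3 a b c x = (if x = a then b else if x = b then c else if x = c then a else x)"

lemma cyc3_rotate: "distinct [a, b, c] \<Longrightarrow> cyc3 a b c = cyc3 b c a"
  by (auto simp: cyc3_def fun_eq_iff)

lemma cyc3_square: "distinct [a, b, c] \<Longrightarrow> cyc3 a b c \<circ> cyc3 a b c = cyc3 a c b"
  by (auto simp: cyc3_def fun_eq_iff)

lemma cyc3_permutes:
  assumes "distinct [a, b, c]" "{a, b, c} \<subseteq> S"
  shows "cyc3 a b c permutes S"
proof -
  have "cyc3 a b c = transpose a b \<circ> transpose b c"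
    using assms(1) by (auto simp: cyc3_def transpose_def fun_eq_iff)
  then show ?thesis
    using assms(2) by (auto intro!: permutes_compose permutes_swap_id)
qed

lemma cyc3_in:
  assumes "{a, b, c} \<subseteq> S" "x \<in> S"
  shows "cyc3 a b c x \<in> S"
  using assms by (auto simp: cyc3_def)

lemma cyc3_inj:
  assumes "inj_on f S" "a \<in> S" "b \<in> S" "c \<in> S" "x \<in> S"
  shows "f (cyc3 a b c x) = cyc3 (f a) (f b) (f c) (f x)"
  using assms by (auto simp: cyc3_def inj_on_def)

locale transformation_group =
  fixes G :: "('l \<Rightarrow> 'l) set"
  assumes comp_closed: "f \<in> G \<Longrightarrow> h \<in> G \<Longrightarrow> f \<circ> h \<in> G"
    and inv_ex: "f \<in> G \<Longrightarrow> \<exists>h\<in>G. h \<circ> f = id \<and> f \<circ> h = id"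
begin

text \<open>\<open>S\<close> stands for the fillings of a section, \<open>Y\<close> for the
  surroundings in which a filling can be placed, and \<open>\<phi>\<close> for the assembled
  tableau.\<close>

definition realizes :: "('s \<Rightarrow> 'y \<Rightarrow> 'l) \<Rightarrow> 's set \<Rightarrow> 'y set \<Rightarrow> ('l \<Rightarrow> 'l) \<Rightarrow> ('s \<Rightarrow> 's) \<Rightarrow> bool" where
  "realizes \<phi> S Y f \<sigma> \<longleftrightarrow> (\<forall>s\<in>S. \<forall>y\<in>Y. f (\<phi> s y) = \<phi> (\<sigma> s) y)"

definition isolated :: "('s \<Rightarrow> 'y \<Rightarrow> 'l) \<Rightarrow> 's set \<Rightarrow> 'y set \<Rightarrow> ('s \<Rightarrow> 's) \<Rightarrow> bool" where
  "isolated \<phi> S Y \<sigma> \<longleftrightarrow> (\<exists>f\<in>G. realizes \<phi> S Y f \<sigma> \<and>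
     (\<forall>T. (\<nexists>s y. s \<in> S \<and> y \<in> Y \<and> T = \<phi> s y) \<longrightarrow> f T = T))"

text \<open>Blocks \<open>B\<close> smaller than \<open>S\<close> are allowed because they are grown
  step by step. A block with at most two points qualifies vacuously, hence the bounds
  \<open>3 \<le> card\<close> below.\<close>

definition alt_on :: "('s \<Rightarrow> 'y \<Rightarrow> 'l) \<Rightarrow> 's set \<Rightarrow> 'y set \<Rightarrow> 's set \<Rightarrow> bool" where
  "alt_on \<phi> S Y B \<longleftrightarrow> B \<subseteq> S \<and>
     (\<forall>a\<in>B. \<forall>b\<in>B. \<forall>c\<in>B. distinct [a, b, c] \<longrightarrow> isolated \<phi> S Y (cyc3 a b c))"

lemma alt_onD:
  "alt_on \<phi> S Y B \<Longrightarrow> a \<in> B \<Longrightarrow> b \<in> B \<Longrightarrow> c \<in> B \<Longrightarrow> distinct [a, b, c] \<Longrightarrow> isolated \<phi> S Y (cyc3 a b c)"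
  by (auto simp: alt_on_def)

lemma alt_on_subset: "alt_on \<phi> S Y B \<Longrightarrow> B \<subseteq> S"
  by (auto simp: alt_on_def)

lemma isolated_comp:
  assumes "isolated \<phi> S Y \<sigma>" "isolated \<phi> S Y \<tau>" "\<tau> ` S \<subseteq> S"
  shows "isolated \<phi> S Y (\<sigma> \<circ> \<tau>)"
proof -
  obtain f where "f \<in> G" and
    f: "realizes \<phi> S Y f \<sigma>" "\<And>T. (\<nexists>s y. s \<in> S \<and> y \<in> Y \<and> T = \<phi> s y) \<Longrightarrow> f T = T"
    using assms(1) unfolding isolated_def by blast
  obtain h where "h \<in> G" and
    h: "realizes \<phi> S Y h \<tau>" "\<And>T. (\<nexists>s y. s \<in> S \<and> y \<in> Y \<and> T = \<phi> s y) \<Longrightarrow> h T = T"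
    using assms(2) unfolding isolated_def by blast
  have "realizes \<phi> S Y (f \<circ> h) (\<sigma> \<circ> \<tau>)"
    using f(1) h(1) assms(3) by (auto simp: realizes_def image_subset_iff)
  moreover have "(f \<circ> h) T = T" if "\<nexists>s y. s \<in> S \<and> y \<in> Y \<and> T = \<phi> s y" for T
    using f(2) h(2) that by simp
  ultimately show ?thesis
    using comp_closed[OF \<open>f \<in> G\<close> \<open>h \<in> G\<close>] unfolding isolated_def by blast
qed

text \<open>Reversing a 3-cycle is squaring it, so closure under composition is enough.\<close>

lemma isolated_cyc3_rev:
  assumes "isolated \<phi> S Y (cyc3 a b c)" "distinct [a, b, c]" "{a, b, c} \<subseteq> S"
  shows "isolated \<phi> S Y (cyc3 b a c)"
proof -
  have "isolated \<phi> S Y (cyc3 a c b)"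
    using isolated_comp[OF assms(1) assms(1)] cyc3_in[of a b c S] assms(2,3)
    by (auto simp: cyc3_square)
  also have "cyc3 a c b = cyc3 b a c"
    using assms(2) by (metis cyc3_rotate distinct_length_2_or_more)
  finally show ?thesis .
qed

text \<open>Only \<open>h\<close> has to be isolated. As \<open>f\<close> permutes the fillings in
  every surrounding, its inverse maps words outside the section to words outside, and the conjugate
  stays trivial there.\<close>

lemma isolated_conj:
  assumes f: "f \<in> G" "realizes \<phi> S Y f \<sigma>" "bij_betw \<sigma> S S"
    and iso: "isolated \<phi> S Y (cyc3 a b c)" and abc: "{a, b, c} \<subseteq> S"
  shows "isolated \<phi> S Y (cyc3 (\<sigma> a) (\<sigma> b) (\<sigma> c))"
proof -
  obtain h where h: "h \<in> G" "realizes \<phi> S Y h (cyc3 a b c)"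
      "\<And>T. (\<nexists>s y. s \<in> S \<and> y \<in> Y \<and> T = \<phi> s y) \<Longrightarrow> h T = T"
    using iso unfolding isolated_def by blast
  obtain f' where f': "f' \<in> G" "\<And>x. f' (f x) = x" "\<And>x. f (f' x) = x"
    using inv_ex[OF f(1)] by (metis comp_apply id_apply)
  have "realizes \<phi> S Y (f \<circ> h \<circ> f') (cyc3 (\<sigma> a) (\<sigma> b) (\<sigma> c))"
    unfolding realizes_def
  proof (intro ballI)
    fix s y assume "s \<in> S" "y \<in> Y"
    then obtain u where u: "u \<in> S" "s = \<sigma> u"
      using f(3) by (auto simp: bij_betw_def)
    have cu: "cyc3 a b c u \<in> S"
      using cyc3_in abc u(1) by metis
    have "\<phi> s y = f (\<phi> u y)"
      using f(2) u \<open>y \<in> Y\<close> by (simp add: realizes_def)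
    then have "(f \<circ> h \<circ> f') (\<phi> s y) = f (h (\<phi> u y))"
      using f' by simp
    also have "\<dots> = \<phi> (\<sigma> (cyc3 a b c u)) y"
      using h(2) f(2) u \<open>y \<in> Y\<close> cu by (simp add: realizes_def)
    also have "\<sigma> (cyc3 a b c u) = cyc3 (\<sigma> a) (\<sigma> b) (\<sigma> c) s"
      using cyc3_inj[of \<sigma> S a b c u] f(3) abc u by (auto simp: bij_betw_def)
    finally show "(f \<circ> h \<circ> f') (\<phi> s y) = \<phi> (cyc3 (\<sigma> a) (\<sigma> b) (\<sigma> c) s) y" .
  qed
  moreover have "(f \<circ> h \<circ> f') T = T" if T: "\<nexists>s y. s \<in> S \<and> y \<in> Y \<and> T = \<phi> s y" for T
  proof -
    have "\<nexists>s y. s \<in> S \<and> y \<in> Y \<and> f' T = \<phi> s y"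
    proof
      assume "\<exists>s y. s \<in> S \<and> y \<in> Y \<and> f' T = \<phi> s y"
      then obtain s y where sy: "s \<in> S" "y \<in> Y" "f' T = \<phi> s y" by blast
      then have "T = \<phi> (\<sigma> s) y"
        using f'(3)[of T] f(2) by (simp add: realizes_def)
      moreover have "\<sigma> s \<in> S"
        using f(3) sy by (auto simp: bij_betw_def)
      ultimately show False
        using T sy by blast
    qed
    then show ?thesis
      using h(3) f'(3) by simp
  qed
  ultimately show ?thesis
    unfolding isolated_def using comp_closed[OF comp_closed[OF f(1) h(1)] f'(1)] by blast
qed

lemma cyc3_bij_betw:
  assumes "distinct [a, b, c]" "{a, b, c} \<subseteq> S"
  shows "bij_betw (cyc3 a b c) S S"
  using cyc3_permutes[OF assms] by (rule permutes_imp_bij)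

lemma isolated_conj_cyc3:
  assumes "isolated \<phi> S Y (cyc3 p q r)" "distinct [p, q, r]" "{p, q, r} \<subseteq> S"
    and "isolated \<phi> S Y (cyc3 a b c)" "{a, b, c} \<subseteq> S"
  shows "isolated \<phi> S Y (cyc3 (cyc3 p q r a) (cyc3 p q r b) (cyc3 p q r c))"
proof -
  obtain f where "f \<in> G" "realizes \<phi> S Y f (cyc3 p q r)"
    using assms(1) unfolding isolated_def by blast
  then show ?thesis
    using isolated_conj cyc3_bij_betw assms by metis
qed

text \<open>One 3-cycle through the new point suffices: conjugating \<open>cyc3 x y w\<close> by
  \<open>cyc3 x y z\<close> inside \<open>B\<close> gives \<open>cyc3 y z w\<close>, and such moves
  lead from one pair in \<open>B\<close> to every other.\<close>

lemma alt_on_insert: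
  assumes B: "alt_on \<phi> S Y B" and ab: "a \<in> B" "b \<in> B" "a \<noteq> b" and w: "w \<in> S"
    and iso: "isolated \<phi> S Y (cyc3 a b w)"
  shows "alt_on \<phi> S Y (insert w B)"
proof (cases "w \<in> B")
  case False
  define R where "R x y \<longleftrightarrow> x \<in> B \<and> y \<in> B \<and> x \<noteq> y \<and> isolated \<phi> S Y (cyc3 x y w)" for x y
  have BS: "B \<subseteq> S" using B by (rule alt_on_subset)
  have sym: "R y x" if "R x y" for x y
    using that isolated_cyc3_rev[of \<phi> S Y x y w] False w BS by (auto simp: R_def)
  have step: "R y z" if "R x y" "z \<in> B" "z \<noteq> x" "z \<noteq> y" for x y z
  proof -
    have xy: "x \<in> B" "y \<in> B" "x \<noteq> y" "isolated \<phi> S Y (cyc3 x y w)"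
      using that by (auto simp: R_def)
    have d: "distinct [x, y, z]" and sub: "{x, y, z} \<subseteq> S"
      using that xy BS by auto
    have "isolated \<phi> S Y (cyc3 (cyc3 x y z x) (cyc3 x y z y) (cyc3 x y z w))"
      using isolated_conj_cyc3[OF alt_onD[OF B xy(1,2) that(2) d] d sub xy(4)] w BS xy by auto
    moreover have "cyc3 x y z x = y" "cyc3 x y z y = z" "cyc3 x y z w = w"
      using d False xy that by (auto simp: cyc3_def)
    ultimately show ?thesis
      using that xy by (auto simp: R_def)
  qed
  have Rab: "R a b" using ab iso by (simp add: R_def)
  have all: "R c d" if "c \<in> B" "d \<in> B" "c \<noteq> d" for c d
  proof -
    have 1: "R a z" "R b z" if "z \<in> B" "z \<noteq> a" "z \<noteq> b" for z
      using step[OF Rab that] step[OF sym[OF Rab]] that by auto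
    show ?thesis
    proof (cases "c = a \<or> c = b \<or> d = a \<or> d = b")
      case True
      then show ?thesis using 1 that Rab sym by blast
    next
      case False
      then show ?thesis using step[OF 1(1)] that by auto
    qed
  qed
  show ?thesis
    unfolding alt_on_def
  proof (intro conjI ballI impI)
    fix x y z assume xyz: "x \<in> insert w B" "y \<in> insert w B" "z \<in> insert w B" and d: "distinct [x, y, z]"
    consider "x = w" | "y = w" | "z = w" | "x \<in> B" "y \<in> B" "z \<in> B"
      using xyz by blast
    then show "isolated \<phi> S Y (cyc3 x y z)"
    proof cases
      case 1
      then have "R y z" using all d xyz by auto
      then show ?thesis using 1 cyc3_rotate[OF d] by (simp add: R_def)
    next
      case 2
      then have "R z x" using all d xyz by auto
      moreover have "cyc3 z x y = cyc3 x y z"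
        using d by (intro cyc3_rotate) auto
      ultimately show ?thesis using 2 by (simp add: R_def)
    next
      case 3
      then have "R x y" using all d xyz by auto
      then show ?thesis using 3 by (simp add: R_def)
    next
      case 4
      then show ?thesis using alt_onD[OF B] d by blast
    qed
  qed (use w BS in auto)
qed (use B in \<open>simp add: insert_absorb\<close>)

lemma alt_on_insert_many:
  assumes "finite W" "alt_on \<phi> S Y B" "W \<subseteq> S"
    and "\<And>w. w \<in> W \<Longrightarrow> \<exists>a\<in>B. \<exists>b\<in>B. a \<noteq> b \<and> isolated \<phi> S Y (cyc3 a b w)"
  shows "alt_on \<phi> S Y (B \<union> W)"
  using assms(1,3,4)
proof (induction W rule: finite_induct)
  case empty
  then show ?case using assms(2) by simp
next
  case (insert w W)
  then have "alt_on \<phi> S Y (B \<union> W)" by blast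
  moreover obtain a b where "a \<in> B" "b \<in> B" "a \<noteq> b" "isolated \<phi> S Y (cyc3 a b w)"
    using insert.prems by blast
  ultimately have "alt_on \<phi> S Y (insert w (B \<union> W))"
    using insert.prems by (intro alt_on_insert[of \<phi> S Y "B \<union> W" a b w]) auto
  then show ?case by simp
qed

text \<open>For \<open>w\<close> in \<open>C - B\<close> a 3-cycle with two points of
  \<open>B\<close> is needed. A third point \<open>d\<close> of \<open>C\<close> gives it at once
  when \<open>d\<close> lies in \<open>B\<close>; otherwise \<open>cyc3 p w d\<close>, available in
  \<open>C\<close>, carries a 3-cycle \<open>cyc3 a b p\<close> of \<open>B\<close> to
  \<open>cyc3 a b w\<close>.\<close>

lemma alt_on_union:
  assumes B: "alt_on \<phi> S Y B" "3 \<le> card B" and C: "alt_on \<phi> S Y C" "3 \<le> card C"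
    and meet: "B \<inter> C \<noteq> {}" and fin: "finite S"
  shows "alt_on \<phi> S Y (B \<union> C)"
proof -
  have sub: "B \<subseteq> S" "C \<subseteq> S"
    using B C by (auto dest: alt_on_subset)
  have fins: "finite B" "finite C"
    using sub fin finite_subset by blast+
  obtain p where p: "p \<in> B" "p \<in> C" using meet by blast
  have "\<exists>a\<in>B. \<exists>b\<in>B. a \<noteq> b \<and> isolated \<phi> S Y (cyc3 a b w)" if w: "w \<in> C - B" for w
  proof -
    have "card {p, w} \<le> 2" by (simp add: card_insert_if)
    then have "\<not> C \<subseteq> {p, w}"
      using C(2) card_mono[of "{p, w}" C] by auto
    then obtain d where d: "d \<in> C" "d \<noteq> p" "d \<noteq> w" by blast
    have dist: "distinct [p, w, d]" "distinct [p, d, w]"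
      using d p w by auto
    show ?thesis
    proof (cases "d \<in> B")
      case True
      moreover have "isolated \<phi> S Y (cyc3 p d w)"
        using alt_onD[OF C(1) p(2) d(1)] w dist(2) by simp
      ultimately show ?thesis using p d by metis
    next
      case False
      have "card (B - {p}) \<ge> 2" using B(2) p fins by simp
      then obtain a where a: "a \<in> B - {p}"
        by (metis all_not_in_conv card.empty not_numeral_le_zero)
      have "card (B - {p} - {a}) \<ge> 1" using \<open>card (B - {p}) \<ge> 2\<close> a fins by simp
      then obtain b where b: "b \<in> B - {p} - {a}"
        by (metis all_not_in_conv card.empty not_one_le_zero)
      have "isolated \<phi> S Y (cyc3 a b p)"
        using alt_onD[OF B(1)] a b p by auto
      moreover have "isolated \<phi> S Y (cyc3 p w d)"
        using alt_onD[OF C(1)] p d w dist by auto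
      ultimately have "isolated \<phi> S Y (cyc3 (cyc3 p w d a) (cyc3 p w d b) (cyc3 p w d p))"
        using a b p d w sub dist by (intro isolated_conj_cyc3) auto
      moreover have "cyc3 p w d a = a" "cyc3 p w d b = b" "cyc3 p w d p = w"
        using a b w False p by (auto simp: cyc3_def)
      ultimately show ?thesis using a b by (intro bexI[of _ a] bexI[of _ b]) auto
    qed
  qed
  then have "alt_on \<phi> S Y (B \<union> (C - B))"
    using fins sub by (intro alt_on_insert_many B) auto
  then show ?thesis by simp
qed

lemma alt_on_image:
  assumes "f \<in> G" "realizes \<phi> S Y f \<sigma>" "bij_betw \<sigma> S S" "alt_on \<phi> S Y B"
  shows "alt_on \<phi> S Y (\<sigma> ` B)"
  unfolding alt_on_def
proof (intro conjI ballI impI)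
  have BS: "B \<subseteq> S" using assms(4) by (rule alt_on_subset)
  show "\<sigma> ` B \<subseteq> S" using assms(3) BS by (auto simp: bij_betw_def)
  fix x y z assume xyz: "x \<in> \<sigma> ` B" "y \<in> \<sigma> ` B" "z \<in> \<sigma> ` B" "distinct [x, y, z]"
  then obtain a b c where abc: "a \<in> B" "b \<in> B" "c \<in> B" "x = \<sigma> a" "y = \<sigma> b" "z = \<sigma> c" by blast
  then have "isolated \<phi> S Y (cyc3 a b c)"
    using xyz alt_onD[OF assms(4)] by auto
  then show "isolated \<phi> S Y (cyc3 x y z)"
    using isolated_conj[OF assms(1-3)] abc BS by auto
qed

text \<open>The images \<^term>\<open>\<sigma> ` B\<close> of a maximal \<^term>\<open>B\<close> meet \<^term>\<open>B\<close>, so they stay inside it.\<close>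
lemma alt_on_closure:
  assumes fin: "finite S" and B0: "alt_on \<phi> S Y B0" "3 \<le> card B0"
    and gens: "\<And>f \<sigma>. (f, \<sigma>) \<in> \<Gamma> \<Longrightarrow> f \<in> G \<and> realizes \<phi> S Y f \<sigma> \<and> bij_betw \<sigma> S S \<and> (\<exists>s\<in>B0. \<sigma> s \<in> B0)"
    and conn: "\<And>B. B \<noteq> {} \<Longrightarrow> B \<subseteq> S \<Longrightarrow> (\<And>f \<sigma>. (f, \<sigma>) \<in> \<Gamma> \<Longrightarrow> \<sigma> ` B \<subseteq> B) \<Longrightarrow> B = S"
  shows "alt_on \<phi> S Y S"
proof -
  define \<B> where "\<B> = {B. alt_on \<phi> S Y B \<and> B0 \<subseteq> B}"
  have "\<B> \<subseteq> Pow S" by (auto simp: \<B>_def dest: alt_on_subset)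
  then have "finite \<B>" using fin by (meson finite_Pow_iff finite_subset)
  moreover have "\<B> \<noteq> {}" using B0 by (auto simp: \<B>_def)
  ultimately obtain B where B: "B \<in> \<B>" "\<And>C. C \<in> \<B> \<Longrightarrow> B \<subseteq> C \<Longrightarrow> C = B"
    using finite_has_maximal[of \<B>] by metis
  have altB: "alt_on \<phi> S Y B" and sub: "B0 \<subseteq> B" "B \<subseteq> S"
    using B(1) by (auto simp: \<B>_def dest: alt_on_subset)
  have finB: "finite B" using sub fin finite_subset by blast
  have cardB: "3 \<le> card B" using B0(2) card_mono[OF finB sub(1)] by simp
  have "\<sigma> ` B \<subseteq> B" if "(f, \<sigma>) \<in> \<Gamma>" for f \<sigma>
  proof -
    note g = gens[OF that]
    have "inj_on \<sigma> B" using g sub by (meson bij_betw_def inj_on_subset)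
    then have "3 \<le> card (\<sigma> ` B)" using cardB by (simp add: card_image)
    moreover have "alt_on \<phi> S Y (\<sigma> ` B)" using g alt_on_image altB by blast
    moreover have "B \<inter> \<sigma> ` B \<noteq> {}" using g sub by blast
    ultimately have "alt_on \<phi> S Y (B \<union> \<sigma> ` B)"
      using alt_on_union altB cardB fin by blast
    then have "B \<union> \<sigma> ` B \<in> \<B>" using sub by (auto simp: \<B>_def)
    then have "B \<union> \<sigma> ` B = B" using B(2) by blast
    then show ?thesis by blast
  qed
  moreover have "B \<noteq> {}" using cardB by auto
  ultimately show ?thesis using conn sub altB by metis
qed

text \<open>If \<^term>\<open>p\<close> acts as \<^term>\<open>\<tau>\<close> on the small section and \<^term>\<open>q\<close> moves just one of the points
  moved by \<^term>\<open>p\<close>, then \<open>p q p\<inverse> q\<close> is a 3-cycle on the larger section and isolated there.\<close>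
lemma isolated_commutator:
  fixes \<phi> :: "'s \<Rightarrow> 'y \<Rightarrow> 'l" and \<phi>' :: "'t \<Rightarrow> 'z \<Rightarrow> 'l"
  assumes e: "\<And>s. s \<in> S \<Longrightarrow> e s \<in> S'" "inj_on e S"
    and j: "\<And>y. y \<in> Y' \<Longrightarrow> j y \<in> Y" "\<And>s y. s \<in> S \<Longrightarrow> y \<in> Y' \<Longrightarrow> \<phi>' (e s) y = \<phi> s (j y)"
    and inj: "\<And>s t y z. s \<in> S' \<Longrightarrow> t \<in> S' \<Longrightarrow> y \<in> Y' \<Longrightarrow> z \<in> Y' \<Longrightarrow> \<phi>' s y = \<phi>' t z \<Longrightarrow> s = t"
    and outside: "\<And>x y s z. x \<in> S' - e ` S \<Longrightarrow> y \<in> Y' \<Longrightarrow> s \<in> S \<Longrightarrow> z \<in> Y \<Longrightarrow> \<phi>' x y \<noteq> \<phi> s z"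
    and \<tau>: "bij_betw \<tau> S S" "isolated \<phi> S Y \<tau>"
    and a: "a \<in> S" "\<tau> a \<noteq> a" and x: "x \<in> S' - e ` S"
    and q: "q \<in> G" "\<And>T. q (q T) = T"
      "\<And>y. y \<in> Y' \<Longrightarrow> q (\<phi>' (e a) y) = \<phi>' x y"
      "\<And>y. y \<in> Y \<Longrightarrow> y \<notin> j ` Y' \<Longrightarrow> q (\<phi> a y) = \<phi> a y"
      "\<And>s y. s \<in> S \<Longrightarrow> \<tau> s \<noteq> s \<Longrightarrow> s \<noteq> a \<Longrightarrow> y \<in> Y \<Longrightarrow> q (\<phi> s y) = \<phi> s y"
  shows "isolated \<phi>' S' Y' (cyc3 (e a) (e (\<tau> a)) x)"
proof -
  obtain p where p: "p \<in> G" and p_real: "\<And>s y. s \<in> S \<Longrightarrow> y \<in> Y \<Longrightarrow> p (\<phi> s y) = \<phi> (\<tau> s) y"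
    and p_fix: "\<And>T. (\<nexists>s y. s \<in> S \<and> y \<in> Y \<and> T = \<phi> s y) \<Longrightarrow> p T = T"
    using \<tau>(2) unfolding isolated_def realizes_def by blast
  obtain p' where p': "p' \<in> G" "\<And>T. p' (p T) = T" "\<And>T. p (p' T) = T"
    using inv_ex[OF p] by (metis comp_apply id_apply)
  \<comment> \<open>First \<open>q\<close>, then \<open>p'\<close>, then \<open>q\<close>, then
    \<open>p\<close>. The point \<open>e a\<close> goes to \<open>x\<close>, stays, returns, and is
    moved to \<open>e (\<tau> a)\<close>; in the same way \<open>e (\<tau> a)\<close> ends at
    \<open>x\<close> and \<open>x\<close> at \<open>e a\<close>.\<close>
  define g where "g = p \<circ> q \<circ> p' \<circ> q"
  have gG: "g \<in> G" unfolding g_def using comp_closed p p' q(1) by blast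
  have \<tau>S: "\<tau> s \<in> S" if "s \<in> S" for s using \<tau>(1) that by (auto simp: bij_betw_def)
  have \<tau>inj: "s = t" if "\<tau> s = \<tau> t" "s \<in> S" "t \<in> S" for s t
    using \<tau>(1) that by (auto simp: bij_betw_def inj_on_def)
  have \<tau>a: "\<tau> a \<in> S" "\<tau> (\<tau> a) \<noteq> \<tau> a" using a \<tau>S \<tau>inj by blast+
  have qx: "q (\<phi>' x y) = \<phi>' (e a) y" if "y \<in> Y'" for y
    using q(2,3) that by metis
  have xout: "p (\<phi>' x y) = \<phi>' x y" if "y \<in> Y'" for y
    using p_fix outside[OF x that] by blast
  \<comment> \<open>If \<open>p\<close> fixes \<open>T\<close>, it also fixes \<open>q T\<close>,
    unless \<open>q T\<close> is the moved point \<open>a\<close> in a surrounding from the image of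
    \<open>j\<close>; then \<open>T\<close> comes from \<open>x\<close>, which is excluded.\<close>
  have triv: "g T = T" if pT: "p T = T" and T: "\<And>y. y \<in> Y' \<Longrightarrow> T \<noteq> \<phi>' x y" for T
  proof -
    have "p (q T) = q T"
    proof (cases "\<exists>s y. s \<in> S \<and> y \<in> Y \<and> q T = \<phi> s y")
      case True
      then obtain s y where sy: "s \<in> S" "y \<in> Y" "q T = \<phi> s y" by blast
      have *: "p (q T) = q T" if "q (\<phi> s y) = \<phi> s y"
        using that sy pT q(2) by metis
      show ?thesis
      proof (cases "\<tau> s = s")
        case True
        then show ?thesis using p_real sy by simp
      next
        case False
        show ?thesis
        proof (cases "s = a \<and> y \<in> j ` Y'")
          case True
          then obtain y' where "y' \<in> Y'" "y = j y'" by blast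
          then have "T = \<phi>' x y'" using sy q(2,3) j(2) a True by metis
          then show ?thesis using T \<open>y' \<in> Y'\<close> by blast
        next
          case False
          then show ?thesis using * q(4,5) sy \<open>\<tau> s \<noteq> s\<close> by blast
        qed
      qed
    qed (use p_fix in blast)
    then have "p' (q T) = q T" using p' by metis
    then show ?thesis using q(2) pT by (simp add: g_def)
  qed
  \<comment> \<open>By \<open>1\<close> and \<open>2\<close> neither this point nor its preimage
    under \<open>\<tau>\<close> is \<open>a\<close> in a surrounding that extends to the large
    section. So \<open>q\<close> fixes both, and \<open>p\<close> cancels its inverse.\<close>
  have moved: "g (\<phi> s y) = \<phi> s y"
    if s: "s \<in> S" "\<tau> s \<noteq> s" "y \<in> Y" and 1: "s = a \<Longrightarrow> y \<notin> j ` Y'" and 2: "s = \<tau> a \<Longrightarrow> y \<notin> j ` Y'" for s y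
  proof -
    obtain u where u: "u \<in> S" "s = \<tau> u" using \<tau>(1) s by (auto simp: bij_betw_def)
    have "\<tau> u \<noteq> u" using u s by auto
    have "q (\<phi> s y) = \<phi> s y" using q(4,5) s 1 by blast
    moreover have "p' (\<phi> s y) = \<phi> u y" using p'(2) p_real u s by metis
    moreover have "q (\<phi> u y) = \<phi> u y" using q(4,5) u s 2 \<open>\<tau> u \<noteq> u\<close> by blast
    ultimately show ?thesis using p_real u s by (simp add: g_def)
  qed
  have "realizes \<phi>' S' Y' g (cyc3 (e a) (e (\<tau> a)) x)"
    unfolding realizes_def
  proof (intro ballI)
    fix t y assume t: "t \<in> S'" and y: "y \<in> Y'"
    have jy: "j y \<in> Y" using j y by blast
    have ne: "e a \<noteq> e (\<tau> a)" "e a \<noteq> x" "e (\<tau> a) \<noteq> x"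
      using e(2) a \<tau>a x by (auto simp: inj_on_def)
    consider "t = e a" | "t = e (\<tau> a)" | "t = x" | s where "s \<in> S" "t = e s" "s \<noteq> a" "s \<noteq> \<tau> a"
      | "t \<notin> e ` S" "t \<noteq> x" by blast
    then show "g (\<phi>' t y) = \<phi>' (cyc3 (e a) (e (\<tau> a)) x t) y"
    proof cases
      case 1
      have "g (\<phi>' t y) = p (q (p' (\<phi>' x y)))" using 1 q(3) y by (simp add: g_def)
      also have "p' (\<phi>' x y) = \<phi>' x y" using xout p' y by metis
      also have "p (q (\<phi>' x y)) = \<phi>' (e (\<tau> a)) y" using qx y j a jy p_real \<tau>a by simp
      finally show ?thesis using 1 by (simp add: cyc3_def)
    next
      case 2
      have "q (\<phi> (\<tau> a) (j y)) = \<phi> (\<tau> a) (j y)" using q(5) \<tau>a a jy by blast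
      moreover have "p' (\<phi> (\<tau> a) (j y)) = \<phi> a (j y)" using p'(2) p_real a jy by metis
      ultimately have "g (\<phi>' t y) = p (q (\<phi>' (e a) y))" using 2 j y \<tau>a a by (simp add: g_def)
      also have "\<dots> = \<phi>' x y" using q(3) y xout by simp
      finally show ?thesis using 2 ne by (auto simp: cyc3_def)
    next
      case 3
      have "p' (\<phi> (\<tau> a) (j y)) = \<phi> a (j y)" using p'(2) p_real a jy by metis
      obtain u where u: "u \<in> S" "a = \<tau> u" using \<tau>(1) a by (auto simp: bij_betw_def)
      have "p' (\<phi> a (j y)) = \<phi> u (j y)" using p'(2) p_real u jy by metis
      moreover have "q (\<phi> u (j y)) = \<phi> u (j y)" using q(5) u a jy by metis
      ultimately have "g (\<phi>' t y) = \<phi>' (e a) y"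
        using 3 qx y j a p_real u jy by (simp add: g_def)
      then show ?thesis using 3 ne by (auto simp: cyc3_def)
    next
      case 4
      have "t \<noteq> e a" "t \<noteq> e (\<tau> a)" "t \<noteq> x"
        using 4 e(2) a \<tau>a x by (auto simp: inj_on_def)
      then have c: "cyc3 (e a) (e (\<tau> a)) x t = t" by (simp add: cyc3_def)
      show ?thesis
      proof (cases "\<tau> s = s")
        case True
        then have "p (\<phi>' t y) = \<phi>' t y" using 4 j y p_real jy by simp
        moreover have "\<phi>' t y \<noteq> \<phi>' x z" if "z \<in> Y'" for z
          using outside[OF x that 4(1) jy] 4 j y by simp
        ultimately show ?thesis using triv c by simp
      next
        case False
        then show ?thesis using moved[of s "j y"] 4 jy j y c by simp
      qed
    next
      case 5
      then have "p (\<phi>' t y) = \<phi>' t y" using p_fix outside[of t y] t y by blast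
      moreover have "\<phi>' t y \<noteq> \<phi>' x z" if "z \<in> Y'" for z using inj[of t x y z] 5 t x y that by blast
      moreover have "cyc3 (e a) (e (\<tau> a)) x t = t" using 5 a \<tau>a by (auto simp: cyc3_def)
      ultimately show ?thesis using triv by simp
    qed
  qed
  moreover have "g T = T" if T: "\<nexists>s y. s \<in> S' \<and> y \<in> Y' \<and> T = \<phi>' s y" for T
  proof (cases "\<exists>s y. s \<in> S \<and> \<tau> s \<noteq> s \<and> y \<in> Y \<and> T = \<phi> s y")
    case True
    then obtain s y where sy: "s \<in> S" "\<tau> s \<noteq> s" "y \<in> Y" "T = \<phi> s y" by blast
    have "y \<notin> j ` Y'"
    proof
      assume "y \<in> j ` Y'"
      then obtain z where "z \<in> Y'" "y = j z" by blast
      then have "T = \<phi>' (e s) z" using sy j by simp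
      then show False using T e(1) sy \<open>z \<in> Y'\<close> by blast
    qed
    then show ?thesis using moved sy by blast
  next
    case False
    have "p T = T"
    proof (cases "\<exists>s y. s \<in> S \<and> y \<in> Y \<and> T = \<phi> s y")
      case True
      then show ?thesis using False p_real by metis
    qed (use p_fix in blast)
    then show ?thesis using triv T x by blast
  qed
  ultimately show ?thesis unfolding isolated_def using gG by blast
qed

text \<open>A 3-cycle of the small section need not be isolated on the large one, yet it acts there
  as a 3-cycle on the image of \<open>e\<close> and trivially on new fillings. Conjugation by it
  turns the single cycle through \<open>x\<close> into cycles through \<open>x\<close> and each old
  filling.\<close>

lemma alt_on_extend:
  fixes \<phi> :: "'s \<Rightarrow> 'y \<Rightarrow> 'l" and \<phi>' :: "'t \<Rightarrow> 'z \<Rightarrow> 'l"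
  assumes fin: "finite S'"
    and e: "\<And>s. s \<in> S \<Longrightarrow> e s \<in> S'" "inj_on e S"
    and j: "\<And>y. y \<in> Y' \<Longrightarrow> j y \<in> Y" "\<And>s y. s \<in> S \<Longrightarrow> y \<in> Y' \<Longrightarrow> \<phi>' (e s) y = \<phi> s (j y)"
    and outside: "\<And>x y s z. x \<in> S' - e ` S \<Longrightarrow> y \<in> Y' \<Longrightarrow> s \<in> S \<Longrightarrow> z \<in> Y \<Longrightarrow> \<phi>' x y \<noteq> \<phi> s z"
    and alt: "alt_on \<phi> S Y S"
    and ab: "a \<in> S" "b \<in> S" "a \<noteq> b" and x: "x \<in> S' - e ` S"
    and iso: "isolated \<phi>' S' Y' (cyc3 (e a) (e b) x)"
  shows "alt_on \<phi>' S' Y' (insert x (e ` S))"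
proof -
  have d: "distinct [e a, e b, x]" "{e a, e b, x} \<subseteq> S'"
    using e ab x by (auto simp: inj_on_def)
  have finS: "finite S"
    using fin e finite_imageD[of e S] by (meson finite_subset image_subsetI)
  have "isolated \<phi>' S' Y' (cyc3 (e b) (e a) x)" using isolated_cyc3_rev iso d by metis
  have base: "alt_on \<phi>' S' Y' {e a, e b, x}"
  proof -
    have "alt_on \<phi>' S' Y' {e a, e b}" using d by (auto simp: alt_on_def)
    from alt_on_insert[OF this, of "e a" "e b" x] show ?thesis
      using iso d by (simp add: insert_commute)
  qed
  have "\<exists>u\<in>{e a, e b, x}. \<exists>v\<in>{e a, e b, x}. u \<noteq> v \<and> isolated \<phi>' S' Y' (cyc3 u v w)"
    if w: "w \<in> e ` (S - {a, b})" for w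
  proof -
    obtain s where s: "s \<in> S" "s \<noteq> a" "s \<noteq> b" "w = e s" using w by blast
    have "isolated \<phi> S Y (cyc3 a b s)" using alt_onD[OF alt] ab s by auto
    then obtain f where f: "f \<in> G" "\<And>s' y. s' \<in> S \<Longrightarrow> y \<in> Y \<Longrightarrow> f (\<phi> s' y) = \<phi> (cyc3 a b s s') y"
      "\<And>T. (\<nexists>s y. s \<in> S \<and> y \<in> Y \<and> T = \<phi> s y) \<Longrightarrow> f T = T"
      unfolding isolated_def realizes_def by blast
    have d2: "distinct [e a, e b, e s]" "{e a, e b, e s} \<subseteq> S'"
      using e ab s by (auto simp: inj_on_def)
    have "realizes \<phi>' S' Y' f (cyc3 (e a) (e b) (e s))"
      unfolding realizes_def
    proof (intro ballI)
      fix t y assume ty: "t \<in> S'" "y \<in> Y'"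
      show "f (\<phi>' t y) = \<phi>' (cyc3 (e a) (e b) (e s) t) y"
      proof (cases "t \<in> e ` S")
        case True
        then obtain u where u: "u \<in> S" "t = e u" by blast
        have "cyc3 a b s u \<in> S" using u ab s by (intro cyc3_in) auto
        then have "f (\<phi>' t y) = \<phi>' (e (cyc3 a b s u)) y"
          using u ty j f(2) by simp
        then show ?thesis using cyc3_inj[OF e(2) ab(1,2) s(1) u(1)] u by simp
      next
        case False
        then have "f (\<phi>' t y) = \<phi>' t y" using f(3) outside[of t y] ty by blast
        moreover have "cyc3 (e a) (e b) (e s) t = t" using False ab s by (auto simp: cyc3_def)
        ultimately show ?thesis by simp
      qed
    qed
    from isolated_conj[OF f(1) this cyc3_bij_betw[OF d2] iso d(2)]
    have "isolated \<phi>' S' Y' (cyc3 (cyc3 (e a) (e b) (e s) (e a)) (cyc3 (e a) (e b) (e s) (e b))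
        (cyc3 (e a) (e b) (e s) x))" .
    moreover have "cyc3 (e a) (e b) (e s) (e a) = e b" "cyc3 (e a) (e b) (e s) (e b) = e s"
        "cyc3 (e a) (e b) (e s) x = x"
      using d2 x ab s by (auto simp: cyc3_def)
    ultimately have "isolated \<phi>' S' Y' (cyc3 (e b) (e s) x)" by simp
    moreover have "cyc3 x (e b) (e s) = cyc3 (e b) (e s) x"
      using d d2 x s by (intro cyc3_rotate) auto
    ultimately show ?thesis using d s by auto
  qed
  then have "alt_on \<phi>' S' Y' ({e a, e b, x} \<union> e ` (S - {a, b}))"
    using finS e by (intro alt_on_insert_many base) auto
  moreover have "{e a, e b, x} \<union> e ` (S - {a, b}) = insert x (e ` S)" using ab by auto
  ultimately show ?thesis by simp
qed

text \<open>The commutator gives one 3-cycle, the old 3-cycles enlarge it to the block of old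
  fillings and \<open>x\<close>, and the connecting moves \<open>\<Gamma>\<close> spread this block.
  Each move has to keep some old filling old, so that the block meets its image.\<close>

lemma alt_on_grow:
  fixes \<phi> :: "'s \<Rightarrow> 'y \<Rightarrow> 'l" and \<phi>' :: "'t \<Rightarrow> 'z \<Rightarrow> 'l"
  assumes fin: "finite S'"
    and e: "\<And>s. s \<in> S \<Longrightarrow> e s \<in> S'" "inj_on e S"
    and j: "\<And>y. y \<in> Y' \<Longrightarrow> j y \<in> Y" "\<And>s y. s \<in> S \<Longrightarrow> y \<in> Y' \<Longrightarrow> \<phi>' (e s) y = \<phi> s (j y)"
    and inj: "\<And>s t y z. s \<in> S' \<Longrightarrow> t \<in> S' \<Longrightarrow> y \<in> Y' \<Longrightarrow> z \<in> Y' \<Longrightarrow> \<phi>' s y = \<phi>' t z \<Longrightarrow> s = t"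
    and outside: "\<And>x y s z. x \<in> S' - e ` S \<Longrightarrow> y \<in> Y' \<Longrightarrow> s \<in> S \<Longrightarrow> z \<in> Y \<Longrightarrow> \<phi>' x y \<noteq> \<phi> s z"
    and alt: "alt_on \<phi> S Y S"
    and \<tau>: "bij_betw \<tau> S S" "isolated \<phi> S Y \<tau>"
    and a: "a \<in> S" "\<tau> a \<noteq> a" and x: "x \<in> S' - e ` S"
    and q: "q \<in> G" "\<And>T. q (q T) = T"
      "\<And>y. y \<in> Y' \<Longrightarrow> q (\<phi>' (e a) y) = \<phi>' x y"
      "\<And>y. y \<in> Y \<Longrightarrow> y \<notin> j ` Y' \<Longrightarrow> q (\<phi> a y) = \<phi> a y"
      "\<And>s y. s \<in> S \<Longrightarrow> \<tau> s \<noteq> s \<Longrightarrow> s \<noteq> a \<Longrightarrow> y \<in> Y \<Longrightarrow> q (\<phi> s y) = \<phi> s y"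
    and gens: "\<And>f \<sigma>. (f, \<sigma>) \<in> \<Gamma> \<Longrightarrow> f \<in> G \<and> realizes \<phi>' S' Y' f \<sigma> \<and> bij_betw \<sigma> S' S' \<and>
        (\<exists>s\<in>S. \<sigma> (e s) \<in> e ` S)"
    and conn: "\<And>B. B \<noteq> {} \<Longrightarrow> B \<subseteq> S' \<Longrightarrow> (\<And>f \<sigma>. (f, \<sigma>) \<in> \<Gamma> \<Longrightarrow> \<sigma> ` B \<subseteq> B) \<Longrightarrow> B = S'"
  shows "alt_on \<phi>' S' Y' S'"
proof -
  have \<tau>a: "\<tau> a \<in> S" using \<tau>(1) a by (auto simp: bij_betw_def)
  have iso: "isolated \<phi>' S' Y' (cyc3 (e a) (e (\<tau> a)) x)"
    by (rule isolated_commutator[of S e S' Y' j Y \<phi>' \<phi> \<tau> a x q]) (use assms in auto)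
  have alt': "alt_on \<phi>' S' Y' (insert x (e ` S))"
    by (rule alt_on_extend[of S' S e Y' j Y \<phi>' \<phi> a "\<tau> a" x]) (use assms \<tau>a iso in auto)
  have "{e a, e (\<tau> a), x} \<subseteq> insert x (e ` S)" using a \<tau>a by auto
  moreover have "card {e a, e (\<tau> a), x} = 3"
    using a \<tau>a x e(2) by (auto simp: inj_on_def card_insert_if)
  moreover have "finite (insert x (e ` S))"
    using alt' fin by (meson alt_on_subset finite_subset)
  ultimately have card3: "3 \<le> card (insert x (e ` S))" using card_mono by metis
  show ?thesis
    by (rule alt_on_closure[OF fin alt' card3, of \<Gamma>]) (use gens conn in blast)+
qed

text \<open>For a box whose addition creates no new filling and loses no surrounding: the words of
  the two sections coincide, and only the cut between filling and surrounding moves.\<close>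

lemma alt_on_transport:
  fixes \<phi> :: "'s \<Rightarrow> 'y \<Rightarrow> 'l" and \<phi>' :: "'t \<Rightarrow> 'z \<Rightarrow> 'l"
  assumes e: "bij_betw e S S'"
    and j: "bij_betw j Y' Y" "\<And>s y. s \<in> S \<Longrightarrow> y \<in> Y' \<Longrightarrow> \<phi>' (e s) y = \<phi> s (j y)"
    and alt: "alt_on \<phi> S Y S"
  shows "alt_on \<phi>' S' Y' S'"
  unfolding alt_on_def
proof (intro conjI ballI impI)
  fix x y z assume xyz: "x \<in> S'" "y \<in> S'" "z \<in> S'" "distinct [x, y, z]"
  have inj: "inj_on e S" using e by (simp add: bij_betw_def)
  obtain a b c where abc: "a \<in> S" "b \<in> S" "c \<in> S" "x = e a" "y = e b" "z = e c"
    using e xyz by (auto simp: bij_betw_def)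
  then have "isolated \<phi> S Y (cyc3 a b c)" using xyz alt_onD[OF alt] by auto
  then obtain f where f: "f \<in> G" "\<And>s' y. s' \<in> S \<Longrightarrow> y \<in> Y \<Longrightarrow> f (\<phi> s' y) = \<phi> (cyc3 a b c s') y"
      "\<And>T. (\<nexists>s y. s \<in> S \<and> y \<in> Y \<and> T = \<phi> s y) \<Longrightarrow> f T = T"
    unfolding isolated_def realizes_def by blast
  have "realizes \<phi>' S' Y' f (cyc3 x y z)"
    unfolding realizes_def
  proof (intro ballI)
    fix t w assume tw: "t \<in> S'" "w \<in> Y'"
    then obtain u where u: "u \<in> S" "t = e u" using e by (auto simp: bij_betw_def)
    have "cyc3 a b c u \<in> S" using u abc by (intro cyc3_in) auto
    moreover have "j w \<in> Y" using j tw by (auto simp: bij_betw_def)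
    ultimately have "f (\<phi>' t w) = \<phi>' (e (cyc3 a b c u)) w" using u tw j f(2) by simp
    then show "f (\<phi>' t w) = \<phi>' (cyc3 x y z t) w"
      using cyc3_inj[OF inj abc(1-3) u(1)] u abc by simp
  qed
  moreover have "f T = T" if T: "\<nexists>s y. s \<in> S' \<and> y \<in> Y' \<and> T = \<phi>' s y" for T
  proof (rule f(3), rule notI)
    assume "\<exists>s y. s \<in> S \<and> y \<in> Y \<and> T = \<phi> s y"
    then obtain s y where sy: "s \<in> S" "y \<in> Y" "T = \<phi> s y" by blast
    then obtain w where "w \<in> Y'" "y = j w" using j by (auto simp: bij_betw_def)
    then have "T = \<phi>' (e s) w" using sy j by simp
    moreover have "e s \<in> S'" using sy e by (auto simp: bij_betw_def)
    ultimately show False using T \<open>w \<in> Y'\<close> by blast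
  qed
  ultimately show "isolated \<phi>' S' Y' (cyc3 x y z)" unfolding isolated_def using f(1) by blast
qed simp

end

section \<open>Fillings as words of boxes\<close>

type_synonym box = "int \<times> int"

definition below :: "box \<Rightarrow> box \<Rightarrow> bool" where
  "below x y \<longleftrightarrow> fst x \<le> fst y \<and> snd x \<le> snd y \<and> x \<noteq> y"

definition content :: "box \<Rightarrow> int" where
  "content x = snd x - fst x"

text \<open>Places count from 0 and entries from 1, so for \<open>b \<ge> 2\<close> this is the word
  version of the generator with \<open>t = n + 1\<close> and \<open>a = b\<close>. Words that are
  too short are left alone.\<close>

definition swap_at :: "nat \<Rightarrow> int \<Rightarrow> box list \<Rightarrow> box list" where
  "swap_at n b w = (if Suc n < length w \<and> \<bar>content (w ! n) - content (w ! Suc n)\<bar> = b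
     then take n w @ w ! Suc n # w ! n # drop (Suc (Suc n)) w else w)"

lemma swap_at_append:
  "length P = n \<Longrightarrow> swap_at n b (P @ x # y # Q) =
     (if \<bar>content x - content y\<bar> = b then P @ y # x # Q else P @ x # y # Q)"
  by (auto simp: swap_at_def nth_append)

lemma swap_at_short: "\<not> Suc n < length w \<Longrightarrow> swap_at n b w = w"
  by (auto simp: swap_at_def)

lemma split_at_pair:
  assumes "Suc n < length w"
  obtains P x y Q where "w = P @ x # y # Q" "length P = n"
proof -
  have "w = take n w @ w ! n # w ! Suc n # drop (Suc (Suc n)) w"
    using assms by (metis Cons_nth_drop_Suc Suc_lessD append_take_drop_id)
  then show ?thesis using that[of "take n w"] assms by auto
qed

lemma swap_at_swap_at: "swap_at n b (swap_at n b w) = w"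
proof (cases "Suc n < length w")
  case True
  then obtain P x y Q where "w = P @ x # y # Q" "length P = n" by (rule split_at_pair)
  then show ?thesis by (auto simp: swap_at_append abs_minus_commute)
qed (simp add: swap_at_short)

lemma swap_at_context:
  assumes "Suc n < length w"
  shows "P @ swap_at n b w @ Q = swap_at (length P + n) b (P @ w @ Q)"
proof -
  obtain U x y V where w: "w = U @ x # y # V" "length U = n"
    using assms by (rule split_at_pair)
  have "P @ w @ Q = (P @ U) @ x # y # (V @ Q)" using w by simp
  then show ?thesis using w swap_at_append[of "P @ U" "length P + n" b x y "V @ Q"]
    by (auto simp: swap_at_append)
qed

locale skew_shape =
  fixes D :: "box set"
  assumes finite_shape: "finite D"
    and convex: "x \<in> D \<Longrightarrow> z \<in> D \<Longrightarrow> fst x \<le> fst y \<Longrightarrow> fst y \<le> fst z \<Longrightarrow> snd x \<le> snd y \<Longrightarrow>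
       snd y \<le> snd z \<Longrightarrow> y \<in> D"
begin

definition ready :: "box \<Rightarrow> box set \<Rightarrow> bool" where
  "ready x I \<longleftrightarrow> x \<in> D \<and> x \<notin> I \<and> (\<forall>y\<in>D. below y x \<longrightarrow> y \<in> I)"

definition ideal :: "box set \<Rightarrow> bool" where
  "ideal I \<longleftrightarrow> I \<subseteq> D \<and> (\<forall>x\<in>I. \<forall>y\<in>D. below y x \<longrightarrow> y \<in> I)"

fun ext :: "box set \<Rightarrow> box list \<Rightarrow> bool" where
  "ext I [] = True"
| "ext I (x # A) = (ready x I \<and> ext (insert x I) A)"

text \<open>The standard fillings of \<open>J - I\<close>, written as the list of boxes in the order of their entries.\<close>
definition LE :: "box set \<Rightarrow> box set \<Rightarrow> box list set" where
  "LE I J = {A. ext I A \<and> I \<union> set A = J}"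

lemma ext_append: "ext I (A @ B) \<longleftrightarrow> ext I A \<and> ext (I \<union> set A) B"
  by (induction A arbitrary: I) auto

lemma LE_Nil [simp]: "[] \<in> LE I J \<longleftrightarrow> I = J"
  by (simp add: LE_def)

lemma LE_Cons [simp]: "x # A \<in> LE I J \<longleftrightarrow> ready x I \<and> A \<in> LE (insert x I) J"
  by (auto simp: LE_def)

lemma LE_append_iff: "A @ B \<in> LE I K \<longleftrightarrow> A \<in> LE I (I \<union> set A) \<and> B \<in> LE (I \<union> set A) K"
  by (auto simp: LE_def ext_append Un_assoc)

lemma LE_D: "A \<in> LE I J \<Longrightarrow> I \<union> set A = J"
  by (simp add: LE_def)

lemma LE_append: "A \<in> LE I J \<Longrightarrow> B \<in> LE J K \<Longrightarrow> A @ B \<in> LE I K"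
  using LE_D[of A I J] LE_append_iff[of A B I K] by simp

lemma ext_distinct: "ext I A \<Longrightarrow> set A \<inter> I = {} \<and> distinct A \<and> set A \<subseteq> D"
  by (induction A arbitrary: I) (auto simp: ready_def)

lemma LE_distinct: "A \<in> LE I J \<Longrightarrow> set A \<inter> I = {} \<and> distinct A \<and> set A \<subseteq> D"
  using ext_distinct[of I A] by (simp add: LE_def)

lemma finite_ideal: "ideal I \<Longrightarrow> finite I"
  using finite_shape finite_subset by (auto simp: ideal_def)

lemma ideal_insert: "ideal I \<Longrightarrow> ready x I \<Longrightarrow> ideal (insert x I)"
  by (auto simp: ideal_def ready_def)

lemma ideal_empty [simp]: "ideal {}"
  by (simp add: ideal_def)

lemma ideal_shape [simp]: "ideal D"
  by (simp add: ideal_def)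

lemma ideal_ext: "ideal I \<Longrightarrow> ext I A \<Longrightarrow> ideal (I \<union> set A)"
proof (induction A arbitrary: I)
  case (Cons x A)
  then show ?case using ideal_insert[of I x] by (auto dest: Cons.IH)
qed simp

lemma LE_card: "finite I \<Longrightarrow> A \<in> LE I J \<Longrightarrow> card J = card I + length A"
  using LE_distinct[of A I J] LE_D[of A I J]
  by (metis List.finite_set card_Un_disjoint distinct_card inf_commute)

lemma finite_LE: "finite (LE I J)"
proof (rule finite_subset)
  show "LE I J \<subseteq> {xs. set xs \<subseteq> D \<and> distinct xs}"
    using LE_distinct by blast
  show "finite {xs. set xs \<subseteq> D \<and> distinct xs}"
    using finite_shape by (rule finite_subset_distinct)
qed

lemma LE_exists:
  assumes "ideal I" "ideal J" "I \<subseteq> J"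
  shows "\<exists>A. A \<in> LE I J"
  using assms
proof (induction "card (J - I)" arbitrary: I)
  case 0
  then have "I = J" using finite_ideal[of J] by auto
  then show ?case by (intro exI[of _ "[]"]) simp
next
  case (Suc n)
  then have ne: "J - I \<noteq> {}" by (metis card.empty nat.distinct(1))
  have fin: "finite (J - I)" using finite_ideal Suc by auto
  define x where "x = arg_min_on (\<lambda>x. fst x + snd x) (J - I)"
  have x: "x \<in> J - I"
    unfolding x_def by (rule arg_min_if_finite(1)[OF fin ne])
  have min: "fst x + snd x \<le> fst y + snd y" if "y \<in> J - I" for y
    using arg_min_least[OF fin ne that, of "\<lambda>x. fst x + snd x"] unfolding x_def .
  have r: "ready x I"
    unfolding ready_def
  proof (intro conjI ballI impI)
    show "x \<in> D" "x \<notin> I" using x Suc.prems by (auto simp: ideal_def)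
    fix y assume y: "y \<in> D" "below y x"
    then have "y \<in> J" using x Suc.prems by (auto simp: ideal_def)
    moreover have "fst y + snd y < fst x + snd x" using y by (auto simp: below_def prod_eq_iff)
    ultimately show "y \<in> I" using min[of y] by fastforce
  qed
  have "n = card (J - insert x I)"
    by (metis Diff_insert Suc.hyps(2) card_Diff_singleton diff_Suc_1 x)
  then obtain A where "A \<in> LE (insert x I) J"
    using Suc.hyps(1)[OF _ ideal_insert[OF Suc.prems(1) r] Suc.prems(2)] Suc.prems(3) x by blast
  then show ?case using r by (intro exI[of _ "x # A"]) simp
qed

text \<open>Two boxes that can both be added next are incomparable, so row and column differ in
  opposite directions and both differences count.\<close>

lemma ready_content:
  assumes "ready x K" "ready y K" "x \<noteq> y"
  shows "2 \<le> \<bar>content x - content y\<bar>"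
proof -
  have "\<not> below x y" "\<not> below y x" using assms by (auto simp: ready_def)
  then show ?thesis using assms(3) by (cases x; cases y) (auto simp: below_def content_def)
qed

text \<open>Comparable consecutive letters of a word must be neighbouring boxes: otherwise convexity
  supplies a box strictly between them, which would have to be filled between two consecutive times.
  Neighbouring boxes have contents differing by 1.\<close>

lemma swap_ready:
  assumes "ideal I" "ready x I" "ready y (insert x I)" "2 \<le> \<bar>content x - content y\<bar>"
  shows "ready y I \<and> ready x (insert y I)"
proof -
  have "\<not> below x y"
  proof
    assume b: "below x y"
    obtain i j k l where xy: "x = (i, j)" "y = (k, l)" by (cases x, cases y) auto
    have inD: "x \<in> D" "y \<in> D" using assms by (auto simp: ready_def)
    have le: "i \<le> k" "j \<le> l" using b xy by (auto simp: below_def)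
    \<comment> \<open>The box in between is the neighbour of \<open>x\<close> towards
      \<open>y\<close> on a common line, or else a corner of the rectangle spanned by them.\<close>
    have "\<exists>u\<in>D. below x u \<and> below u y"
    proof (cases "i = k \<or> j = l")
      case True
      define u where "u = (if i = k then (i, j + 1) else (i + 1, j))"
      have "2 \<le> l - j \<or> 2 \<le> k - i" "i = k \<longrightarrow> 2 \<le> l - j" "i \<noteq> k \<longrightarrow> 2 \<le> k - i"
        using True assms(4) xy le by (auto simp: content_def)
      moreover from this have "u \<in> D"
        using convex[OF inD, of u] xy le True by (auto simp: u_def)
      ultimately show ?thesis
        using xy le True by (intro bexI[of _ u]) (auto simp: below_def u_def)
    next
      case False
      then have "(i, l) \<in> D" using convex[OF inD, of "(i, l)"] xy le by simp
      then show ?thesis using False xy le by (intro bexI[of _ "(i, l)"]) (auto simp: below_def)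
    qed
    then obtain u where u: "u \<in> D" "below x u" "below u y" by blast
    then have "u \<in> insert x I" using assms(3) by (auto simp: ready_def)
    then have "u \<in> I" using u by (auto simp: below_def)
    then have "x \<in> I" using assms(1) u inD by (auto simp: ideal_def)
    then show False using assms(2) by (simp add: ready_def)
  qed
  then show ?thesis using assms(2,3) by (auto simp: ready_def)
qed

lemma LE_swap:
  assumes "ideal I" "U @ x # y # V \<in> LE I J" "2 \<le> \<bar>content x - content y\<bar>"
  shows "U @ y # x # V \<in> LE I J"
proof -
  have "ideal (I \<union> set U)" using assms ideal_ext by (auto simp: LE_def ext_append)
  then have "ready y (I \<union> set U) \<and> ready x (insert y (I \<union> set U))"
    using swap_ready[of "I \<union> set U" x y] assms by (auto simp: LE_append_iff)
  then show ?thesis using assms(2) by (auto simp: LE_append_iff insert_commute)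
qed

lemma swap_at_LE:
  assumes "ideal I" "A \<in> LE I J" "2 \<le> b"
  shows "swap_at n b A \<in> LE I J"
proof (cases "Suc n < length A")
  case True
  then obtain P x y Q where "A = P @ x # y # Q" "length P = n" by (rule split_at_pair)
  then show ?thesis using assms LE_swap by (auto simp: swap_at_append)
qed (use assms in \<open>simp add: swap_at_short\<close>)

text \<open>As \<open>x\<close> can be added from the start, each letter in front of it is addable
  at the same moment as \<open>x\<close>; so every exchange on the way is between contents at least
  2 apart.\<close>

lemma bubble_front:
  assumes I: "ideal I" and x: "ready x I"
    and swap: "\<And>U x y V. Pr (U @ x # y # V) \<Longrightarrow> U @ x # y # V \<in> LE I J \<Longrightarrow>
        2 \<le> \<bar>content x - content y\<bar> \<Longrightarrow> Pr (U @ y # x # V)"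
  shows "Pr (U @ x # V) \<Longrightarrow> U @ x # V \<in> LE I J \<Longrightarrow> Pr (x # U @ V) \<and> x # U @ V \<in> LE I J"
proof (induction U arbitrary: V rule: rev_induct)
  case (snoc u U)
  have "ready u (I \<union> set U)" using snoc.prems(2) by (simp add: LE_append_iff)
  moreover have "ready x (I \<union> set U)"
    using x snoc.prems(2) LE_distinct[OF snoc.prems(2)] by (auto simp: ready_def)
  moreover have "u \<noteq> x" using LE_distinct[OF snoc.prems(2)] by auto
  ultimately have c: "2 \<le> \<bar>content u - content x\<bar>" by (rule ready_content)
  have "Pr (U @ x # u # V)" using swap[of U u x V] snoc.prems c by simp
  moreover have "U @ x # u # V \<in> LE I J" using LE_swap[OF I _ c, of U V J] snoc.prems by simp
  ultimately show ?case using snoc.IH[of "u # V"] by simp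
qed simp

text \<open>The classical connectedness of linear extensions under adjacent exchanges. It is phrased
  for invariant predicates so that the induction can restrict \<open>P\<close> to words with a fixed
  first letter.\<close>

lemma LE_connected_pred:
  assumes "A' \<in> LE I J" "A \<in> LE I J" "ideal I" "P A"
    and "\<And>U x y V. P (U @ x # y # V) \<Longrightarrow> U @ x # y # V \<in> LE I J \<Longrightarrow>
        2 \<le> \<bar>content x - content y\<bar> \<Longrightarrow> P (U @ y # x # V)"
  shows "P A'"
  using assms
proof (induction A' arbitrary: I A P)
  case Nil
  then have "I = J" by simp
  then have "A = []" using LE_D[OF Nil(2)] LE_distinct[OF Nil(2)] by (cases A) auto
  then show ?case using Nil by simp
next
  case (Cons x A')
  have r: "ready x I" and A': "A' \<in> LE (insert x I) J" using Cons.prems by auto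
  have "x \<in> I \<union> set A" using LE_D[OF Cons.prems(1)] LE_D[OF Cons.prems(2)] by auto
  then have "x \<in> set A" using r by (auto simp: ready_def)
  then obtain U V where UV: "A = U @ x # V" by (meson split_list)
  have f: "P (x # U @ V) \<and> x # U @ V \<in> LE I J"
    by (rule bubble_front[where Pr = P, OF Cons.prems(3) r Cons.prems(5)]) (use Cons.prems(2,4) UV in auto)
  show ?case
  proof (rule Cons.IH[OF A', of "U @ V" "\<lambda>B. P (x # B)"])
    show "U @ V \<in> LE (insert x I) J" "P (x # U @ V)" using f by auto
    show "ideal (insert x I)" using ideal_insert Cons.prems(3) r by blast
    fix U x' y V
    assume "P (x # U @ x' # y # V)" "U @ x' # y # V \<in> LE (insert x I) J" "2 \<le> \<bar>content x' - content y\<bar>"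
    then show "P (x # U @ y # x' # V)" using Cons.prems(5)[of "x # U" x' y V] r by simp
  qed
qed

lemma LE_connected:
  assumes "ideal I" "B \<subseteq> LE I J" "B \<noteq> {}"
    and sw: "\<And>n b. 2 \<le> b \<Longrightarrow> swap_at n b ` B \<subseteq> B"
  shows "B = LE I J"
proof -
  obtain A where A: "A \<in> B" using assms(3) by blast
  have "A' \<in> B" if A': "A' \<in> LE I J" for A'
  proof (rule LE_connected_pred[OF A' _ assms(1), where P = "\<lambda>X. X \<in> B"])
    show "A \<in> LE I J" "A \<in> B" using A assms(2) by auto
    fix U x y V
    assume "U @ x # y # V \<in> B" "2 \<le> \<bar>content x - content y\<bar>"
    then have "swap_at (length U) \<bar>content x - content y\<bar> (U @ x # y # V) \<in> B"
      using sw by blast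
    then show "U @ y # x # V \<in> B"
      by (simp add: swap_at_append[OF refl])
  qed
  then show ?thesis using assms(2) by blast
qed

text \<open>Supplies the two companions needed for a 3-cycle: after a filling of
  \<open>J - I\<close> the boxes \<open>x\<close> and \<open>y\<close> are added in either
  order.\<close>

lemma two_LE:
  assumes "ideal I" "ideal J" "ideal K" "I \<subseteq> J" "ready x J" "ready y J" "x \<noteq> y" "x \<in> K" "y \<in> K" "J \<subseteq> K"
  obtains A B where "A \<in> LE I K" "B \<in> LE I K" "A \<noteq> B"
proof -
  obtain U where U: "U \<in> LE I J" using LE_exists assms by blast
  have xy: "ready x (insert y J)" "ready y (insert x J)" using assms by (auto simp: ready_def)
  have "ideal (insert y (insert x J))" using ideal_insert assms xy by blast
  then obtain V where V: "V \<in> LE (insert y (insert x J)) K" using LE_exists assms by blast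
  have "x # y # V \<in> LE J K" "y # x # V \<in> LE J K"
    using V xy assms by (auto simp: insert_commute)
  then have "U @ x # y # V \<in> LE I K" "U @ y # x # V \<in> LE I K"
    using U LE_append by blast+
  then show ?thesis using that \<open>x \<noteq> y\<close> by blast
qed

end

section \<open>The group on words, and the extension of a section by one box\<close>

locale tableau_group = skew_shape D + transformation_group G
  for D and G :: "('l \<Rightarrow> 'l) set" +
  fixes tab :: "box list \<Rightarrow> 'l"
  assumes tab_inj: "inj_on tab (LE {} D)"
    and swap_in_group: "2 \<le> b \<Longrightarrow> \<exists>f\<in>G. (\<forall>w\<in>LE {} D. f (tab w) = tab (swap_at n b w)) \<and>
        (\<forall>T. T \<notin> tab ` LE {} D \<longrightarrow> f T = T)"
begin

definition fill :: "box list \<Rightarrow> box list \<times> box list \<Rightarrow> 'l" where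
  "fill A y = tab (fst y @ A @ snd y)"

definition ctx :: "box set \<Rightarrow> box set \<Rightarrow> (box list \<times> box list) set" where
  "ctx I J = LE {} I \<times> LE J D"

definition good :: "box set \<Rightarrow> box set \<Rightarrow> bool" where
  "good I J \<longleftrightarrow> alt_on fill (LE I J) (ctx I J) (LE I J)"

lemma fill_word: "A \<in> LE I J \<Longrightarrow> y \<in> ctx I J \<Longrightarrow> fst y @ A @ snd y \<in> LE {} D"
  using LE_append[OF _ LE_append, of "fst y" "{}" I A J "snd y" D] by (auto simp: ctx_def)

lemma fill_eq:
  assumes "A \<in> LE I J" "y \<in> ctx I J" "B \<in> LE K L" "z \<in> ctx K L" "fill A y = fill B z"
  shows "fst y @ A @ snd y = fst z @ B @ snd z"
  using assms tab_inj fill_word by (auto simp: fill_def inj_on_def)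

lemma ctx_length:
  assumes "y \<in> ctx I J" "ideal J"
  shows "length (fst y) = card I" "length (snd y) = card D - card J"
  using assms LE_card[of "{}" "fst y" I] LE_card[of J "snd y" D] finite_ideal by (auto simp: ctx_def)

lemma fill_inj:
  assumes "A \<in> LE I J" "B \<in> LE I J" "y \<in> ctx I J" "z \<in> ctx I J" "fill A y = fill B z" "ideal J"
  shows "A = B"
proof -
  have "length (fst y) = length (fst z)" "length (snd y) = length (snd z)"
    using assms ctx_length by metis+
  then show ?thesis using fill_eq[OF assms(1,3,2,4,5)] by auto
qed

text \<open>The generators that act between two places inside the section, paired with their effect
  on fillings; \<open>card I\<close> is the length of the prefix. They are the connecting moves of
  \<open>alt_on_grow\<close>.\<close>

definition swappers :: "box set \<Rightarrow> nat \<Rightarrow> (('l \<Rightarrow> 'l) \<times> (box list \<Rightarrow> box list)) set" where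
  "swappers I l = {(f, swap_at n b) | f n b. 2 \<le> b \<and> Suc n < l \<and> f \<in> G \<and>
      (\<forall>w\<in>LE {} D. f (tab w) = tab (swap_at (card I + n) b w))}"

lemma swappers_realize:
  assumes "ideal I" "ideal J" "(f, \<sigma>) \<in> swappers I l" "\<And>A. A \<in> LE I J \<Longrightarrow> length A = l"
  shows "f \<in> G \<and> realizes fill (LE I J) (ctx I J) f \<sigma> \<and> bij_betw \<sigma> (LE I J) (LE I J)"
proof -
  obtain n b where nb: "\<sigma> = swap_at n b" "2 \<le> b" "Suc n < l" "f \<in> G"
      "\<And>w. w \<in> LE {} D \<Longrightarrow> f (tab w) = tab (swap_at (card I + n) b w)"
    using assms(3) by (auto simp: swappers_def)
  have "realizes fill (LE I J) (ctx I J) f \<sigma>"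
    unfolding realizes_def
  proof (intro ballI)
    fix A y assume A: "A \<in> LE I J" and y: "y \<in> ctx I J"
    show "f (fill A y) = fill (\<sigma> A) y"
      using nb fill_word[OF A y] swap_at_context[of n A "fst y" b "snd y"] assms(4)[OF A]
        ctx_length(1)[OF y assms(2)] by (simp add: fill_def)
  qed
  moreover have "bij_betw \<sigma> (LE I J) (LE I J)"
    unfolding nb(1) by (rule bij_betw_byWitness[where f' = "swap_at n b"])
      (use swap_at_LE assms nb swap_at_swap_at in auto)
  ultimately show ?thesis using nb by blast
qed

lemma swappers_connected:
  assumes "ideal I" "\<And>A. A \<in> LE I J \<Longrightarrow> length A = l" "B \<noteq> {}" "B \<subseteq> LE I J"
    and cl: "\<And>f \<sigma>. (f, \<sigma>) \<in> swappers I l \<Longrightarrow> \<sigma> ` B \<subseteq> B"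
  shows "B = LE I J"
proof (rule LE_connected[OF assms(1,4,3)])
  fix n :: nat and b :: int assume b: "2 \<le> b"
  show "swap_at n b ` B \<subseteq> B"
  proof (cases "Suc n < l")
    case True
    obtain f where "f \<in> G" "\<forall>w\<in>LE {} D. f (tab w) = tab (swap_at (card I + n) b w)"
      using swap_in_group[OF b] by blast
    then have "(f, swap_at n b) \<in> swappers I l" using b True by (auto simp: swappers_def)
    then show ?thesis by (rule cl)
  next
    case False
    then show ?thesis using assms(2,4) swap_at_short by (metis image_subsetI subsetD)
  qed
qed

lemma swap_involution:
  assumes "2 \<le> b"
  obtains q where "q \<in> G" "\<And>w. w \<in> LE {} D \<Longrightarrow> q (tab w) = tab (swap_at n b w)" "\<And>T. q (q T) = T"
proof -
  obtain q where q: "q \<in> G" "\<And>w. w \<in> LE {} D \<Longrightarrow> q (tab w) = tab (swap_at n b w)"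
      "\<And>T. T \<notin> tab ` LE {} D \<Longrightarrow> q T = T"
    using swap_in_group[OF assms, of n] by blast
  have "q (q T) = T" for T
  proof (cases "T \<in> tab ` LE {} D")
    case True
    then show ?thesis using q(2) swap_at_LE assms swap_at_swap_at by (auto simp: LE_Nil)
  qed (use q(3) in simp)
  then show ?thesis using that q by blast
qed

text \<open>The commutator is taken with the exchange across the right end of the section. Among the
  fillings moved by \<open>\<tau>\<close> and the boxes that can follow, distance \<open>b\<close>
  occurs only for \<open>A1\<close> followed by \<open>v\<close>, so the exchange affects no other
  moved point.\<close>

lemma grow_right:
  assumes I: "ideal I" and J: "ideal J" and v: "ready v J"
    and alt: "good I J"
    and A1: "A1 \<in> LE I J" "A1 \<noteq> []"
    and \<tau>: "bij_betw \<tau> (LE I J) (LE I J)" "isolated fill (LE I J) (ctx I J) \<tau>" "\<tau> A1 \<noteq> A1"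
    and b: "b = \<bar>content (last A1) - content v\<bar>" "2 \<le> b"
    and other: "\<And>u. ready u J \<Longrightarrow> u \<noteq> v \<Longrightarrow> \<bar>content (last A1) - content u\<bar> \<noteq> b"
    and moved: "\<And>A u. A \<in> LE I J \<Longrightarrow> \<tau> A \<noteq> A \<Longrightarrow> A \<noteq> A1 \<Longrightarrow> ready u J \<Longrightarrow> \<bar>content (last A) - content u\<bar> \<noteq> b"
  shows "good I (insert v J)"
proof -
  let ?J = "insert v J" and ?e = "\<lambda>A. A @ [v]" and ?j = "\<lambda>y. (fst y, v # snd y)"
  define l where "l = length A1"
  have J': "ideal ?J" using ideal_insert J v by blast
  have IJ: "I \<subseteq> J" using LE_D[OF A1(1)] by blast
  have fin: "finite I" "finite J" using finite_ideal I J by auto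
  have vJ: "v \<notin> J" "v \<in> D" using v by (auto simp: ready_def)
  have len: "length A = l" if "A \<in> LE I J" for A
    using LE_card[OF fin(1) that] LE_card[OF fin(1) A1(1)] by (simp add: l_def)
  have l0: "0 < l" using A1 by (simp add: l_def)
  have cJ: "card J = card I + l" using LE_card[OF fin(1) A1(1)] by (simp add: l_def)
  have len': "length A = Suc l" if "A \<in> LE I ?J" for A
    using LE_card[OF fin(1) that] cJ fin vJ by simp
  have eS: "?e A \<in> LE I ?J" if "A \<in> LE I J" for A
    using that v by (intro LE_append[of A I J]) auto
  have snoc: "u = v" if "A \<in> LE I J" "A @ [u] \<in> LE I ?J" for A u
    using LE_D[OF that(1)] LE_D[OF that(2)] LE_distinct[OF that(2)] vJ by auto
  obtain B h where Bh: "A1 = B @ [h]" using A1(2) by (meson rev_exhaust)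
  have hv: "2 \<le> \<bar>content h - content v\<bar>" "\<bar>content h - content v\<bar> = b" using b Bh by auto
  \<comment> \<open>The new filling: \<open>v\<close> slips in before the last letter of
    \<open>A1\<close>.\<close>
  define x where "x = B @ [v, h]"
  have x: "x \<in> LE I ?J - ?e ` LE I J"
  proof
    show "x \<in> LE I ?J" using LE_swap[OF I _ hv(1), of B "[]" ?J] eS[OF A1(1)] Bh by (simp add: x_def)
    have "h \<in> J" using LE_D[OF A1(1)] Bh by auto
    then have "h \<noteq> v" using vJ by blast
    then show "x \<notin> ?e ` LE I J" by (auto simp: x_def)
  qed
  \<comment> \<open>Counted from 0, \<open>card J - 1\<close> is the last place of the section; the
    exchange concerns it and the first letter of the suffix.\<close>
  obtain q where q: "q \<in> G" "\<And>w. w \<in> LE {} D \<Longrightarrow> q (tab w) = tab (swap_at (card J - 1) b w)"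
      "\<And>T. q (q T) = T"
    using swap_involution[OF b(2)] by metis
  have q_fill: "q (fill (A @ [a]) (P, u # Q)) =
      (if \<bar>content a - content u\<bar> = b then fill (A @ [u, a]) (P, Q) else fill (A @ [a]) (P, u # Q))"
    if "A @ [a] \<in> LE I J" "(P, u # Q) \<in> ctx I J" for A a P u Q
  proof -
    have "length (P @ A) = card J - 1"
      using len[OF that(1)] cJ ctx_length(1)[OF that(2) J] by simp
    from swap_at_append[OF this, of b a u Q] show ?thesis
      using q(2)[OF fill_word[OF that]] by (auto simp: fill_def)
  qed
  have Q_Cons: "\<exists>P u Q. y = (P, u # Q) \<and> ready u J" if y: "y \<in> ctx I J" for y
  proof -
    have "snd y \<noteq> []" using y vJ LE_D[of "snd y" J D] by (auto simp: ctx_def)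
    then obtain u Q where "snd y = u # Q" by (meson neq_Nil_conv)
    then show ?thesis using y by (cases y) (auto simp: ctx_def)
  qed
  have snocE: "\<exists>A' a. A = A' @ [a]" if "A \<in> LE I J" for A
    using len[OF that] l0 by (metis length_0_conv neq0_conv rev_exhaust)
  have \<tau>A1: "\<tau> A1 \<in> LE I J" "\<tau> (\<tau> A1) \<noteq> \<tau> A1"
    using \<tau>(1,3) A1(1) by (auto simp: bij_betw_def inj_on_def)
  have "alt_on fill (LE I ?J) (ctx I ?J) (LE I ?J)"
  proof (rule alt_on_grow[where e = ?e and j = ?j and \<tau> = \<tau> and a = A1 and x = x and q = q
        and \<Gamma> = "swappers I (Suc l)"])
    show "finite (LE I ?J)" by (rule finite_LE)
    show "inj_on ?e (LE I J)" by (simp add: inj_on_def)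
    show "\<And>y. y \<in> ctx I ?J \<Longrightarrow> ?j y \<in> ctx I J" using v by (auto simp: ctx_def)
    show "\<And>A y. fill (?e A) y = fill A (?j y)" by (simp add: fill_def)
    show "s = t" if "s \<in> LE I ?J" "t \<in> LE I ?J" "y \<in> ctx I ?J" "z \<in> ctx I ?J" "fill s y = fill t z" for s t y z
      using fill_inj[OF that J'] .
    show "fill X y \<noteq> fill s z"
      if "X \<in> LE I ?J - ?e ` LE I J" "y \<in> ctx I ?J" "s \<in> LE I J" "z \<in> ctx I J" for X y s z
    proof
      assume "fill X y = fill s z"
      then have eq: "fst y @ X @ snd y = fst z @ s @ snd z"
        using fill_eq that by blast
      moreover have "length (fst y) = length (fst z)"
        using ctx_length(1) that J J' by metis
      ultimately have eq: "X @ snd y = s @ snd z" by simp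
      have "X \<noteq> []" using len'[of X] that(1) by auto
      then obtain X' u where X: "X = X' @ [u]" by (meson rev_exhaust)
      have "length X' = length s" using len len' that X by fastforce
      then have "X' = s" using eq X by simp
      then show False using snoc[of s u] that X by blast
    qed
    show "alt_on fill (LE I J) (ctx I J) (LE I J)" using alt by (simp add: good_def)
    show "q (fill (?e A1) y) = fill x y" if y: "y \<in> ctx I ?J" for y
    proof -
      have "(fst y, v # snd y) \<in> ctx I J" using y v by (auto simp: ctx_def)
      from q_fill[of B h, OF _ this] show ?thesis using A1 Bh hv by (simp add: fill_def x_def)
    qed
    show "q (fill A1 y) = fill A1 y" if yc: "y \<in> ctx I J" and yj: "y \<notin> ?j ` ctx I ?J" for y
    proof -
      obtain P u Q where y: "y = (P, u # Q)" "ready u J" using Q_Cons[OF yc] by blast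
      have "u \<noteq> v"
      proof
        assume "u = v"
        then have "(P, Q) \<in> ctx I ?J" using yc y by (auto simp: ctx_def)
        then show False using yj y \<open>u = v\<close> by force
      qed
      then show ?thesis using q_fill[of B h P u Q] A1(1) Bh y other[of u] yc by simp
    qed
    show "q (fill A y) = fill A y" if that': "A \<in> LE I J" "\<tau> A \<noteq> A" "A \<noteq> A1" "y \<in> ctx I J" for A y
    proof -
      obtain P u Q where y: "y = (P, u # Q)" "ready u J" using Q_Cons[OF that'(4)] by blast
      obtain A' a where A: "A = A' @ [a]" using snocE[OF that'(1)] by blast
      then show ?thesis using q_fill[of A' a P u Q] y moved[OF that'(1,2,3) y(2)] that' by simp
    qed
    show "f \<in> G \<and> realizes fill (LE I ?J) (ctx I ?J) f \<sigma> \<and> bij_betw \<sigma> (LE I ?J) (LE I ?J) \<and>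
        (\<exists>s\<in>LE I J. \<sigma> (?e s) \<in> ?e ` LE I J)" if f: "(f, \<sigma>) \<in> swappers I (Suc l)" for f \<sigma>
    proof -
      obtain n c where n: "\<sigma> = swap_at n c" "2 \<le> c" "n < l" using f by (auto simp: swappers_def)
      \<comment> \<open>An exchange inside keeps \<open>v\<close> last. At the right end, distance
        \<open>b\<close> spares \<open>\<tau> A1\<close> by \<open>moved\<close>, and every other
        distance spares \<open>A1\<close>.\<close>
      have "\<exists>s\<in>LE I J. \<sigma> (?e s) \<in> ?e ` LE I J"
      proof (cases "Suc n < l")
        case True
        then have "\<sigma> (?e A1) = ?e (swap_at n c A1)"
          using swap_at_context[of n A1 "[]" c "[v]"] n by (simp add: l_def)
        then show ?thesis using swap_at_LE[OF I A1(1) n(2), of n] A1(1) by auto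
      next
        case False
        then have nl: "Suc n = l" using n by simp
        have fixed: "\<sigma> (?e A) = ?e A" if A: "A \<in> LE I J" and c: "\<bar>content (last A) - content v\<bar> \<noteq> c" for A
        proof -
          obtain A' a where A': "A = A' @ [a]" using snocE A by blast
          then have "length A' = n" using len[OF A] nl by simp
          from swap_at_append[OF this, of c a v "[]"] show ?thesis using A' c n by simp
        qed
        show ?thesis
        proof (cases "c = b")
          case True
          then have "\<sigma> (?e (\<tau> A1)) = ?e (\<tau> A1)"
            using fixed \<tau>A1 moved[of "\<tau> A1" v] \<tau>(3) v by metis
          then show ?thesis using \<tau>A1 by force
        next
          case False
          then have "\<sigma> (?e A1) = ?e A1" using fixed[OF A1(1)] b by blast
          then show ?thesis using A1 by force
        qed
      qed
      then show ?thesis using swappers_realize[OF I J' f] len' by blast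
    qed
    show "B = LE I ?J" if "B \<noteq> {}" "B \<subseteq> LE I ?J" "\<And>f \<sigma>. (f, \<sigma>) \<in> swappers I (Suc l) \<Longrightarrow> \<sigma> ` B \<subseteq> B" for B
      by (rule swappers_connected[OF I len' that])
  qed (use eS \<tau> A1 x q in auto)
  then show ?thesis by (simp add: good_def)
qed


text \<open>Mirror image of \<open>grow_right\<close> with the exchange across the left end. The
  letter before the section is any \<open>u\<close> whose removal from the lower ideal leaves an
  ideal; this condition takes the place of \<open>ready\<close>.\<close>

lemma grow_left:
  assumes I: "ideal I" and z: "ready z I" and J: "ideal J"
    and alt: "good (insert z I) J"
    and A1: "A1 \<in> LE (insert z I) J" "A1 \<noteq> []"
    and \<tau>: "bij_betw \<tau> (LE (insert z I) J) (LE (insert z I) J)"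
      "isolated fill (LE (insert z I) J) (ctx (insert z I) J) \<tau>" "\<tau> A1 \<noteq> A1"
    and b: "b = \<bar>content (hd A1) - content z\<bar>" "2 \<le> b"
    and other: "\<And>u. u \<in> I \<Longrightarrow> ideal (insert z I - {u}) \<Longrightarrow> \<bar>content (hd A1) - content u\<bar> \<noteq> b"
    and moved: "\<And>A u. A \<in> LE (insert z I) J \<Longrightarrow> \<tau> A \<noteq> A \<Longrightarrow> A \<noteq> A1 \<Longrightarrow> u \<in> insert z I \<Longrightarrow>
      ideal (insert z I - {u}) \<Longrightarrow> \<bar>content (hd A) - content u\<bar> \<noteq> b"
  shows "good I J"
proof -
  let ?I = "insert z I" and ?e = "\<lambda>A. z # A" and ?j = "\<lambda>y. (fst y @ [z], snd y)"
  define l where "l = length A1"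
  have I': "ideal ?I" using ideal_insert I z by blast
  have fin: "finite I" "finite ?I" using finite_ideal I by auto
  have zI: "z \<notin> I" "z \<in> D" using z by (auto simp: ready_def)
  have IJ: "?I \<subseteq> J" using LE_D[OF A1(1)] by blast
  have len: "length A = l" if "A \<in> LE ?I J" for A
    using LE_card[OF fin(2) that] LE_card[OF fin(2) A1(1)] by (simp add: l_def)
  have l0: "0 < l" using A1 by (simp add: l_def)
  have cJ: "card J = Suc (card I) + l" using LE_card[OF fin(2) A1(1)] fin(1) zI by (simp add: l_def)
  have len': "length A = Suc l" if "A \<in> LE I J" for A
    using LE_card[OF fin(1) that] cJ by simp
  have eS: "?e A \<in> LE I J" if "A \<in> LE ?I J" for A using that z by simp
  have cons: "u = z" if "P \<in> LE {} I" "P @ [u] \<in> LE {} ?I" for P u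
    using LE_D[OF that(1)] LE_D[OF that(2)] LE_distinct[OF that(2)] zI by auto
  obtain h B where Bh: "A1 = h # B" using A1(2) by (meson neq_Nil_conv)
  have hz: "2 \<le> \<bar>content z - content h\<bar>" "\<bar>content z - content h\<bar> = b"
    using b Bh by (auto simp: abs_minus_commute)
  define x where "x = h # z # B"
  have x: "x \<in> LE I J - ?e ` LE ?I J"
  proof
    show "x \<in> LE I J" using LE_swap[OF I _ hz(1), of "[]" B J] eS[OF A1(1)] Bh by (simp add: x_def)
    have "h \<noteq> z" using LE_distinct[OF A1(1)] Bh by auto
    then show "x \<notin> ?e ` LE ?I J" by (auto simp: x_def)
  qed
  \<comment> \<open>The prefix has \<open>card I + 1\<close> letters, so place \<open>card I\<close>
    is its last one.\<close>
  obtain q where q: "q \<in> G" "\<And>w. w \<in> LE {} D \<Longrightarrow> q (tab w) = tab (swap_at (card I) b w)"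
      "\<And>T. q (q T) = T"
    using swap_involution[OF b(2)] by metis
  have q_fill: "q (fill (a # A) (P @ [u], Q)) =
      (if \<bar>content a - content u\<bar> = b then fill (a # u # A) (P, Q) else fill (a # A) (P @ [u], Q))"
    if "a # A \<in> LE ?I J" "(P @ [u], Q) \<in> ctx ?I J" for A a P u Q
  proof -
    have "length P = card I"
      using ctx_length(1)[OF that(2) J] fin zI by simp
    from swap_at_append[OF this, of b u a "A @ Q"] show ?thesis
      using q(2)[OF fill_word[OF that]] by (auto simp: fill_def abs_minus_commute)
  qed
  have P_snoc: "\<exists>P u Q. y = (P @ [u], Q) \<and> u \<in> ?I \<and> ideal (?I - {u})" if y: "y \<in> ctx ?I J" for y
  proof -
    have fy: "fst y \<in> LE {} ?I" using y by (auto simp: ctx_def)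
    then have "fst y \<noteq> []" using LE_D[of "fst y" "{}" ?I] by auto
    then obtain P u where P: "fst y = P @ [u]" by (meson rev_exhaust)
    then have "P @ [u] \<in> LE {} ?I" using fy by simp
    then have "ext {} P" "u \<notin> set P" "insert u (set P) = ?I"
      using LE_D[of "P @ [u]" "{}" ?I] LE_distinct[of "P @ [u]" "{}" ?I] by (auto simp: LE_append_iff LE_def ext_append)
    then have "?I - {u} = set P" "u \<in> ?I" by blast+
    moreover have "ideal (set P)" using ideal_ext[of "{}" P] \<open>ext {} P\<close> by simp
    ultimately show ?thesis using P by (intro exI[of _ P] exI[of _ u] exI[of _ "snd y"]) (simp add: prod_eq_iff)
  qed
  have consE: "\<exists>a A'. A = a # A'" if "A \<in> LE ?I J" for A
    using len[OF that] l0 by (cases A) auto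
  have \<tau>A1: "\<tau> A1 \<in> LE ?I J" "\<tau> (\<tau> A1) \<noteq> \<tau> A1"
    using \<tau>(1,3) A1(1) by (auto simp: bij_betw_def inj_on_def)
  have zI': "?I - {z} = I" using zI by blast
  have "alt_on fill (LE I J) (ctx I J) (LE I J)"
  proof (rule alt_on_grow[where e = ?e and j = ?j and \<tau> = \<tau> and a = A1 and x = x and q = q
        and \<Gamma> = "swappers I (Suc l)"])
    show "finite (LE I J)" by (rule finite_LE)
    show "inj_on ?e (LE ?I J)" by (simp add: inj_on_def)
    show "?j y \<in> ctx ?I J" if "y \<in> ctx I J" for y
      using that z LE_append[of "fst y" "{}" I "[z]" ?I] by (auto simp: ctx_def)
    show "\<And>A y. fill (?e A) y = fill A (?j y)" by (simp add: fill_def)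
    show "s = t" if "s \<in> LE I J" "t \<in> LE I J" "y \<in> ctx I J" "w \<in> ctx I J" "fill s y = fill t w" for s t y w
      using fill_inj[OF that J] .
    show "fill X y \<noteq> fill s w"
      if that': "X \<in> LE I J - ?e ` LE ?I J" "y \<in> ctx I J" "s \<in> LE ?I J" "w \<in> ctx ?I J" for X y s w
    proof
      assume "fill X y = fill s w"
      then have eq: "fst y @ X @ snd y = fst w @ s @ snd w"
        using fill_eq that' by blast
      moreover have "length (snd y) = length (snd w)"
        using ctx_length(2) that' J by metis
      ultimately have eq: "fst y @ X = fst w @ s"
        using append_eq_append_conv[of "fst y @ X" "fst w @ s" "snd y" "snd w"] by (simp del: append_eq_append_conv)
      obtain P u Q where w: "w = (P @ [u], Q)" using P_snoc[OF that'(4)] by blast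
      have "length P = card I" using ctx_length(1)[OF that'(4) J] w fin zI by simp
      then have "length P = length (fst y)" using ctx_length(1)[OF that'(2) J] by simp
      then have *: "fst y = P" "X = u # s" using eq w by simp_all
      then have "u = z" using cons[of P u] that'(2,4) w by (auto simp: ctx_def)
      then show False using * that' by blast
    qed
    show "alt_on fill (LE ?I J) (ctx ?I J) (LE ?I J)" using alt by (simp add: good_def)
    show "q (fill (?e A1) y) = fill x y" if y: "y \<in> ctx I J" for y
    proof -
      have "(fst y @ [z], snd y) \<in> ctx ?I J"
        using y z LE_append[of "fst y" "{}" I "[z]" ?I] by (auto simp: ctx_def)
      from q_fill[OF _ this, of h B] show ?thesis
        using A1 Bh hz by (simp add: fill_def x_def abs_minus_commute)
    qed
    show "q (fill A1 y) = fill A1 y" if yc: "y \<in> ctx ?I J" and yj: "y \<notin> ?j ` ctx I J" for y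
    proof -
      obtain P u Q where y: "y = (P @ [u], Q)" "u \<in> ?I" "ideal (?I - {u})" using P_snoc[OF yc] by blast
      have "u \<noteq> z"
      proof
        assume "u = z"
        then have uz: "P @ [z] \<in> LE {} ?I" "Q \<in> LE J D" using yc y by (auto simp: ctx_def)
        have "set P = I"
          using LE_D[OF uz(1)] LE_distinct[OF uz(1)] zI by auto
        then have "P \<in> LE {} I" using uz(1) by (auto simp: LE_append_iff)
        then have "(P, Q) \<in> ctx I J" using uz by (auto simp: ctx_def)
        then show False using yj y \<open>u = z\<close> by force
      qed
      then show ?thesis using q_fill[of h B P u Q] A1(1) Bh y other[of u] yc by simp
    qed
    show "q (fill A y) = fill A y" if that': "A \<in> LE ?I J" "\<tau> A \<noteq> A" "A \<noteq> A1" "y \<in> ctx ?I J" for A y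
    proof -
      obtain P u Q where y: "y = (P @ [u], Q)" "u \<in> ?I" "ideal (?I - {u})" using P_snoc[OF that'(4)] by blast
      obtain a A' where A: "A = a # A'" using consE[OF that'(1)] by blast
      then show ?thesis using q_fill[of a A' P u Q] y moved[OF that'(1,2,3) y(2,3)] that' by simp
    qed
    show "f \<in> G \<and> realizes fill (LE I J) (ctx I J) f \<sigma> \<and> bij_betw \<sigma> (LE I J) (LE I J) \<and>
        (\<exists>s\<in>LE ?I J. \<sigma> (?e s) \<in> ?e ` LE ?I J)" if f: "(f, \<sigma>) \<in> swappers I (Suc l)" for f \<sigma>
    proof -
      obtain n c where n: "\<sigma> = swap_at n c" "2 \<le> c" "n < l" using f by (auto simp: swappers_def)
      have "\<exists>s\<in>LE ?I J. \<sigma> (?e s) \<in> ?e ` LE ?I J"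
      proof (cases n)
        case (Suc k)
        then have "\<sigma> (?e A1) = ?e (swap_at k c A1)"
          using swap_at_context[of k A1 "[z]" c "[]"] n by (simp add: l_def)
        then show ?thesis using swap_at_LE[OF I' A1(1) n(2), of k] A1(1) by auto
      next
        case 0
        have fixed: "\<sigma> (?e A) = ?e A" if A: "A \<in> LE ?I J" and c: "\<bar>content (hd A) - content z\<bar> \<noteq> c" for A
        proof -
          obtain a A' where A': "A = a # A'" using consE[OF A] by blast
          from swap_at_append[of "[]" 0 c z a A'] show ?thesis
            using A' c n 0 by (simp add: abs_minus_commute)
        qed
        show ?thesis
        proof (cases "c = b")
          case True
          then have "\<sigma> (?e (\<tau> A1)) = ?e (\<tau> A1)"
            using fixed[OF \<tau>A1(1)] moved[OF \<tau>A1 \<tau>(3), of z] I zI' by simp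
          then show ?thesis using \<tau>A1 by force
        next
          case False
          then have "\<sigma> (?e A1) = ?e A1" using fixed[OF A1(1)] b by blast
          then show ?thesis using A1 by force
        qed
      qed
      then show ?thesis using swappers_realize[OF I J f] len' by blast
    qed
    show "B = LE I J" if "B \<noteq> {}" "B \<subseteq> LE I J" "\<And>f \<sigma>. (f, \<sigma>) \<in> swappers I (Suc l) \<Longrightarrow> \<sigma> ` B \<subseteq> B" for B
      by (rule swappers_connected[OF I len' that])
  qed (use eS \<tau> A1 x q in auto)
  then show ?thesis by (simp add: good_def)
qed

lemma good_cyc3:
  assumes "good I J" "A \<in> LE I J" "B \<in> LE I J" "C \<in> LE I J" "distinct [A, B, C]"
  shows "bij_betw (cyc3 A B C) (LE I J) (LE I J)" "isolated fill (LE I J) (ctx I J) (cyc3 A B C)"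
  using cyc3_bij_betw[of A B C "LE I J"] alt_onD[of fill "LE I J" "ctx I J" "LE I J" A B C] assms
  by (auto simp: good_def)

text \<open>Past the seed, \<open>\<tau>\<close> is a 3-cycle that goodness already makes isolated,
  so only three fillings have to be watched for coincidences.\<close>

lemma grow_right_triple:
  assumes "ideal I" "ideal J" "ready v J" "good I J"
    and A: "A1 \<in> LE I J" "A2 \<in> LE I J" "A3 \<in> LE I J" "distinct [A1, A2, A3]" "A1 \<noteq> []"
    and b: "b = \<bar>content (last A1) - content v\<bar>" "2 \<le> b"
    and other: "\<And>u. ready u J \<Longrightarrow> u \<noteq> v \<Longrightarrow> \<bar>content (last A1) - content u\<bar> \<noteq> b"
    and moved: "\<And>u. ready u J \<Longrightarrow> \<bar>content (last A2) - content u\<bar> \<noteq> b"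
      "\<And>u. ready u J \<Longrightarrow> \<bar>content (last A3) - content u\<bar> \<noteq> b"
  shows "good I (insert v J)"
proof (rule grow_right[where \<tau> = "cyc3 A1 A2 A3" and b = b and ?A1.0 = A1])
  show "cyc3 A1 A2 A3 A1 \<noteq> A1" using A(4) by (auto simp: cyc3_def)
  show "\<bar>content (last B) - content u\<bar> \<noteq> b"
    if "B \<in> LE I J" "cyc3 A1 A2 A3 B \<noteq> B" "B \<noteq> A1" "ready u J" for B u
    using that moved by (auto simp: cyc3_def split: if_splits)
qed (use assms good_cyc3[OF assms(4) A(1-4)] in auto)

lemma grow_left_triple:
  assumes "ideal I" "ready z I" "ideal J" "good (insert z I) J"
    and A: "A1 \<in> LE (insert z I) J" "A2 \<in> LE (insert z I) J" "A3 \<in> LE (insert z I) J"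
      "distinct [A1, A2, A3]" "A1 \<noteq> []"
    and b: "b = \<bar>content (hd A1) - content z\<bar>" "2 \<le> b"
    and other: "\<And>u. u \<in> I \<Longrightarrow> ideal (insert z I - {u}) \<Longrightarrow> \<bar>content (hd A1) - content u\<bar> \<noteq> b"
    and moved: "\<And>u. u \<in> insert z I \<Longrightarrow> ideal (insert z I - {u}) \<Longrightarrow> \<bar>content (hd A2) - content u\<bar> \<noteq> b"
      "\<And>u. u \<in> insert z I \<Longrightarrow> ideal (insert z I - {u}) \<Longrightarrow> \<bar>content (hd A3) - content u\<bar> \<noteq> b"
  shows "good I J"
proof (rule grow_left[where \<tau> = "cyc3 A1 A2 A3" and b = b and ?A1.0 = A1 and z = z])
  show "cyc3 A1 A2 A3 A1 \<noteq> A1" using A(4) by (auto simp: cyc3_def)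
  show "\<bar>content (hd B) - content u\<bar> \<noteq> b"
    if "B \<in> LE (insert z I) J" "cyc3 A1 A2 A3 B \<noteq> B" "B \<noteq> A1" "u \<in> insert z I" "ideal (insert z I - {u})" for B u
    using that moved by (auto simp: cyc3_def split: if_splits)
qed (use assms good_cyc3[OF assms(4) A(1-4)] in auto)

text \<open>If some filling ends at content distance at least 2 from \<open>v\<close>, the
  commutator works, with two companions ending too close to \<open>v\<close> to be exchanged.
  Otherwise \<open>v\<close> can never move left, and the enlarged section has the same
  words.\<close>

lemma grow_right_only:
  assumes I: "ideal I" and J: "ideal J" and IJ: "I \<subseteq> J" "I \<noteq> J" and v: "ready v J"
    and only: "\<And>u. ready u J \<Longrightarrow> u = v"
    and alt: "good I J"
    and A: "A2 \<in> LE I J" "A3 \<in> LE I J" "A2 \<noteq> A3"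
      "\<bar>content (last A2) - content v\<bar> < 2" "\<bar>content (last A3) - content v\<bar> < 2"
  shows "good I (insert v J)"
proof (cases "\<exists>A1\<in>LE I J. 2 \<le> \<bar>content (last A1) - content v\<bar>")
  case True
  then obtain A1 where A1: "A1 \<in> LE I J" "2 \<le> \<bar>content (last A1) - content v\<bar>" by blast
  have "A1 \<noteq> []" using A1 IJ by auto
  then show ?thesis
    by (intro grow_right_triple[OF I J v alt A1(1) A(1,2) _ _ refl A1(2)]) (use only A A1 in auto)
next
  case False
  have v': "v \<notin> J" "v \<in> D" using v by (auto simp: ready_def)
  \<comment> \<open>The words ending in \<open>v\<close> are closed under exchanges, as no filling
    ends far enough from \<open>v\<close>; by connectedness they are all words of the enlarged
    section.\<close>
  have e: "bij_betw (\<lambda>A. A @ [v]) (LE I J) (LE I (insert v J))"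
  proof (rule bij_betw_imageI)
    show "inj_on (\<lambda>A. A @ [v]) (LE I J)" by (simp add: inj_on_def)
    show "(\<lambda>A. A @ [v]) ` LE I J = LE I (insert v J)"
    proof (rule LE_connected[OF I])
      show "(\<lambda>A. A @ [v]) ` LE I J \<subseteq> LE I (insert v J)"
      proof
        fix X assume "X \<in> (\<lambda>A. A @ [v]) ` LE I J"
        then obtain A where "A \<in> LE I J" "X = A @ [v]" by blast
        then show "X \<in> LE I (insert v J)" using v by (simp add: LE_append[of A I J "[v]"])
      qed
      show "(\<lambda>A. A @ [v]) ` LE I J \<noteq> {}" using A by blast
      fix n :: nat and b :: int assume b: "2 \<le> b"
      show "swap_at n b ` (\<lambda>A. A @ [v]) ` LE I J \<subseteq> (\<lambda>A. A @ [v]) ` LE I J"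
      proof (clarsimp)
        fix X assume X: "X \<in> LE I J"
        have "swap_at n b (X @ [v]) = swap_at n b X @ [v]"
        proof (cases "Suc n < length X")
          case True
          then show ?thesis using swap_at_context[of n X "[]" b "[v]"] by simp
        next
          case Xn: False
          show ?thesis
          proof (cases "Suc n = length X")
            case True
            then obtain X' a where X': "X = X' @ [a]" by (metis length_0_conv nat.distinct(1) rev_exhaust)
            then have "\<not> 2 \<le> \<bar>content a - content v\<bar>" using False X by force
            then have "\<bar>content a - content v\<bar> \<noteq> b" using b by linarith
            then show ?thesis using True X' swap_at_append[of X' n b a v "[]"] Xn by (simp add: swap_at_short)
          qed (use Xn in \<open>simp add: swap_at_short\<close>)
        qed
        then show "swap_at n b (X @ [v]) \<in> (\<lambda>A. A @ [v]) ` LE I J"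
          using swap_at_LE[OF I X b] by simp
      qed
    qed
  qed
  have j: "bij_betw (\<lambda>y. (fst y, v # snd y)) (ctx I (insert v J)) (ctx I J)"
  proof (rule bij_betw_imageI)
    show "inj_on (\<lambda>y. (fst y, v # snd y)) (ctx I (insert v J))" by (auto simp: inj_on_def)
    show "(\<lambda>y. (fst y, v # snd y)) ` ctx I (insert v J) = ctx I J"
    proof (intro equalityI subsetI)
      fix y assume y: "y \<in> ctx I J"
      then have "snd y \<noteq> []" using v' by (auto simp: ctx_def)
      then obtain u Q where Q: "snd y = u # Q" by (meson neq_Nil_conv)
      then have "ready u J" using y by (auto simp: ctx_def)
      then have "u = v" by (rule only)
      then have "(fst y, Q) \<in> ctx I (insert v J)" "y = (fst y, v # Q)"
        using y Q by (cases y; auto simp: ctx_def)+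
      then show "y \<in> (\<lambda>y. (fst y, v # snd y)) ` ctx I (insert v J)" by force
    qed (use v in \<open>auto simp: ctx_def\<close>)
  qed
  show ?thesis
    using alt_on_transport[OF e j, of fill fill] alt by (simp add: good_def fill_def)
qed

text \<open>Mirror image of \<open>grow_right_only\<close>: \<open>z\<close> is the only possible
  last letter of the prefix.\<close>

lemma grow_left_only:
  assumes I: "ideal I" and J: "ideal J" and z: "ready z I" and IJ: "insert z I \<noteq> J"
    and only: "\<And>u. u \<in> I \<Longrightarrow> \<not> ideal (insert z I - {u})"
    and alt: "good (insert z I) J"
    and A: "A2 \<in> LE (insert z I) J" "A3 \<in> LE (insert z I) J" "A2 \<noteq> A3"
      "\<bar>content (hd A2) - content z\<bar> < 2" "\<bar>content (hd A3) - content z\<bar> < 2"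
  shows "good I J"
proof (cases "\<exists>A1\<in>LE (insert z I) J. 2 \<le> \<bar>content (hd A1) - content z\<bar>")
  case True
  then obtain A1 where A1: "A1 \<in> LE (insert z I) J" "2 \<le> \<bar>content (hd A1) - content z\<bar>" by blast
  have "A1 \<noteq> []" using A1 IJ by auto
  then show ?thesis
    by (intro grow_left_triple[OF I z J alt A1(1) A(1,2) _ _ refl A1(2)]) (use only A A1 in auto)
next
  case False
  have z': "z \<notin> I" "z \<in> D" using z by (auto simp: ready_def)
  have I': "ideal (insert z I)" using ideal_insert I z by blast
  have e: "bij_betw (\<lambda>A. z # A) (LE (insert z I) J) (LE I J)"
  proof (rule bij_betw_imageI)
    show "inj_on (\<lambda>A. z # A) (LE (insert z I) J)" by (simp add: inj_on_def)
    show "(\<lambda>A. z # A) ` LE (insert z I) J = LE I J"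
    proof (rule LE_connected[OF I])
      show "(\<lambda>A. z # A) ` LE (insert z I) J \<subseteq> LE I J" using z by auto
      show "(\<lambda>A. z # A) ` LE (insert z I) J \<noteq> {}" using A by blast
      fix n :: nat and b :: int assume b: "2 \<le> b"
      show "swap_at n b ` (\<lambda>A. z # A) ` LE (insert z I) J \<subseteq> (\<lambda>A. z # A) ` LE (insert z I) J"
      proof (clarsimp)
        fix X assume X: "X \<in> LE (insert z I) J"
        have "\<exists>k. swap_at n b (z # X) = z # swap_at k b X"
        proof (cases n)
          case 0
          have "swap_at n b (z # X) = z # X"
          proof (cases X)
            case (Cons a X')
            then have "\<not> 2 \<le> \<bar>content a - content z\<bar>" using False X by (metis list.sel(1))
            then have "\<bar>content z - content a\<bar> \<noteq> b" using b by linarith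
            then show ?thesis using Cons 0 swap_at_append[of "[]" n b z a X'] by simp
          qed (simp add: swap_at_short)
          \<comment> \<open>A place beyond the end serves as witness for a trivial exchange.\<close>
          moreover have "swap_at (length X) b X = X" by (simp add: swap_at_short)
          ultimately show ?thesis by metis
        next
          case (Suc k)
          show ?thesis
          proof (cases "Suc k < length X")
            case True
            then show ?thesis using swap_at_context[of k X "[z]" b "[]"] Suc by (intro exI[of _ k]) simp
          next
            case False
            then show ?thesis using Suc by (intro exI[of _ k]) (simp add: swap_at_short)
          qed
        qed
        then obtain k where "swap_at n b (z # X) = z # swap_at k b X" by blast
        then show "swap_at n b (z # X) \<in> (\<lambda>A. z # A) ` LE (insert z I) J"
          using swap_at_LE[OF I' X b, of k] by auto
      qed
    qed
  qed
  have j: "bij_betw (\<lambda>y. (fst y @ [z], snd y)) (ctx I J) (ctx (insert z I) J)"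
  proof (rule bij_betw_imageI)
    show "inj_on (\<lambda>y. (fst y @ [z], snd y)) (ctx I J)" by (auto simp: inj_on_def)
    show "(\<lambda>y. (fst y @ [z], snd y)) ` ctx I J = ctx (insert z I) J"
    proof (intro equalityI subsetI)
      fix y assume "y \<in> (\<lambda>y. (fst y @ [z], snd y)) ` ctx I J"
      then show "y \<in> ctx (insert z I) J"
        using z LE_append[of _ "{}" I "[z]" "insert z I"] by (auto simp: ctx_def)
    next
      fix y assume y: "y \<in> ctx (insert z I) J"
      then have fy: "fst y \<in> LE {} (insert z I)" by (auto simp: ctx_def)
      then have "fst y \<noteq> []" using LE_D[of "fst y" "{}"] by auto
      then obtain P u where P: "fst y = P @ [u]" by (meson rev_exhaust)
      have Pu: "P @ [u] \<in> LE {} (insert z I)" using P fy by simp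
      then have P': "P \<in> LE {} (set P)" "u \<notin> set P" "insert u (set P) = insert z I"
        using LE_D[OF Pu] LE_distinct[OF Pu] by (auto simp: LE_append_iff)
      have "ideal (set P)" using ideal_ext[of "{}" P] P'(1) by (simp add: LE_def)
      moreover have "set P = insert z I - {u}" "u \<in> insert z I" using P' by blast+
      ultimately have "u = z" using only[of u] by auto
      then have "set P = I" using P' z' by (metis insert_ident)
      then have "(P, snd y) \<in> ctx I J" "y = (P @ [z], snd y)"
        using y P P' \<open>u = z\<close> by (cases y; auto simp: ctx_def)+
      then show "y \<in> (\<lambda>y. (fst y @ [z], snd y)) ` ctx I J" by force
    qed
  qed
  show ?thesis
    using alt_on_transport[OF e j, of fill fill] alt by (simp add: good_def fill_def)
qed

end

section \<open>Growing a good section to the whole shape\<close>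

context skew_shape
begin

lemma remove_maximal:
  assumes "ideal J" "x \<in> J" "\<And>u. u \<in> J \<Longrightarrow> \<not> below x u"
  shows "ideal (J - {x})" "ready x (J - {x})"
  using assms by (auto simp: ideal_def ready_def below_def)

text \<open>Dual of \<open>ready_content\<close>: two boxes that can each be the last one of the
  same ideal are incomparable.\<close>

lemma maximal_content:
  assumes "ideal I" "ready z I" "u \<in> I" "ideal (insert z I - {u})"
  shows "2 \<le> \<bar>content u - content z\<bar>"
proof -
  have zI: "z \<notin> I" "z \<in> D" "u \<in> D" "u \<noteq> z" using assms by (auto simp: ready_def ideal_def)
  have "\<not> below z u" using assms zI by (auto simp: ideal_def)
  moreover have "\<not> below u z"
  proof
    assume "below u z"
    moreover have "z \<in> insert z I - {u}" using zI by blast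
    ultimately have "u \<in> insert z I - {u}" using assms(4) zI(3) unfolding ideal_def by blast
    then show False by blast
  qed
  ultimately show ?thesis using zI(4) by (cases z; cases u) (auto simp: below_def content_def)
qed

text \<open>The last letter alone decides about exchanges at the right end. A maximal box
  \<open>t\<close> can be postponed to the end, so this letter can be prescribed.\<close>

lemma two_LE_snoc:
  assumes "ideal I" "ideal J" "ideal K" "I \<subseteq> J" "ready x J" "ready y J" "x \<noteq> y"
    "x \<in> K" "y \<in> K" "J \<subseteq> K" "t \<in> K" "t \<noteq> x" "t \<noteq> y" "t \<notin> J" "\<And>u. u \<in> K \<Longrightarrow> \<not> below t u"
  obtains A B where "A \<in> LE I K" "B \<in> LE I K" "A \<noteq> B" "last A = t" "last B = t"
proof -
  have t: "ideal (K - {t})" "ready t (K - {t})" using remove_maximal assms by blast+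
  obtain A B where AB: "A \<in> LE I (K - {t})" "B \<in> LE I (K - {t})" "A \<noteq> B"
    by (rule two_LE[OF assms(1,2) t(1) assms(4-7)]) (use assms in auto)
  have "insert t (K - {t}) = K" using assms(11) by blast
  then have "[t] \<in> LE (K - {t}) K" using t by simp
  then have "A @ [t] \<in> LE I K" "B @ [t] \<in> LE I K" using AB LE_append by blast+
  then show ?thesis using that[of "A @ [t]" "B @ [t]"] AB by simp
qed

end

text \<open>Row \<open>k\<close> occupies the columns from \<open>s k + 1\<close> to
  \<open>e k\<close>. By \<open>wide\<close>, more than \<open>R\<close> columns meet all rows. The
  bound in \<open>gap\<close> is the content of the first box of row 1 minus that of the first box
  of row \<open>R\<close>; the overlap of consecutive rows exceeds it.\<close>

locale wide_tableau_group = tableau_group D G tab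
  for D and G :: "('l \<Rightarrow> 'l) set" and tab +
  fixes R :: int and s e :: "int \<Rightarrow> int"
  assumes shape: "D = {(k, c). 1 \<le> k \<and> k \<le> R \<and> s k < c \<and> c \<le> e k}"
    and s_anti: "1 \<le> k \<Longrightarrow> k \<le> l \<Longrightarrow> l \<le> R \<Longrightarrow> s l \<le> s k"
    and e_anti: "1 \<le> k \<Longrightarrow> k \<le> l \<Longrightarrow> l \<le> R \<Longrightarrow> e l \<le> e k"
    and rows: "3 \<le> R"
    and wide: "R < e R - s 1"
    and gap: "1 \<le> k \<Longrightarrow> k < R \<Longrightarrow> s 1 - s R + R - 1 < e k - s (k + 1)"
begin

section \<open>The seed at the two extremal corners\<close>

definition TR :: box where "TR = (1, e 1)"
definition BL :: box where "BL = (R, s R + 1)"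
text \<open>The first free box of row 2 once \<open>K0\<close> is filled: if row 2 starts in column
  \<open>s R + 1\<close>, that box already belongs to \<open>K0\<close>.\<close>

definition V1 :: box where "V1 = (2, if s 2 = s R then s R + 2 else s 2 + 1)"
text \<open>All that precedes \<open>TR\<close> or \<open>BL\<close>: the rest of the first row, and
  the boxes above \<open>BL\<close> in its column, which exist in the rows with
  \<open>s k = s R\<close>.\<close>

definition K0 :: "box set" where
  "K0 = {(k, c). k = 1 \<and> s 1 < c \<and> c < e 1 \<or> 1 \<le> k \<and> k < R \<and> s k = s R \<and> c = s R + 1}"
definition K1 :: "box set" where "K1 = insert BL (insert TR K0)"
definition K2 :: "box set" where "K2 = insert V1 K1"

lemma mem_shape [simp]: "(k, c) \<in> D \<longleftrightarrow> 1 \<le> k \<and> k \<le> R \<and> s k < c \<and> c \<le> e k"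
  by (simp add: shape)

lemma mem_K0 [simp]: "(k, c) \<in> K0 \<longleftrightarrow>
    k = 1 \<and> s 1 < c \<and> c < e 1 \<or> 1 \<le> k \<and> k < R \<and> s k = s R \<and> c = s R + 1"
  by (simp add: K0_def)

lemma bounds:
  assumes "1 \<le> k" "k \<le> R"
  shows "s R \<le> s k" "s k \<le> s 1" "e R \<le> e k" "e k \<le> e 1" "R < e k - s 1" "R < e k - s R"
  using s_anti[of k R] s_anti[of 1 k] e_anti[of k R] e_anti[of 1 k] s_anti[of 1 R] wide assms by auto

lemma bounds12: "s R \<le> s 2" "s 2 \<le> s 1" "s R \<le> s 1" "e R \<le> e 2" "e 2 \<le> e 1" "R < e R - s 1" "R < e R - s R"
  using bounds[of 1] bounds[of 2] bounds[of R] rows by auto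

lemma corners_in: "TR \<in> D" "BL \<in> D" "V1 \<in> D"
  using rows bounds12 by (auto simp: TR_def BL_def V1_def)

lemma corners_distinct: "TR \<noteq> BL" "TR \<noteq> V1" "BL \<noteq> V1"
  using rows by (auto simp: TR_def BL_def V1_def)

lemma ideal_K0: "ideal K0"
  unfolding ideal_def
proof (intro conjI subsetI ballI impI)
  fix x assume x: "x \<in> K0"
  obtain k c where kc: "x = (k, c)" by (cases x) auto
  show "x \<in> D" using x kc bounds[of k] bounds[of 1] rows by auto
  fix y assume "y \<in> D" "below y x"
  then show "y \<in> K0" using x kc bounds[of "fst y"] bounds12 rows
    by (cases y) (auto simp: below_def)
qed

lemma ready_K0: "ready TR K0" "ready BL K0" "ready V1 K0"
proof -
  show "ready TR K0" unfolding ready_def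
  proof (intro conjI ballI impI)
    fix y assume "y \<in> D" "below y TR"
    then show "y \<in> K0" by (cases y) (auto simp: below_def TR_def)
  qed (use corners_in bounds12 rows in \<open>auto simp: TR_def\<close>)
  show "ready BL K0" unfolding ready_def
  proof (intro conjI ballI impI)
    fix y assume "y \<in> D" "below y BL"
    then show "y \<in> K0" using bounds[of "fst y"] by (cases y) (auto simp: below_def BL_def)
  qed (use corners_in bounds12 rows in \<open>auto simp: BL_def\<close>)
  show "ready V1 K0" unfolding ready_def
  proof (intro conjI ballI impI)
    fix y assume y: "y \<in> D" "below y V1"
    obtain k c where kc: "y = (k, c)" by (cases y) auto
    have "k = 1 \<or> k = 2" using y kc by (auto simp: below_def V1_def)
    then show "y \<in> K0" using y kc bounds12 rows
      by (auto simp: below_def V1_def split: if_splits)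
  qed (use corners_in bounds12 rows in \<open>auto simp: V1_def\<close>)
qed

lemma ready_insert:
  assumes "ready x I" "ready y I" "x \<noteq> y"
  shows "ready x (insert y I)"
  using assms by (auto simp: ready_def)

lemma ideal_K1: "ideal K1" and ideal_K2: "ideal K2" and ready_V1_K1: "ready V1 K1"
proof -
  have BL: "ready BL (insert TR K0)"
    by (rule ready_insert[OF ready_K0(2,1) corners_distinct(1)[symmetric]])
  show 1: "ideal K1" unfolding K1_def
    by (rule ideal_insert[OF ideal_insert[OF ideal_K0 ready_K0(1)] BL])
  show 2: "ready V1 K1" unfolding K1_def
    by (rule ready_insert[OF ready_insert[OF ready_K0(3,1)] BL]) (use corners_distinct in auto)
  show "ideal K2" unfolding K2_def using ideal_insert 1 2 by blast
qed

text \<open>Content grows to the right and falls downwards, and \<open>e\<close> does not increase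
  down the rows, so the maximum is attained at \<open>TR\<close> alone.\<close>

lemma content_le_TR: "x \<in> D \<Longrightarrow> content x \<le> content TR \<and> (content x = content TR \<longrightarrow> x = TR)"
  using bounds[of "fst x"] by (cases x) (auto simp: content_def TR_def)

lemma content_ge_BL: "x \<in> D \<Longrightarrow> content BL \<le> content x \<and> (content x = content BL \<longrightarrow> x = BL)"
  using bounds[of "fst x"] by (cases x) (auto simp: content_def BL_def)

lemma LE_K0_K1: "LE K0 K1 = {[TR, BL], [BL, TR]}"
proof (intro equalityI subsetI)
  fix A assume A: "A \<in> LE K0 K1"
  have nin: "TR \<notin> K0" "BL \<notin> K0" using ready_K0 by (auto simp: ready_def)
  have fin: "finite K0" using ideal_K0 finite_ideal by blast
  then have "card K1 = card K0 + 2"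
    unfolding K1_def using nin corners_distinct by simp
  then have "length A = 2" using LE_card[OF fin A] by simp
  then obtain x y where xy: "A = [x, y]"
    by (metis One_nat_def Suc_1 length_0_conv length_Suc_conv)
  have "K0 \<union> {x, y} = K1" "{x, y} \<inter> K0 = {}" using LE_D[OF A] LE_distinct[OF A] xy by auto
  then have "{x, y} = {TR, BL}" using nin unfolding K1_def by blast
  then show "A \<in> {[TR, BL], [BL, TR]}" using xy by (auto simp: doubleton_eq_iff)
next
  fix A assume "A \<in> {[TR, BL], [BL, TR]}"
  then show "A \<in> LE K0 K1"
    using ready_K0 ready_insert[OF ready_K0(1,2)] ready_insert[OF ready_K0(2,1)] corners_distinct
    by (auto simp: K1_def insert_commute)
qed

abbreviation width :: int where "width \<equiv> content TR - content BL"

lemma width_ge: "2 \<le> width"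
  using rows bounds12 by (simp add: content_def TR_def BL_def)

text \<open>The corners \<^const>\<open>TR\<close> and \<^const>\<open>BL\<close> are the only two boxes at the maximal distance, and
  \<^const>\<open>K0\<close> is the least ideal at which both can be added; so this generator is isolated.\<close>
lemma isolated_seed: "isolated fill (LE K0 K1) (ctx K0 K1) (swap_at 0 width)"
proof -
  obtain f where f: "f \<in> G" "\<And>w. w \<in> LE {} D \<Longrightarrow> f (tab w) = tab (swap_at (card K0) width w)"
      "\<And>T. T \<notin> tab ` LE {} D \<Longrightarrow> f T = T"
    using swap_in_group[OF width_ge, of "card K0"] by blast
  have "realizes fill (LE K0 K1) (ctx K0 K1) f (swap_at 0 width)"
    unfolding realizes_def
  proof (intro ballI)
    fix A y assume A: "A \<in> LE K0 K1" and y: "y \<in> ctx K0 K1"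
    have "Suc 0 < length A" using A unfolding LE_K0_K1 by auto
    from swap_at_context[OF this, of "fst y" width "snd y"]
    show "f (fill A y) = fill (swap_at 0 width A) y"
      using f(2)[OF fill_word[OF A y]] ctx_length(1)[OF y ideal_K1] by (simp add: fill_def)
  qed
  moreover have "f T = T" if T: "\<nexists>A y. A \<in> LE K0 K1 \<and> y \<in> ctx K0 K1 \<and> T = fill A y" for T
  proof (rule ccontr)
    assume "f T \<noteq> T"
    then obtain w where w: "w \<in> LE {} D" "T = tab w" using f(3) by blast
    have ne: "swap_at (card K0) width w \<noteq> w" using f(2) w \<open>f T \<noteq> T\<close> by metis
    then have "Suc (card K0) < length w" using swap_at_short by metis
    then obtain P x y Q where w': "w = P @ x # y # Q" "length P = card K0" by (rule split_at_pair)
    have xy: "\<bar>content x - content y\<bar> = width" using ne w' swap_at_append[OF w'(2), of width x y Q] by metis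
    have words: "P \<in> LE {} (set P)" "ready x (set P)" "ready y (insert x (set P))"
        "Q \<in> LE (insert y (insert x (set P))) D"
      using w(1) w' by (auto simp: LE_append_iff)
    have inD: "x \<in> D" "y \<in> D" using words by (auto simp: ready_def)
    have "x = TR \<and> y = BL \<or> x = BL \<and> y = TR"
      using xy content_le_TR[OF inD(1)] content_le_TR[OF inD(2)] content_ge_BL[OF inD(1)] content_ge_BL[OF inD(2)]
      by (auto simp: abs_if split: if_splits)
    note cases = this
    have sub: "K0 \<subseteq> set P"
    proof
      fix u assume u: "u \<in> K0"
      then have uD: "u \<in> D" using ideal_K0 by (auto simp: ideal_def)
      have "u \<noteq> x" "u \<noteq> y" using cases u ready_K0 by (auto simp: ready_def)
      moreover have "below u TR \<or> below u BL"
        using u bounds12 rows by (cases u) (auto simp: below_def TR_def BL_def)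
      then have "below u x \<or> below u y" using cases by auto
      ultimately show "u \<in> set P" using words(2,3) uD by (auto simp: ready_def)
    qed
    \<comment> \<open>All predecessors of the two corners lie in a prefix of length
      \<open>card K0\<close>, so the prefix is exactly \<open>K0\<close>: the time of the exchange
      singles out the section.\<close>
    have "card (set P) = card K0"
      using w' LE_distinct[OF words(1)] distinct_card by metis
    then have P: "set P = K0" using card_subset_eq[OF _ sub] by simp
    have "insert y (insert x K0) = K1" using cases by (auto simp: K1_def)
    then have "[x, y] \<in> LE K0 K1" "(P, Q) \<in> ctx K0 K1" "T = fill [x, y] (P, Q)"
      using words P w w' by (auto simp: ctx_def fill_def)
    then show False using T by blast
  qed
  ultimately show ?thesis unfolding isolated_def using f(1) by blast
qed

text \<open>Vacuous, as two fillings admit no 3-cycle; the information is carried by the seed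
  transposition.\<close>

lemma good_K0_K1: "good K0 K1"
  unfolding good_def alt_on_def LE_K0_K1 by auto

text \<open>Row 1 is full in \<open>K1\<close>, so \<open>u\<close> lies in row 2 or lower; as
  \<open>V1\<close> does not precede it, \<open>u\<close> is \<open>V1\<close> or lies strictly
  further left.\<close>

lemma ready_K1_content:
  assumes u: "ready u K1"
  shows "content u \<le> content V1"
proof -
  obtain k c where kc: "u = (k, c)" by (cases u) auto
  have "\<not> below V1 u" using u ready_V1_K1 by (auto simp: ready_def)
  moreover have "k \<noteq> 1" "u \<in> D" using u kc by (auto simp: ready_def K1_def TR_def)
  ultimately show ?thesis using kc by (auto simp: below_def V1_def content_def)
qed

text \<open>By \<open>gap\<close> for the first two rows, together with \<open>wide\<close>,
  \<open>V1\<close> is closer in content to \<open>BL\<close> than to \<open>TR\<close>. This keeps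
  the distance from \<open>TR\<close> to \<open>V1\<close> apart from the distances that start at
  \<open>BL\<close>.\<close>

lemma V1_content: "2 * content V1 < content TR + content BL" "content V1 < content TR"
  using gap[of 1] rows bounds12 by (auto simp: content_def V1_def TR_def BL_def)

text \<open>The commutator of the seed transposition with the exchange of \<open>TR\<close> and
  \<open>V1\<close> is the first 3-cycle. The exchange spares \<open>[TR, BL]\<close>, since its
  last letter \<open>BL\<close> is too close to every box that can follow.\<close>

lemma good_K0_K2: "good K0 K2"
  unfolding K2_def
proof (rule grow_right[OF ideal_K0 ideal_K1 ready_V1_K1 good_K0_K1, where \<tau> = "swap_at 0 width"
      and ?A1.0 = "[BL, TR]" and b = "content TR - content V1"])
  have sw: "swap_at 0 width [BL, TR] = [TR, BL]" "swap_at 0 width [TR, BL] = [BL, TR]"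
    using swap_at_append[of "[]" 0 width BL TR "[]"] swap_at_append[of "[]" 0 width TR BL "[]"] width_ge
    by (auto simp: abs_minus_commute)
  show "[BL, TR] \<in> LE K0 K1" "[BL, TR] \<noteq> []" by (auto simp: LE_K0_K1)
  show "bij_betw (swap_at 0 width) (LE K0 K1) (LE K0 K1)"
    using sw corners_distinct by (auto simp: LE_K0_K1 bij_betw_def inj_on_def)
  show "isolated fill (LE K0 K1) (ctx K0 K1) (swap_at 0 width)" by (rule isolated_seed)
  show "swap_at 0 width [BL, TR] \<noteq> [BL, TR]" using sw corners_distinct by simp
  show "content TR - content V1 = \<bar>content (last [BL, TR]) - content V1\<bar>" using V1_content by simp
  then show "2 \<le> content TR - content V1" using ready_content[OF ready_K0(1,3)] corners_distinct by simp
  show "\<bar>content (last [BL, TR]) - content u\<bar> \<noteq> content TR - content V1"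
    if u: "ready u K1" "u \<noteq> V1" for u
    using ready_content[OF u(1) ready_V1_K1 u(2)] content_le_TR[of u] u by (auto simp: ready_def)
  show "\<bar>content (last A) - content u\<bar> \<noteq> content TR - content V1"
    if "A \<in> LE K0 K1" "swap_at 0 width A \<noteq> A" "A \<noteq> [BL, TR]" "ready u K1" for A u
  proof -
    have "A = [TR, BL]" using that by (auto simp: LE_K0_K1)
    then show ?thesis
      using ready_K1_content[OF that(4)] V1_content content_ge_BL[of u] that(4) by (auto simp: ready_def)
  qed
qed

section \<open>Shrinking the lower ideal: the first column, then the first row\<close>

definition L :: "int \<Rightarrow> box set" where
  "L k = {(i, c). i = 1 \<and> s 1 < c \<and> c < e 1 \<or> 1 \<le> i \<and> i < k \<and> s i = s R \<and> c = s R + 1}"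

lemma mem_L [simp]: "(i, c) \<in> L k \<longleftrightarrow>
    i = 1 \<and> s 1 < c \<and> c < e 1 \<or> 1 \<le> i \<and> i < k \<and> s i = s R \<and> c = s R + 1"
  by (simp add: L_def)

lemma ideal_L:
  assumes "k \<le> R"
  shows "ideal (L k)"
  unfolding ideal_def
proof (intro conjI subsetI ballI impI)
  fix x assume x: "x \<in> L k"
  obtain i c where ic: "x = (i, c)" by (cases x) auto
  show "x \<in> D" using x ic bounds[of i] bounds[of 1] rows assms by auto
  fix y assume "y \<in> D" "below y x"
  then show "y \<in> L k" using x ic bounds[of "fst y"] bounds12 rows assms
    by (cases y) (auto simp: below_def)
qed

text \<open>The bottom box \<open>z\<close> of the remaining column passes from the lower ideal into
  the section. It has least content in that ideal and \<open>TR\<close> has the greatest content of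
  all, so their distance identifies the pair. The companions start with \<open>V1\<close>, whose
  distances to boxes of the ideal are all smaller.\<close>

lemma good_L_step:
  assumes k: "2 \<le> k" "k < R" and good: "good (L (k + 1)) K2"
  shows "good (L k) K2"
proof (cases "s k = s R")
  case False
  have "L (k + 1) = L k"
  proof (rule Set.set_eqI)
    fix x :: box
    obtain i c where ic: "x = (i, c)" by (cases x) auto
    show "x \<in> L (k + 1) \<longleftrightarrow> x \<in> L k" using False ic by (cases "i = k") auto
  qed
  then show ?thesis using good by simp
next
  case True
  define z where "z = (k, s R + 1)"
  have ins: "insert z (L k) = L (k + 1)"
  proof (rule Set.set_eqI)
    fix x :: box
    obtain i c where ic: "x = (i, c)" by (cases x) auto
    show "x \<in> insert z (L k) \<longleftrightarrow> x \<in> L (k + 1)"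
      using True ic k by (cases "i = k") (auto simp: z_def)
  qed
  have LK0: "L (k + 1) \<subseteq> K0" using k by auto
  have Lideal: "ideal (L k)" "ideal (L (k + 1))" using ideal_L k by auto
  have z: "ready z (L k)"
    unfolding ready_def
  proof (intro conjI ballI impI)
    show "z \<in> D" "z \<notin> L k" using True k bounds[of k] rows by (auto simp: z_def)
    fix y assume "y \<in> D" "below y z"
    then show "y \<in> L k" using bounds[of "fst y"] True by (cases y) (auto simp: below_def z_def)
  qed
  have TR: "ready TR (L (k + 1))"
    unfolding ready_def
  proof (intro conjI ballI impI)
    show "TR \<in> D" "TR \<notin> L (k + 1)" using corners_in bounds12 rows by (auto simp: TR_def)
    fix y assume "y \<in> D" "below y TR"
    then show "y \<in> L (k + 1)" by (cases y) (auto simp: below_def TR_def)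
  qed
  have V1: "ready V1 (L (k + 1))"
    unfolding ready_def
  proof (intro conjI ballI impI)
    show "V1 \<in> D" "V1 \<notin> L (k + 1)" using corners_in bounds12 rows by (auto simp: V1_def)
    fix y assume y: "y \<in> D" "below y V1"
    obtain i c where ic: "y = (i, c)" by (cases y) auto
    have "i = 1 \<or> i = 2" using y ic by (auto simp: below_def V1_def)
    then show "y \<in> L (k + 1)" using y ic bounds12 rows k
      by (auto simp: below_def V1_def split: if_splits)
  qed
  have K2: "TR \<in> K2" "BL \<in> K2" "V1 \<in> K2" "K0 \<subseteq> K2" by (auto simp: K2_def K1_def)
  have "insert TR (L (k + 1)) \<subseteq> K2" using LK0 K2 by blast
  then obtain X where "X \<in> LE (insert TR (L (k + 1))) K2"
    using LE_exists[OF ideal_insert[OF Lideal(2) TR] ideal_K2] by blast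
  then have A1: "TR # X \<in> LE (insert z (L k)) K2" using TR ins by simp
  \<comment> \<open>After \<open>V1\<close>, the corners \<open>TR\<close> and \<open>BL\<close> can
    be added in either order.\<close>
  obtain B C where BC: "B \<in> LE (insert V1 (L (k + 1))) K2" "C \<in> LE (insert V1 (L (k + 1))) K2" "B \<noteq> C"
    by (rule two_LE[of "insert V1 (L (k + 1))" "insert V1 K0" K2 TR BL])
      (use ideal_insert[OF Lideal(2) V1] ideal_insert[OF ideal_K0 ready_K0(3)] ideal_K2 LK0 K2
        ready_insert[OF ready_K0(1,3)] ready_insert[OF ready_K0(2,3)] corners_distinct in auto)
  then have A23: "V1 # B \<in> LE (insert z (L k)) K2" "V1 # C \<in> LE (insert z (L k)) K2"
    using V1 ins by auto
  have zc: "content z \<le> content V1" using k bounds12 by (auto simp: z_def content_def V1_def)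
  have cz: "content z \<le> content u \<and> content u < content TR" if "u \<in> insert z (L k)" for u
  proof -
    have "u \<in> L (k + 1)" using that ins by simp
    then have "content z \<le> content u" using k bounds12 by (cases u) (auto simp: z_def content_def)
    moreover have "u \<in> D" "u \<noteq> TR" using \<open>u \<in> L (k + 1)\<close> Lideal(2) TR by (auto simp: ideal_def ready_def)
    ultimately show ?thesis using content_le_TR[of u] by linarith
  qed
  have moved: "\<bar>content V1 - content u\<bar> \<noteq> content TR - content z" if "u \<in> insert z (L k)" for u
    using cz[OF that] zc V1_content by linarith
  show ?thesis
  proof (rule grow_left_triple[OF Lideal(1) z ideal_K2 _ A1 A23, where b = "content TR - content z"])
    show "good (insert z (L k)) K2" using good ins by simp
    show "distinct [TR # X, V1 # B, V1 # C]" using corners_distinct BC by auto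
    show "content TR - content z = \<bar>content (hd (TR # X)) - content z\<bar>" using cz[of z] by simp
    show "2 \<le> content TR - content z" using k bounds12 by (simp add: z_def content_def TR_def)
    show "\<bar>content (hd (TR # X)) - content u\<bar> \<noteq> content TR - content z"
      if "u \<in> L k" "ideal (insert z (L k) - {u})" for u
      using maximal_content[OF Lideal(1) z that] cz[of u] that by simp
  qed (use moved in auto)
qed

lemma good_L: "good (L 2) K2"
proof -
  have "good (L (R - int n)) K2" if "int n \<le> R - 2" for n
    using that
  proof (induction n)
    case 0
    have "L R = K0" by auto
    then show ?case using good_K0_K2 by simp
  next
    case (Suc n)
    then show ?case using good_L_step[of "R - int (Suc n)"] by simp
  qed
  from this[of "nat (R - 2)"] show ?thesis using rows by simp
qed

definition N :: "int \<Rightarrow> box set" where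
  "N j = {(i, c). i = 1 \<and> s 1 < c \<and> c < j}"

lemma mem_N [simp]: "(i, c) \<in> N j \<longleftrightarrow> i = 1 \<and> s 1 < c \<and> c < j"
  by (simp add: N_def)

lemma ideal_N: "j \<le> e 1 + 1 \<Longrightarrow> ideal (N j)"
  using rows by (auto simp: ideal_def below_def)

lemma ready_N: "s 1 < j \<Longrightarrow> j \<le> e 1 \<Longrightarrow> ready (1, j) (N j)"
  using rows by (auto simp: ready_def below_def)

text \<open>The remaining first row is a chain, so \<open>z\<close> is its only removable box. The
  companions start with the right neighbour of \<open>z\<close>, at content difference 1, and are
  never exchanged with it.\<close>

lemma good_N_step:
  assumes j: "s 1 < j" "j < e 1" and good: "good (N (j + 1)) K2"
  shows "good (N j) K2"
proof -
  define z :: box where "z = (1, j)"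
  have ins: "insert z (N j) = N (j + 1)" and ins2: "insert (1, j + 1) (N (j + 1)) = N (j + 2)"
    using j by (auto simp: z_def)
  have z: "ready z (N j)" and z': "ready (1, j + 1) (N (j + 1))" using ready_N j by (auto simp: z_def)
  have K2: "TR \<in> K2" "BL \<in> K2" "V1 \<in> K2" "K0 \<subseteq> K2" by (auto simp: K2_def K1_def)
  have sub: "N (j + 2) \<subseteq> insert TR K0" using j by (auto simp: TR_def)
  obtain B C where BC: "B \<in> LE (N (j + 2)) K2" "C \<in> LE (N (j + 2)) K2" "B \<noteq> C"
    by (rule two_LE[of "N (j + 2)" "insert TR K0" K2 BL V1])
      (use ideal_N[of "j + 2"] j ideal_insert[OF ideal_K0 ready_K0(1)] ideal_K2 sub K2
        ready_insert[OF ready_K0(2,1)] ready_insert[OF ready_K0(3,1)] corners_distinct in auto)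
  have A23: "(1, j + 1) # B \<in> LE (insert z (N j)) K2" "(1, j + 1) # C \<in> LE (insert z (N j)) K2"
    using BC z' ins ins2 by auto
  show ?thesis
  proof (rule grow_left_only[OF _ ideal_K2 z _ _ _ A23])
    show "ideal (N j)" using ideal_N j by simp
    have "BL \<notin> N (j + 1)" using rows by (simp add: BL_def)
    then show "insert z (N j) \<noteq> K2" using ins K2 by metis
    show "\<not> ideal (insert z (N j) - {u})" if "u \<in> N j" for u
    proof
      assume id: "ideal (insert z (N j) - {u})"
      have "z \<in> insert z (N j) - {u}" using that z by (auto simp: ready_def)
      moreover have "below u z" using that by (cases u) (auto simp: below_def z_def)
      moreover have "u \<in> D" using that j rows by (cases u) auto
      ultimately show False using id unfolding ideal_def by blast
    qed
    show "good (insert z (N j)) K2" using good ins by simp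
  qed (use BC in \<open>auto simp: content_def z_def\<close>)
qed

lemma good_start: "good {} K2"
proof -
  have "good (N (e 1 - int n)) K2" if "int n \<le> e 1 - s 1 - 1" for n
    using that
  proof (induction n)
    case 0
    \<comment> \<open>For \<open>k = 2\<close> the column part is at most one box of row 1, which
      the row part contains.\<close>
    have "L 2 = N (e 1)"
    proof (intro equalityI subsetI)
      fix x assume x: "x \<in> L 2"
      have "fst x = 1" using x by (cases x) auto
      then show "x \<in> N (e 1)" using x bounds12 rows by (cases x) auto
    next
      fix x assume "x \<in> N (e 1)"
      then show "x \<in> L 2" by (cases x) auto
    qed
    then show ?case using good_L by simp
  next
    case (Suc n)
    then show ?case using good_N_step[of "e 1 - int (Suc n)"] by simp
  qed
  from this[of "nat (e 1 - s 1 - 1)"] have "good (N (s 1 + 1)) K2" using bounds12 rows by simp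
  moreover have "N (s 1 + 1) = {}" by auto
  ultimately show ?thesis by simp
qed

section \<open>Enlarging the upper ideal row by row\<close>

definition M :: "int \<Rightarrow> int \<Rightarrow> box set" where
  "M k c = K2 \<union> {(i, j). (i, j) \<in> D \<and> (i < k \<or> i = k \<and> j < c)}"

lemma mem_K2: "(i, j) \<in> K2 \<longleftrightarrow> (i, j) = V1 \<or> (i, j) = TR \<or> (i, j) = BL \<or> (i, j) \<in> K0"
  by (auto simp: K2_def K1_def)

lemma mem_M: "(i, j) \<in> M k c \<longleftrightarrow> (i, j) \<in> K2 \<or> (i, j) \<in> D \<and> (i < k \<or> i = k \<and> j < c)"
  by (simp add: M_def)

lemma ideal_M: "ideal (M k c)"
proof -
  have "ideal {(i, j). (i, j) \<in> D \<and> (i < k \<or> i = k \<and> j < c)}"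
    by (auto simp: ideal_def below_def)
  then show ?thesis using ideal_K2 unfolding M_def ideal_def by blast
qed

lemma insert_M: "(k, c) \<in> D \<Longrightarrow> insert (k, c) (M k c) = M k (c + 1)"
  by (auto simp: M_def)

lemma ready_M: "(k, c) \<in> D \<Longrightarrow> (k, c) \<notin> K2 \<Longrightarrow> ready (k, c) (M k c)"
  by (auto simp: ready_def M_def below_def)

text \<open>Boxes are added in reading order, so any other addable box lies strictly lower and
  strictly further left; its content is smaller by at least 2.\<close>

lemma ready_M_cases:
  assumes v: "ready (k, c) (M k c)" and u: "ready (i, j) (M k c)"
  shows "(i, j) = (k, c) \<or> k < i \<and> j < c"
proof -
  have "\<not> below (k, c) (i, j)" using u v by (auto simp: ready_def)
  moreover have "k \<le> i" "i = k \<longrightarrow> c \<le> j" using u by (auto simp: ready_def mem_M)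
  ultimately show ?thesis by (auto simp: below_def)
qed

text \<open>Before the last row \<open>BL\<close> is still maximal and can come last. Any addable
  box other than \<open>(k, c)\<close> has content strictly between those of \<open>BL\<close> and
  \<open>(k, c)\<close>, so distance \<open>b\<close> from \<open>BL\<close> identifies
  \<open>(k, c)\<close>. The companions end with a box \<open>t\<close> from which distance
  \<open>b\<close> does not occur.\<close>

lemma good_M_step:
  assumes k: "2 \<le> k" "k < R" and c: "s k < c" "c \<le> e k" and good: "good {} (M k c)"
  shows "good {} (M k (c + 1))"
proof (cases "(k, c) \<in> K2")
  case True
  then have "insert (k, c) (M k c) = M k c" by (auto simp: M_def)
  then show ?thesis using insert_M[of k c] k c good by simp
next
  case nK2: False
  have vD: "(k, c) \<in> D" using k c by simp
  have v: "ready (k, c) (M k c)" using ready_M vD nK2 by blast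
  note bk = bounds[of k] bounds[of "k - 1"]
  have c2: "s R + 2 \<le> c" using nK2 k c bk by (auto simp: mem_K2)
  have K2: "TR \<in> M k c" "BL \<in> M k c" "V1 \<in> M k c" "K0 \<subseteq> M k c" "K1 \<subseteq> M k c"
    by (auto simp: M_def K2_def K1_def)
  have BLmax: "\<not> below BL u" if "u \<in> M k c" for u
    using that k bounds12 rows by (cases u) (auto simp: mem_M mem_K2 below_def BL_def TR_def V1_def)
  have BL': "ideal (M k c - {BL})" "ready BL (M k c - {BL})"
    using remove_maximal[OF ideal_M K2(2) BLmax] by blast+
  obtain X where X: "X \<in> LE {} (M k c - {BL})" using LE_exists[OF ideal_empty BL'(1)] by blast
  have "insert BL (M k c - {BL}) = M k c" using K2 by blast
  then have "[BL] \<in> LE (M k c - {BL}) (M k c)" using BL'(2) by simp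
  then have A1: "X @ [BL] \<in> LE {} (M k c)" using X LE_append by blast
  define b where "b = content (k, c) - content BL"
  have b2: "2 \<le> b" using k c2 by (simp add: b_def content_def BL_def)
  have ready_u: "u = (k, c) \<or> content u \<le> content (k, c) - 2 \<and> content BL < content u"
    if u: "ready u (M k c)" for u
  proof -
    obtain i j where ij: "u = (i, j)" by (cases u) auto
    have "u \<in> D" "u \<noteq> BL" using u K2 by (auto simp: ready_def)
    then have "content BL < content u" using content_ge_BL[of u] by linarith
    then show ?thesis using ready_M_cases[OF v, of i j] u ij by (auto simp: content_def)
  qed
  \<comment> \<open>The choice of \<open>t\<close>: the left neighbour of \<open>(k, c)\<close> if
    it exists outside \<open>K1\<close>, which is too close; otherwise the end of the previous row,
    which \<open>gap\<close> makes too far.\<close>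
  have "\<exists>t. t \<in> M k c \<and> t \<notin> K1 \<and> (\<forall>u\<in>M k c. \<not> below t u) \<and>
      (\<forall>u. ready u (M k c) \<longrightarrow> \<bar>content t - content u\<bar> \<noteq> b)"
  proof (cases "s k < c - 1 \<and> (k, c - 1) \<notin> K1")
    case True
    then have c3: "s R + 2 \<le> c - 1" using bk k by (auto simp: K1_def)
    have "\<not> below (k, c - 1) u" if "u \<in> M k c" for u
      using that True k c nK2 bounds12 rows c3
      by (cases u) (auto simp: mem_M mem_K2 below_def BL_def TR_def V1_def split: if_splits)
    moreover have "\<bar>content (k, c - 1) - content u\<bar> \<noteq> b" if "ready u (M k c)" for u
      using ready_u[OF that] b2 by (auto simp: b_def content_def)
    moreover have "(k, c - 1) \<in> M k c" using True k c by (simp add: mem_M)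
    ultimately show ?thesis using True by blast
  next
    case False
    then have cases: "c = s k + 1 \<and> s R < s k \<or> c = s R + 2 \<and> s k = s R"
      using c c2 k bk by (auto simp: K1_def TR_def BL_def)
    \<comment> \<open>In row 2 the box in question is \<open>V1\<close>, which lies in
      \<open>K2\<close>. So the previous row is not the first one and its end is not
      \<open>TR\<close>.\<close>
    have k3: "3 \<le> k"
    proof (rule ccontr)
      assume "\<not> 3 \<le> k"
      then have "k = 2" using k by simp
      then show False using cases nK2 by (auto simp: mem_K2 V1_def)
    qed
    define t where "t = (k - 1, e (k - 1))"
    have g: "s 1 - s R + R - 1 < e (k - 1) - s k" using gap[of "k - 1"] k3 k by simp
    have "\<not> below t u" if "u \<in> M k c" for u
    proof -
      obtain i j where ij: "u = (i, j)" by (cases u) auto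
      show ?thesis
      proof (cases "i = k - 1")
        case True
        then have "j \<le> e (k - 1)"
          using that ij ideal_M[of k c] by (auto simp: ideal_def)
        then show ?thesis using True ij by (auto simp: below_def t_def)
      next
        case False
        then show ?thesis using that ij k3 k c cases bk g rows
          by (auto simp: mem_M mem_K2 below_def BL_def TR_def V1_def t_def)
      qed
    qed
    moreover have "\<bar>content t - content u\<bar> \<noteq> b" if "ready u (M k c)" for u
      using ready_u[OF that] b2 cases g bk k3 k by (auto simp: b_def content_def t_def BL_def)
    moreover have "t \<in> M k c" using k3 k bk rows by (simp add: mem_M t_def)
    moreover have "t \<notin> K1" using k3 k bk rows by (auto simp: t_def K1_def TR_def BL_def)
    ultimately show ?thesis by blast
  qed
  then obtain t where t: "t \<in> M k c" "t \<notin> K1" "\<And>u. u \<in> M k c \<Longrightarrow> \<not> below t u"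
      "\<And>u. ready u (M k c) \<Longrightarrow> \<bar>content t - content u\<bar> \<noteq> b" by blast
  \<comment> \<open>As \<open>t\<close> lies outside \<open>K1\<close>, the corners
    \<open>TR\<close> and \<open>BL\<close> can be ordered freely before \<open>t\<close> closes the
    word.\<close>
  have tne: "t \<noteq> TR" "t \<noteq> BL" "t \<notin> K0" using t(2) by (auto simp: K1_def)
  obtain A B where AB: "A \<in> LE {} (M k c)" "B \<in> LE {} (M k c)" "A \<noteq> B" "last A = t" "last B = t"
    by (rule two_LE_snoc[OF ideal_empty ideal_K0 ideal_M _ ready_K0(1,2) corners_distinct(1) K2(1,2,4) t(1) tne t(3)])
      auto
  have "good {} (insert (k, c) (M k c))"
  proof (rule grow_right_triple[OF ideal_empty ideal_M v good A1 AB(1,2), where b = b])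
    show "distinct [X @ [BL], A, B]" using AB tne by auto
    show "b = \<bar>content (last (X @ [BL])) - content (k, c)\<bar>" using b2 by (simp add: b_def)
    show "\<bar>content (last (X @ [BL])) - content u\<bar> \<noteq> b" if "ready u (M k c)" "u \<noteq> (k, c)" for u
      using ready_u[OF that(1)] that(2) b2 by (auto simp: b_def)
  qed (use b2 t AB in auto)
  then show ?thesis using insert_M[OF vD] by simp
qed

lemma good_M_row:
  assumes k: "2 \<le> k" "k < R" and good: "good {} (M k (s k + 1))"
  shows "good {} (M (k + 1) (s (k + 1) + 1))"
proof -
  have "good {} (M k (s k + 1 + int n))" if "int n \<le> e k - s k" for n
    using that
  proof (induction n)
    case (Suc n)
    then show ?case using good_M_step[of k "s k + 1 + int n"] k by (simp add: algebra_simps)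
  qed (use good in simp)
  from this[of "nat (e k - s k)"] have "good {} (M k (e k + 1))"
    using bounds[of k] k rows by (simp add: add.commute)
  moreover have "M k (e k + 1) = M (k + 1) (s (k + 1) + 1)" by (auto simp: M_def)
  ultimately show ?thesis by simp
qed

lemma good_M_last: "good {} (M R (s R + 1))"
proof -
  have "good {} (M (2 + int n) (s (2 + int n) + 1))" if "int n \<le> R - 2" for n
    using that
  proof (induction n)
    case 0
    have "(i, j) \<in> K2" if ij: "(i, j) \<in> D" "i < 2 \<or> i = 2 \<and> j < s 2 + 1" for i j
    proof -
      have "i = 1" using ij by auto
      then show ?thesis using ij by (auto simp: mem_K2 TR_def)
    qed
    then have "M 2 (s 2 + 1) = K2" by (auto simp: M_def simp del: mem_shape)
    then show ?case using good_start by simp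
  next
    case (Suc n)
    then show ?case using good_M_row[of "2 + int n"] by (simp add: algebra_simps)
  qed
  from this[of "nat (R - 2)"] show ?thesis using rows by simp
qed

text \<open>In the last row \<open>BL\<close> need no longer be maximal, but \<open>(R, c)\<close>
  is the only addable box and its left neighbour is too close for an exchange. The companions differ
  in the order of \<open>TR\<close> and \<open>V1\<close>, since \<open>BL\<close> may itself be
  that neighbour.\<close>

lemma good_M_last_step:
  assumes c: "s R + 1 < c" "c \<le> e R" and good: "good {} (M R c)"
  shows "good {} (M R (c + 1))"
proof -
  have vD: "(R, c) \<in> D" using c rows by simp
  have "(R, c) \<notin> K2" using c rows by (auto simp: mem_K2 V1_def TR_def BL_def)
  then have v: "ready (R, c) (M R c)" using ready_M vD by blast
  have K2: "TR \<in> M R c" "V1 \<in> M R c" "K0 \<subseteq> M R c" by (auto simp: M_def K2_def K1_def)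
  have tM: "(R, c - 1) \<in> M R c" using c rows by (auto simp: mem_M)
  have tne: "(R, c - 1) \<noteq> TR" "(R, c - 1) \<noteq> V1" "(R, c - 1) \<notin> K0"
    using rows by (auto simp: TR_def V1_def)
  have max: "\<not> below (R, c - 1) u" if "u \<in> M R c" for u
    using that c rows by (cases u) (auto simp: mem_M mem_K2 below_def BL_def TR_def V1_def)
  obtain A B where AB: "A \<in> LE {} (M R c)" "B \<in> LE {} (M R c)" "A \<noteq> B" "last A = (R, c - 1)" "last B = (R, c - 1)"
    by (rule two_LE_snoc[OF ideal_empty ideal_K0 ideal_M _ ready_K0(1,3) corners_distinct(2) K2 tM tne max]) auto
  have "good {} (insert (R, c) (M R c))"
  proof (rule grow_right_only[OF ideal_empty ideal_M _ _ v _ good AB(1-3)])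
    show "u = (R, c)" if u: "ready u (M R c)" for u
      using ready_M_cases[OF v, of "fst u" "snd u"] u by (cases u) (auto simp: ready_def)
  qed (use K2 AB in \<open>auto simp: content_def\<close>)
  then show ?thesis using insert_M[OF vD] by simp
qed

lemma good_shape: "good {} D"
proof -
  have "good {} (M R (s R + 2 + int n))" if "int n \<le> e R - s R - 1" for n
    using that
  proof (induction n)
    case 0
    \<comment> \<open>The row starts with \<open>BL\<close>, which \<open>K2\<close> contains, so
      genuine additions begin in column \<open>s R + 2\<close>.\<close>
    have "insert (R, s R + 1) (M R (s R + 1)) = M R (s R + 1)" by (auto simp: M_def mem_K2 BL_def)
    then show ?case using good_M_last insert_M[of R "s R + 1"] bounds12 rows by (simp add: algebra_simps)
  next
    case (Suc n)
    then show ?case using good_M_last_step[of "s R + 2 + int n"] by (simp add: algebra_simps)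
  qed
  from this[of "nat (e R - s R - 1)"] have "good {} (M R (e R + 1))"
    using bounds12 rows by (simp add: add.commute)
  moreover have "M R (e R + 1) = D"
  proof
    show "M R (e R + 1) \<subseteq> D" using ideal_M by (simp add: ideal_def)
    show "D \<subseteq> M R (e R + 1)" by (auto simp: M_def)
  qed
  ultimately show ?thesis by simp
qed

end

section \<open>Transfer to tableaux\<close>

context skew_shape
begin

text \<open>Entries start from 1; the default 0 off the word is the value that \<open>YT\<close>
  prescribes off the shape.\<close>

definition tableau_of :: "box list \<Rightarrow> box \<Rightarrow> int" where
  "tableau_of w x = (if x \<in> set w then int (length (takeWhile (\<lambda>y. y \<noteq> x) w)) + 1 else 0)"

definition standard :: "(box \<Rightarrow> int) \<Rightarrow> bool" where
  "standard T \<longleftrightarrow> bij_betw T D {1..int (card D)} \<and> (\<forall>x. x \<notin> D \<longrightarrow> T x = 0) \<and>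
     (\<forall>x\<in>D. \<forall>y\<in>D. below x y \<longrightarrow> T x < T y)"

lemma tableau_of_append: "x \<notin> set P \<Longrightarrow> tableau_of (P @ x # Q) x = int (length P) + 1"
proof -
  assume x: "x \<notin> set P"
  then have "takeWhile (\<lambda>y. y \<noteq> x) (P @ x # Q) = P"
    by (subst takeWhile_append2) auto
  then show ?thesis by (simp add: tableau_of_def)
qed

lemma tableau_of_nth:
  assumes "distinct w" "n < length w"
  shows "tableau_of w (w ! n) = int n + 1"
proof -
  have w: "w = take n w @ w ! n # drop (Suc n) w" using assms(2) by (rule id_take_nth_drop)
  have "distinct (take n w @ w ! n # drop (Suc n) w)" using assms(1) w by simp
  then have "w ! n \<notin> set (take n w)" by simp
  from tableau_of_append[OF this, of "drop (Suc n) w"] show ?thesis using w assms(2) by simp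
qed

lemma ext_iff_nth: "ext I w \<longleftrightarrow> (\<forall>n<length w. ready (w ! n) (I \<union> set (take n w)))"
proof (induction w arbitrary: I)
  case (Cons x w)
  have "(\<forall>n<length (x # w). ready ((x # w) ! n) (I \<union> set (take n (x # w)))) \<longleftrightarrow>
      ready x I \<and> (\<forall>n<length w. ready (w ! n) (insert x I \<union> set (take n w)))"
    by (auto simp: All_less_Suc2)
  then show ?case using Cons by simp
qed simp

lemma word_distinct: "w \<in> LE {} D \<Longrightarrow> distinct w \<and> set w = D \<and> length w = card D"
  using LE_distinct[of w "{}" D] LE_D[of w "{}" D] distinct_card by force

lemma tableau_of_standard:
  assumes w: "w \<in> LE {} D"
  shows "standard (tableau_of w)"
  unfolding standard_def
proof (intro conjI ballI allI impI)
  note wd = word_distinct[OF w]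
  show "bij_betw (tableau_of w) D {1..int (card D)}"
  proof (rule bij_betwI')
    fix x y assume "x \<in> D" "y \<in> D"
    then obtain m n where "x = w ! m" "m < length w" "y = w ! n" "n < length w"
      using wd by (metis in_set_conv_nth)
    then show "tableau_of w x = tableau_of w y \<longleftrightarrow> x = y"
      using tableau_of_nth wd by (metis nth_eq_iff_index_eq add_right_cancel of_nat_eq_iff)
  next
    fix x assume "x \<in> D"
    then obtain m where "x = w ! m" "m < length w" using wd by (metis in_set_conv_nth)
    then show "tableau_of w x \<in> {1..int (card D)}" using tableau_of_nth wd by auto
  next
    fix i assume i: "i \<in> {1..int (card D)}"
    then have "nat (i - 1) < length w" using wd by auto
    then have "w ! nat (i - 1) \<in> D" "i = tableau_of w (w ! nat (i - 1))"
      using tableau_of_nth[of w "nat (i - 1)"] wd i by auto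
    then show "\<exists>x\<in>D. i = tableau_of w x" by blast
  qed
  show "tableau_of w x = 0" if "x \<notin> D" for x using that wd by (simp add: tableau_of_def)
  fix x y assume xy: "x \<in> D" "y \<in> D" "below x y"
  obtain n where n: "y = w ! n" "n < length w" using xy wd by (metis in_set_conv_nth)
  have "ready y (set (take n w))" using w n ext_iff_nth by (auto simp: LE_def)
  then have "x \<in> set (take n w)" using xy by (auto simp: ready_def)
  then obtain m where m: "m < length (take n w)" "x = take n w ! m" by (metis in_set_conv_nth)
  then have "m < n" "x = w ! m" by auto
  then show "tableau_of w x < tableau_of w y" using n tableau_of_nth[of w] wd by simp
qed

text \<open>The word lists the preimages of 1, 2, ... under \<open>T\<close>; monotonicity along
  \<open>below\<close> makes each letter addable in its turn.\<close>

lemma tableau_of_surj: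
  assumes T: "standard T"
  shows "T \<in> tableau_of ` LE {} D"
proof -
  have bij: "bij_betw T D {1..int (card D)}" and zero: "\<And>x. x \<notin> D \<Longrightarrow> T x = 0"
    and mono: "\<And>x y. x \<in> D \<Longrightarrow> y \<in> D \<Longrightarrow> below x y \<Longrightarrow> T x < T y"
    using T by (auto simp: standard_def)
  define f where "f n = inv_into D T (int n + 1)" for n :: nat
  have f: "f n \<in> D" "T (f n) = int n + 1" if "n < card D" for n
  proof -
    have "int n + 1 \<in> T ` D" using bij that by (auto simp: bij_betw_def)
    then show "f n \<in> D" "T (f n) = int n + 1" unfolding f_def by (auto intro: inv_into_into f_inv_into_f)
  qed
  have fT: "\<exists>n<card D. x = f n \<and> T x = int n + 1" if x: "x \<in> D" for x
  proof -
    have Tx: "T x \<in> {1..int (card D)}" using bij x by (auto simp: bij_betw_def)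
    then have "f (nat (T x - 1)) = x" unfolding f_def using bij x by (simp add: bij_betw_def)
    then show ?thesis using Tx by (intro exI[of _ "nat (T x - 1)"]) auto
  qed
  define w where "w = map f [0..<card D]"
  have nth: "w ! n = f n" if "n < card D" for n using that by (simp add: w_def)
  have setw: "set w = D"
  proof
    show "set w \<subseteq> D" using f by (auto simp: w_def)
    show "D \<subseteq> set w" using fT by (force simp: w_def)
  qed
  have inj: "inj_on f {0..<card D}"
  proof (rule inj_onI)
    fix m n assume mn: "m \<in> {0..<card D}" "n \<in> {0..<card D}" "f m = f n"
    have "int m + 1 = T (f m)" using f(2)[of m] mn(1) by simp
    also have "\<dots> = T (f n)" by (simp only: mn(3))
    also have "\<dots> = int n + 1" using f(2)[of n] mn(2) by simp
    finally show "m = n" by simp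
  qed
  then have dist: "distinct w" by (simp add: w_def distinct_map)
  have "ext {} w"
    unfolding ext_iff_nth
  proof (intro allI impI)
    fix n assume n: "n < length w"
    then have n': "n < card D" by (simp add: w_def)
    have tk: "set (take n w) = f ` {0..<n}" using n' by (simp add: w_def take_map)
    show "ready (w ! n) ({} \<union> set (take n w))"
      unfolding ready_def nth[OF n'] tk
    proof (intro conjI ballI impI)
      show "f n \<in> D" using f n' by blast
      show "f n \<notin> {} \<union> f ` {0..<n}"
      proof
        assume "f n \<in> {} \<union> f ` {0..<n}"
        then obtain m where m: "m < n" "f n = f m" by auto
        then have "n = m" using inj_onD[OF inj m(2)] n' by simp
        then show False using m(1) by simp
      qed
      fix y assume y: "y \<in> D" "below y (f n)"
      obtain m where m: "m < card D" "y = f m" "T y = int m + 1" using fT y(1) by blast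
      have "m < n" using mono[OF y(1) f(1)[OF n'] y(2)] f(2)[OF n'] m by simp
      then show "y \<in> {} \<union> f ` {0..<n}" using m by simp
    qed
  qed
  then have w: "w \<in> LE {} D" using setw by (simp add: LE_def)
  have "tableau_of w x = T x" for x
  proof (cases "x \<in> D")
    case True
    then obtain n where n: "n < card D" "x = f n" "T x = int n + 1" using fT by blast
    then show ?thesis using tableau_of_nth[OF dist, of n] nth[of n] by (simp add: w_def)
  next
    case False
    then show ?thesis using zero setw by (simp add: tableau_of_def)
  qed
  then have "tableau_of w = T" by blast
  then show ?thesis using w by blast
qed

lemma tableau_of_image: "tableau_of ` LE {} D = {T. standard T}"
  using tableau_of_standard tableau_of_surj by blast

lemma tableau_of_inj: "inj_on tableau_of (LE {} D)"
proof (rule inj_onI)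
  fix v w assume vw: "v \<in> LE {} D" "w \<in> LE {} D" "tableau_of v = tableau_of w"
  note d = word_distinct[OF vw(1)] word_distinct[OF vw(2)]
  show "v = w"
  proof (rule nth_equalityI)
    show "length v = length w" using d by simp
    fix i assume i: "i < length v"
    then have "v ! i \<in> set w" using d by (metis nth_mem)
    then obtain j where j: "v ! i = w ! j" "j < length w" by (metis in_set_conv_nth)
    have "tableau_of v (v ! i) = int i + 1" using tableau_of_nth d i by blast
    moreover have "tableau_of w (w ! j) = int j + 1" using tableau_of_nth d j by blast
    ultimately have "i = j" using vw(3) j by simp
    then show "v ! i = w ! i" using j by simp
  qed
qed

lemma tableau_of_swap:
  assumes d: "distinct (P @ x # y # Q)"
  shows "tableau_of (P @ y # x # Q) z =
    (if tableau_of (P @ x # y # Q) z = int (length P) + 1 then int (length P) + 2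
     else if tableau_of (P @ x # y # Q) z = int (length P) + 2 then int (length P) + 1
     else tableau_of (P @ x # y # Q) z)"
proof (cases "z \<in> set (P @ x # y # Q)")
  case False
  then show ?thesis by (auto simp: tableau_of_def)
next
  case True
  let ?w = "P @ x # y # Q" and ?v = "P @ y # x # Q"
  have d': "distinct ?v" using d by auto
  obtain n where n: "n < length ?w" "z = ?w ! n" using True by (metis in_set_conv_nth)
  have Tz: "tableau_of ?w z = int n + 1" using tableau_of_nth[OF d n(1)] n by simp
  consider "n = length P" | "n = Suc (length P)" | "n \<noteq> length P" "n \<noteq> Suc (length P)" by blast
  then show ?thesis
  proof cases
    case 1
    then have "z = ?v ! Suc (length P)" using n by (simp add: nth_append)
    then show ?thesis using tableau_of_nth[OF d', of "Suc (length P)"] Tz 1 by simp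
  next
    case 2
    then have "z = ?v ! length P" using n by (simp add: nth_append)
    then show ?thesis using tableau_of_nth[OF d', of "length P"] Tz 2 by simp
  next
    case 3
    have "?w ! n = ?v ! n" using 3 by (auto simp: nth_append nth_Cons split: nat.splits)
    then have "z = ?v ! n" using n by simp
    moreover have "n < length ?v" using n by simp
    ultimately have "tableau_of ?v z = int n + 1" using tableau_of_nth[OF d'] by metis
    then show ?thesis using Tz 3 by auto
  qed
qed

text \<open>If consecutive entries lay in comparable boxes of different rows and columns, a corner
  of their rectangle would need an entry in between. For incomparable boxes the two measures agree,
  and \<open>b \<ge> 2\<close> rules out neighbouring boxes.\<close>

lemma swap_distance:
  assumes w: "P @ x # y # Q \<in> LE {} D" and b: "2 \<le> b"
  shows "fst x \<noteq> fst y \<and> snd x \<noteq> snd y \<and> \<bar>fst x - fst y\<bar> + \<bar>snd x - snd y\<bar> = b \<longleftrightarrow>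
    \<bar>content x - content y\<bar> = b"
proof -
  have words: "ideal (set P)" "ready x (set P)" "ready y (insert x (set P))"
  proof -
    have *: "P \<in> LE {} (set P)" "x # y # Q \<in> LE (set P) D"
      using w unfolding LE_append_iff by simp_all
    show "ideal (set P)" using ideal_ext[of "{}" P] *(1) by (simp add: LE_def)
    show "ready x (set P)" "ready y (insert x (set P))" using *(2) by simp_all
  qed
  have inD: "x \<in> D" "y \<in> D" and nyx: "\<not> below y x"
    using words by (auto simp: ready_def)
  have eq: "fst x \<noteq> fst y \<and> snd x \<noteq> snd y \<and> \<bar>fst x - fst y\<bar> + \<bar>snd x - snd y\<bar> = \<bar>content x - content y\<bar>"
    if "\<not> below x y" "x \<noteq> y"
    using that nyx by (cases x; cases y) (auto simp: below_def content_def)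
  have ne: "x \<noteq> y" using words by (auto simp: ready_def)
  show ?thesis
  proof
    assume l: "fst x \<noteq> fst y \<and> snd x \<noteq> snd y \<and> \<bar>fst x - fst y\<bar> + \<bar>snd x - snd y\<bar> = b"
    have "\<not> below x y"
    proof
      assume xy: "below x y"
      define u where "u = (fst x, snd y)"
      have "u \<in> D" using convex[OF inD, of u] xy by (auto simp: u_def below_def)
      moreover have "below u y" "below x u" using xy l by (auto simp: u_def below_def prod_eq_iff)
      ultimately have "u \<in> set P" using words(3) by (auto simp: ready_def below_def)
      then have "x \<in> set P" using words(1) \<open>below x u\<close> inD by (auto simp: ideal_def)
      then show False using words(2) by (simp add: ready_def)
    qed
    then show "\<bar>content x - content y\<bar> = b" using eq ne l by simp
  next
    assume c: "\<bar>content x - content y\<bar> = b"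
    then have "ready y (set P)" using swap_ready[OF words] b by simp
    then have "\<not> below x y" using words(2) inD by (auto simp: ready_def)
    then show "fst x \<noteq> fst y \<and> snd x \<noteq> snd y \<and> \<bar>fst x - fst y\<bar> + \<bar>snd x - snd y\<bar> = b"
      using eq ne c by simp
  qed
qed

end

section \<open>From all 3-cycles to the alternating or the symmetric group\<close>

lemma double_transposition_in:
  assumes id: "id \<in> G" and comp: "\<And>f h. f \<in> G \<Longrightarrow> h \<in> G \<Longrightarrow> f \<circ> h \<in> G"
    and cyc: "\<And>a b c. {a, b, c} \<subseteq> X \<Longrightarrow> distinct [a, b, c] \<Longrightarrow> cyc3 a b c \<in> G"
    and "{a, b, x, y} \<subseteq> X" "a \<noteq> b" "x \<noteq> y"
  shows "transpose x y \<circ> transpose a b \<in> G"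
proof -
  \<comment> \<open>Two transpositions with a common point compose to a 3-cycle or the identity;
    disjoint ones are linked by inserting \<open>transpose y a\<close> twice.\<close>
  have share: "transpose u v \<circ> transpose v t \<in> G" if "{u, v, t} \<subseteq> X" "u \<noteq> v" "v \<noteq> t" for u v t
  proof (cases "u = t")
    case True
    then have "transpose u v \<circ> transpose v t = id" by (simp add: transpose_commute)
    then show ?thesis using id by simp
  next
    case False
    then have "transpose u v \<circ> transpose v t = cyc3 u v t"
      using that by (auto simp: cyc3_def transpose_def fun_eq_iff)
    then show ?thesis using cyc that False by simp
  qed
  consider "y = a" | "y = b" | "x = a" | "x = b" | "x \<noteq> a" "x \<noteq> b" "y \<noteq> a" "y \<noteq> b" by blast
  then show ?thesis
  proof cases
    case 1
    then show ?thesis using share[of x a b] assms by auto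
  next
    case 2
    then show ?thesis using share[of x b a] assms by (auto simp: transpose_commute)
  next
    case 3
    then show ?thesis using share[of y a b] assms by (auto simp: transpose_commute)
  next
    case 4
    then show ?thesis using share[of y b a] assms by (auto simp: transpose_commute)
  next
    case 5
    have "(transpose x y \<circ> transpose y a) \<circ> (transpose y a \<circ> transpose a b) \<in> G"
      by (rule comp[OF share share]) (use assms 5 in auto)
    moreover have "(transpose x y \<circ> transpose y a) \<circ> (transpose y a \<circ> transpose a b) =
        transpose x y \<circ> transpose a b"
      by (simp add: fun_eq_iff)
    ultimately show ?thesis by simp
  qed
qed

text \<open>The 3-cycles yield all even permutations. An odd element \<open>f\<close> with inverse
  \<open>h\<close> then yields every odd \<open>p\<close>, because \<open>p \<circ> h\<close> is
  even.\<close>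

lemma alternating_or_symmetric:
  assumes fin: "finite X" and sub: "G \<subseteq> {p. p permutes X}"
    and id: "id \<in> G" and comp: "\<And>f h. f \<in> G \<Longrightarrow> h \<in> G \<Longrightarrow> f \<circ> h \<in> G"
    and inv: "\<And>f. f \<in> G \<Longrightarrow> \<exists>h\<in>G. h \<circ> f = id \<and> f \<circ> h = id"
    and cyc: "\<And>a b c. {a, b, c} \<subseteq> X \<Longrightarrow> distinct [a, b, c] \<Longrightarrow> cyc3 a b c \<in> G"
  shows "G = {p. p permutes X \<and> evenperm p} \<or> G = {p. p permutes X}"
proof -
  have perm: "permutation p" if "p permutes X" for p using that fin permutation_permutes by blast
  \<comment> \<open>The induction adds one transposition at a time and so alternates parity; the
    second half is what an odd permutation has to hand on to its even successors.\<close>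
  have "(evenperm p \<longrightarrow> p \<in> G) \<and>
      (\<not> evenperm p \<longrightarrow> (\<forall>x\<in>X. \<forall>y\<in>X. x \<noteq> y \<longrightarrow> transpose x y \<circ> p \<in> G))" if "p permutes X" for p
    using that fin
  proof (induction rule: permutes_induct)
    case id
    show ?case using assms(3) evenperm_id by blast
  next
    case (swap a b p)
    have ev: "evenperm (transpose a b \<circ> p) \<longleftrightarrow> \<not> evenperm p"
      using swap perm by (simp add: evenperm_comp permutation_swap_id evenperm_swap)
    show ?case
    proof (intro conjI impI ballI)
      assume "evenperm (transpose a b \<circ> p)"
      then show "transpose a b \<circ> p \<in> G" using ev swap by blast
    next
      fix x y assume "\<not> evenperm (transpose a b \<circ> p)" and xy: "x \<in> X" "y \<in> X" "x \<noteq> y"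
      then have "p \<in> G" using ev swap by blast
      moreover have "transpose x y \<circ> transpose a b \<in> G"
        by (rule double_transposition_in[of G X a b x y]) (use assms(3) comp cyc swap xy in auto)
      ultimately have "(transpose x y \<circ> transpose a b) \<circ> p \<in> G" by (rule comp[rotated])
      then show "transpose x y \<circ> (transpose a b \<circ> p) \<in> G" by (simp add: comp_assoc)
    qed
  qed
  then have even: "p \<in> G" if "p permutes X" "evenperm p" for p using that by blast
  show ?thesis
  proof (cases "\<forall>p\<in>G. evenperm p")
    case True
    then show ?thesis using even sub by blast
  next
    case False
    then obtain f where f: "f \<in> G" "\<not> evenperm f" by blast
    obtain h where h: "h \<in> G" "h \<circ> f = id" using inv f(1) by blast
    have fh: "f permutes X" "h permutes X" using sub f h by auto
    have "\<not> evenperm h"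
      using evenperm_comp[OF perm[OF fh(2)] perm[OF fh(1)]] h(2) f(2) by (simp add: evenperm_id)
    have "p \<in> G" if p: "p permutes X" for p
    proof (cases "evenperm p")
      case False
      have "evenperm (p \<circ> h)"
        using evenperm_comp[OF perm[OF p] perm[OF fh(2)]] False \<open>\<not> evenperm h\<close> by simp
      moreover have "p \<circ> h permutes X" using permutes_compose[OF fh(2) p] .
      ultimately have "(p \<circ> h) \<circ> f \<in> G" using even comp f by blast
      then show ?thesis using h(2) by (simp add: comp_assoc)
    qed (use even p in blast)
    then show ?thesis using sub by blast
  qed
qed

text \<open>The section \<open>({}, D)\<close> has only the empty surrounding, so an isolated
  3-cycle of its fillings is a 3-cycle of tableaux.\<close>

lemma (in wide_tableau_group) cyc3_in_group:
  assumes fixes_outside: "\<And>f T. f \<in> G \<Longrightarrow> T \<notin> tab ` LE {} D \<Longrightarrow> f T = T"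
    and abc: "{a, b, c} \<subseteq> tab ` LE {} D" "distinct [a, b, c]"
  shows "cyc3 a b c \<in> G"
proof -
  obtain A B C where ABC: "A \<in> LE {} D" "B \<in> LE {} D" "C \<in> LE {} D" "a = tab A" "b = tab B" "c = tab C"
    using abc by auto
  have ctx0: "([], []) \<in> ctx {} D" by (simp add: ctx_def)
  have "isolated fill (LE {} D) (ctx {} D) (cyc3 A B C)"
    by (rule good_cyc3(2)[OF good_shape ABC(1-3)]) (use abc ABC in auto)
  then obtain f where f: "f \<in> G" "\<And>w y. w \<in> LE {} D \<Longrightarrow> y \<in> ctx {} D \<Longrightarrow> f (fill w y) = fill (cyc3 A B C w) y"
    unfolding isolated_def realizes_def by blast
  have "f T = cyc3 a b c T" for T
  proof (cases "T \<in> tab ` LE {} D")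
    case True
    then obtain w where w: "w \<in> LE {} D" "T = tab w" by blast
    then have "f T = tab (cyc3 A B C w)" using f(2)[OF w(1) ctx0] by (simp add: fill_def)
    then show ?thesis using cyc3_inj[OF tab_inj ABC(1-3) w(1)] ABC w by simp
  next
    case False
    then have "T \<noteq> a" "T \<noteq> b" "T \<noteq> c" using abc by auto
    then show ?thesis using fixes_outside[OF f(1) False] by (simp add: cyc3_def)
  qed
  then have "f = cyc3 a b c" by blast
  then show ?thesis using f(1) by simp
qed

lemma group_perm_group: "group (perm_group S)"
proof (rule groupI)
  fix p assume "p \<in> carrier (perm_group S)"
  then have "inv_into UNIV p permutes S" "inv_into UNIV p \<circ> p = id"
    by (auto simp: perm_group_def permutes_inv permutes_inv_o)
  then show "\<exists>q\<in>carrier (perm_group S). q \<otimes>\<^bsub>perm_group S\<^esub> p = \<one>\<^bsub>perm_group S\<^esub>"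
    by (auto simp: perm_group_def)
qed (auto simp: perm_group_def permutes_compose permutes_id comp_assoc)

lemma involution_permutes:
  assumes "\<And>x. x \<notin> S \<Longrightarrow> p x = x" "\<And>x. p (p x) = x"
  shows "p permutes S"
  unfolding permutes_def using assms by metis

context skew_shape
begin

lemma pi_EH_tableau_of:
  assumes D: "D = skew_diagram g r d \<alpha> \<beta>" and YT: "YT g r d \<alpha> \<beta> = tableau_of ` LE {} D"
    and w: "w \<in> LE {} D" and n: "Suc n < length w" and b: "2 \<le> b"
  shows "pi_EH g r d \<alpha> \<beta> (int n + 1) b (tableau_of w) = tableau_of (swap_at n b w)"
proof -
  obtain P x y Q where w': "w = P @ x # y # Q" "length P = n" using n by (rule split_at_pair)
  note wd = word_distinct[OF w]
  have d: "distinct (P @ x # y # Q)" using wd w' by simp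
  have inD: "x \<in> D" "y \<in> D" using wd w' by auto
  have T: "tableau_of w x = int n + 1" "tableau_of w y = int n + 2"
    using tableau_of_append[of x P "y # Q"] tableau_of_append[of y "P @ [x]" Q] d w' by auto
  have inj: "inj_on (tableau_of w) D"
    using tableau_of_standard[OF w] by (simp add: standard_def bij_betw_def)
  have cond: "(\<exists>i j i' j'. tableau_of w (i, j) = int n + 1 \<and> tableau_of w (i', j') = int n + 1 + 1 \<and>
      (i, j) \<in> D \<and> (i', j') \<in> D \<and> i \<noteq> i' \<and> j \<noteq> j' \<and> \<bar>i - i'\<bar> + \<bar>j - j'\<bar> = b) \<longleftrightarrow>
      \<bar>content x - content y\<bar> = b" (is "?L \<longleftrightarrow> ?R")
  proof
    have two: "int n + 1 + 1 = int n + 2" by simp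
    assume ?L
    then obtain i j i' j' where ij: "tableau_of w (i, j) = int n + 1" "tableau_of w (i', j') = int n + 2"
      "(i, j) \<in> D" "(i', j') \<in> D" "i \<noteq> i'" "j \<noteq> j'" "\<bar>i - i'\<bar> + \<bar>j - j'\<bar> = b"
      unfolding two by blast
    have "(i, j) = x" "(i', j') = y" using ij T inj inD by (auto simp: inj_on_def)
    then show ?R using swap_distance[of P x y Q b] ij w w' b by auto
  next
    assume ?R
    then have "fst x \<noteq> fst y \<and> snd x \<noteq> snd y \<and> \<bar>fst x - fst y\<bar> + \<bar>snd x - snd y\<bar> = b"
      using swap_distance[of P x y Q b] w w' b by simp
    then show ?L using T inD
      by (intro exI[of _ "fst x"] exI[of _ "snd x"] exI[of _ "fst y"] exI[of _ "snd y"]) simp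
  qed
  have inYT: "tableau_of w \<in> YT g r d \<alpha> \<beta>" using YT w by blast
  show ?thesis
  proof (cases "\<bar>content x - content y\<bar> = b")
    case True
    then have "pi_EH g r d \<alpha> \<beta> (int n + 1) b (tableau_of w) =
        (\<lambda>z. if tableau_of w z = int n + 1 then int n + 1 + 1
          else if tableau_of w z = int n + 1 + 1 then int n + 1 else tableau_of w z)"
      unfolding pi_EH_def D[symmetric] cond using inYT by simp
    also have "\<dots> = tableau_of (swap_at n b w)"
      using tableau_of_swap[OF d] True w' swap_at_append[OF w'(2), of b x y Q]
      by (auto simp: fun_eq_iff algebra_simps)
    finally show ?thesis .
  next
    case False
    then have "swap_at n b w = w" using w' swap_at_append[OF w'(2), of b x y Q] by simp
    then show ?thesis unfolding pi_EH_def D[symmetric] cond using False by simp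
  qed
qed

text \<open>Nonemptiness enters because \<open>g = card D\<close> is read off from a tableau.
  Increase along rows and columns extends to \<open>below\<close> through the corner box, which
  convexity puts into \<open>D\<close>.\<close>

lemma YT_standard:
  assumes D: "D = skew_diagram g r d \<alpha> \<beta>" and ne: "YT g r d \<alpha> \<beta> \<noteq> {}"
  shows "YT g r d \<alpha> \<beta> = tableau_of ` LE {} D \<and> nat g = card D"
proof -
  obtain T0 where T0: "T0 \<in> YT g r d \<alpha> \<beta>" using ne by blast
  then have "bij_betw T0 D {1..g}" using D by (auto simp: YT_def Let_def)
  then have card: "nat g = card D" using bij_betw_same_card by fastforce
  have entries: "{1..g} = {1..int (card D)}" using card by auto
  have incr: "(\<forall>i j j'. (i, j) \<in> D \<longrightarrow> (i, j') \<in> D \<longrightarrow> j < j' \<longrightarrow> T (i, j) < T (i, j')) \<and>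
        (\<forall>i i' j. (i, j) \<in> D \<longrightarrow> (i', j) \<in> D \<longrightarrow> i < i' \<longrightarrow> T (i, j) < T (i', j)) \<longleftrightarrow>
      (\<forall>x\<in>D. \<forall>y\<in>D. below x y \<longrightarrow> T x < T y)" (is "?L \<longleftrightarrow> ?R") for T :: "box \<Rightarrow> int"
  proof
    assume L: ?L
    show ?R
    proof (intro ballI impI)
      fix x y assume xy: "x \<in> D" "y \<in> D" "below x y"
      obtain i j i' j' where ij: "x = (i, j)" "y = (i', j')" by (cases x, cases y) auto
      have le: "i \<le> i'" "j \<le> j'" "i < i' \<or> j < j'" using xy ij by (auto simp: below_def)
      have "(i, j') \<in> D" using convex[OF xy(1,2), of "(i, j')"] ij le by simp
      then have "j < j' \<longrightarrow> T (i, j) < T (i, j')" "i < i' \<longrightarrow> T (i, j') < T (i', j')"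
        using L xy ij by auto
      then show "T x < T y" using ij le by (cases "j = j'"; cases "i = i'") auto
    qed
  next
    assume ?R
    then show ?L by (auto simp: below_def)
  qed
  have "YT g r d \<alpha> \<beta> = {T. standard T}"
    unfolding YT_def Let_def standard_def D[symmetric] entries incr by simp
  then show ?thesis using card tableau_of_image by simp
qed

end

lemma EH_group_closed:
  assumes gens: "\<And>t a. 1 \<le> t \<Longrightarrow> t < g \<Longrightarrow> a > 0 \<Longrightarrow> pi_EH g r d \<alpha> \<beta> t a permutes YT g r d \<alpha> \<beta>"
  defines "G \<equiv> EH_group g r d \<alpha> \<beta>"
  shows "G \<subseteq> {p. p permutes YT g r d \<alpha> \<beta>}" "id \<in> G"
    "f \<in> G \<Longrightarrow> h \<in> G \<Longrightarrow> f \<circ> h \<in> G" "f \<in> G \<Longrightarrow> \<exists>h\<in>G. h \<circ> f = id \<and> f \<circ> h = id"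
proof -
  let ?P = "perm_group (YT g r d \<alpha> \<beta>)"
  let ?H = "{pi_EH g r d \<alpha> \<beta> t a | t a. 1 \<le> t \<and> t < g \<and> a > 0}"
  interpret P: group ?P by (rule group_perm_group)
  have H: "?H \<subseteq> carrier ?P" using gens by (auto simp: perm_group_def)
  have sub: "subgroup G ?P" unfolding G_def EH_group_def by (rule P.generate_is_subgroup[OF H])
  show 1: "G \<subseteq> {p. p permutes YT g r d \<alpha> \<beta>}"
    using subgroup.subset[OF sub] by (auto simp: perm_group_def)
  show "id \<in> G" using subgroup.one_closed[OF sub] by (simp add: perm_group_def)
  show "f \<in> G \<Longrightarrow> h \<in> G \<Longrightarrow> f \<circ> h \<in> G"
    using subgroup.m_closed[OF sub, of f h] by (simp add: perm_group_def)
  show "\<exists>h\<in>G. h \<circ> f = id \<and> f \<circ> h = id" if f: "f \<in> G"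
  proof
    have fc: "f \<in> carrier ?P" using f subgroup.subset[OF sub] by blast
    show "inv\<^bsub>?P\<^esub> f \<in> G" by (rule subgroup.m_inv_closed[OF sub f])
    show "inv\<^bsub>?P\<^esub> f \<circ> f = id \<and> f \<circ> inv\<^bsub>?P\<^esub> f = id"
      using P.l_inv[OF fc] P.r_inv[OF fc] by (simp add: perm_group_def)
  qed
qed

lemma ram_seq_antimono:
  assumes "ram_seq g r d \<alpha>" "i \<le> j" "j \<le> r"
  shows "\<alpha> j \<le> \<alpha> i"
  using assms(2,3)
proof (induction j rule: dec_induct)
  case (step n)
  then have "\<alpha> (Suc n) \<le> \<alpha> n" using assms(1) by (simp add: ram_seq_def)
  then show ?case using step by simp
qed simp

theorem theorem4p5:
  fixes g d :: int and r :: nat and \<alpha> \<beta> :: "nat \<Rightarrow> int"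
  assumes "ram_seq g r d \<alpha>" and "ram_seq g r d \<beta>"
    and "g - d + int r \<ge> 0"
    and "rho g r d \<alpha> \<beta> = 0"
    and "r \<ge> 2"
    and "\<alpha> r + \<beta> r + g - d + int r > int r + 1"
    and "max (\<alpha> 0 - \<alpha> r) 1 < Min ((\<lambda>j. \<alpha> (r - j - 1) + \<beta> j) ` {0..<r}) + g - d"
    and "(\<Sum>i\<le>r. \<alpha> i - \<alpha> r) < \<alpha> r + g - d + int r + \<beta> r"
    and "\<forall>i<r. \<forall>j. i \<le> j \<and> j < r \<and> i + j + 1 \<le> r \<longrightarrow>
            \<alpha> (r - i) + \<beta> i - 1 < \<alpha> (r - i - j - 1) + \<beta> j"
    and "\<forall>i. 0 < i \<and> i < r \<longrightarrow>
            \<alpha> (r - i) + \<beta> i = \<alpha> (r - 1) + \<beta> 1 \<and> \<alpha> (r - 1) + \<beta> 1 \<ge> \<alpha> r + \<beta> 0"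
  shows "EH_group g r d \<alpha> \<beta> = {p. p permutes YT g r d \<alpha> \<beta> \<and> evenperm p}
       \<or> EH_group g r d \<alpha> \<beta> = {p. p permutes YT g r d \<alpha> \<beta>}"
proof -
  define R where "R = int r + 1"
  define s where "s k = \<alpha> 0 - \<alpha> (nat (int r + 1 - k))" for k
  define e where "e k = \<alpha> 0 + (g - d + int r) + \<beta> (nat (k - 1))" for k
  define D where "D = skew_diagram g r d \<alpha> \<beta>"
  let ?YT = "YT g r d \<alpha> \<beta>"
  let ?G = "EH_group g r d \<alpha> \<beta>"
  have shape: "D = {(k, c). 1 \<le> k \<and> k \<le> R \<and> s k < c \<and> c \<le> e k}"
    by (simp add: D_def skew_diagram_def R_def s_def e_def)
  have s_anti: "s l \<le> s k" if "1 \<le> k" "k \<le> l" "l \<le> R" for k l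
    unfolding s_def using ram_seq_antimono[OF assms(1), of "nat (int r + 1 - l)" "nat (int r + 1 - k)"] that
    by (auto simp: R_def)
  have e_anti: "e l \<le> e k" if "1 \<le> k" "k \<le> l" "l \<le> R" for k l
    unfolding e_def using ram_seq_antimono[OF assms(2), of "nat (k - 1)" "nat (l - 1)"] that
    by (auto simp: R_def)
  have rows: "3 \<le> R" using assms(5) by (simp add: R_def)
  \<comment> \<open>Here \<open>e R - s 1\<close> is
    \<open>\<alpha> r + \<beta> r + g - d + r\<close>.\<close>
  have wide: "R < e R - s 1" using assms(6) by (simp add: R_def e_def s_def)
  \<comment> \<open>Here \<open>s 1 - s R\<close> is \<open>\<alpha> 0 - \<alpha> r\<close>, and the
    overlap \<open>e k - s (k + 1)\<close> is
    \<open>\<alpha> (r - j - 1) + \<beta> j + g - d + r\<close> for \<open>j = k - 1\<close>. So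
    this is inequality (1) with \<open>r = R - 1\<close> added to both sides.\<close>
  have gap: "s 1 - s R + R - 1 < e k - s (k + 1)" if k: "1 \<le> k" "k < R" for k
  proof -
    define j where "j = nat (k - 1)"
    have j: "j < r" "k = int j + 1" using k by (auto simp: j_def R_def)
    define \<mu> where "\<mu> = Min ((\<lambda>j. \<alpha> (r - j - 1) + \<beta> j) ` {0..<r})"
    have "\<mu> \<le> \<alpha> (r - j - 1) + \<beta> j"
      unfolding \<mu>_def using j by (intro Min_le) auto
    moreover have "\<alpha> 0 - \<alpha> r < \<mu> + g - d" using assms(7) unfolding \<mu>_def by linarith
    moreover have "nat (int r + 1 - (k + 1)) = r - j - 1" using j by auto
    ultimately show ?thesis using j by (simp add: s_def e_def R_def)
  qed
  interpret skew_shape D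
  proof
    have "D = (SIGMA k:{1..R}. {s k<..e k})" by (auto simp: shape)
    then show "finite D" by simp
    fix x y z assume *: "x \<in> D" "z \<in> D" "fst x \<le> fst y" "fst y \<le> fst z" "snd x \<le> snd y" "snd y \<le> snd z"
    then show "y \<in> D"
      using s_anti[of "fst x" "fst y"] e_anti[of "fst y" "fst z"]
      by (cases x; cases y; cases z) (auto simp: shape)
  qed
  consider "?YT = {}" | "?YT = tableau_of ` LE {} D" "nat g = card D"
    using YT_standard[OF D_def] by blast
  then show ?thesis
  proof cases
    \<comment> \<open>Without tableaux the group acts on the empty set and the condition on 3-cycles
      is vacuous.\<close>
    case 1
    have "pi_EH g r d \<alpha> \<beta> t a permutes ?YT" for t a
      by (rule involution_permutes) (auto simp: pi_EH_def 1)
    note cl = EH_group_closed[OF this]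
    show ?thesis
      by (rule alternating_or_symmetric) (use cl 1 in auto)
  next
    case 2
    have fin: "finite ?YT" using 2 finite_LE by simp
    have pi_out: "pi_EH g r d \<alpha> \<beta> t a T = T" if "T \<notin> ?YT" for t a T
      using that by (simp add: pi_EH_def)
    have pi_w: "pi_EH g r d \<alpha> \<beta> (int n + 1) b (tableau_of w) = tableau_of (swap_at n b w)"
      if "w \<in> LE {} D" "Suc n < length w" "2 \<le> b" for w n b
      using pi_EH_tableau_of[OF D_def 2(1)] that by blast
    have perm: "pi_EH g r d \<alpha> \<beta> t a permutes ?YT" if t: "1 \<le> t" "t < g" and a: "a > 0" for t a
    proof (rule involution_permutes[OF pi_out])
      fix T
      define n where "n = nat (t - 1)"
      have n: "t = int n + 1" "Suc n < card D" using t 2(2) by (auto simp: n_def)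
      show "pi_EH g r d \<alpha> \<beta> t a (pi_EH g r d \<alpha> \<beta> t a T) = T"
      \<comment> \<open>Boxes in different rows and different columns are at distance at least 2, so
        the generators with \<open>a = 1\<close> are trivial and the word model covers the
        rest.\<close>
      proof (cases "T \<in> ?YT \<and> 2 \<le> a")
        case True
        then obtain w where w: "w \<in> LE {} D" "T = tableau_of w" using 2(1) by blast
        have sw: "swap_at n a w \<in> LE {} D" using swap_at_LE[OF ideal_empty w(1)] True by simp
        show ?thesis
          using pi_w[OF w(1), of n a] pi_w[OF sw, of n a] n True w
            word_distinct[OF w(1)] word_distinct[OF sw] swap_at_swap_at by simp
      next
        case False
        have "pi_EH g r d \<alpha> \<beta> t a T = T"
        proof (cases "T \<in> ?YT")
          case True
          then have "a = 1" using False a by simp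
          then show ?thesis by (auto simp: pi_EH_def)
        qed (rule pi_out)
        then show ?thesis by simp
      qed
    qed
    have cl: "?G \<subseteq> {p. p permutes ?YT}" "id \<in> ?G"
        "\<And>f h. f \<in> ?G \<Longrightarrow> h \<in> ?G \<Longrightarrow> f \<circ> h \<in> ?G"
        "\<And>f. f \<in> ?G \<Longrightarrow> \<exists>h\<in>?G. h \<circ> f = id \<and> f \<circ> h = id"
      using EH_group_closed[of g r d \<alpha> \<beta>] perm by blast+
    interpret wide_tableau_group D ?G tableau_of R s e
    proof
      show "f \<circ> h \<in> ?G" if "f \<in> ?G" "h \<in> ?G" for f h using cl(3) that .
      show "\<exists>h\<in>?G. h \<circ> f = id \<and> f \<circ> h = id" if "f \<in> ?G" for f using cl(4) that .
      show "inj_on tableau_of (LE {} D)" by (rule tableau_of_inj)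
      show "\<exists>f\<in>?G. (\<forall>w\<in>LE {} D. f (tableau_of w) = tableau_of (swap_at n b w)) \<and>
          (\<forall>T. T \<notin> tableau_of ` LE {} D \<longrightarrow> f T = T)" if b: "2 \<le> b" for b n
      proof (cases "Suc n < card D")
        case True
        let ?f = "pi_EH g r d \<alpha> \<beta> (int n + 1) b"
        have "?f \<in> ?G"
          unfolding EH_group_def by (rule generate.incl) (use True 2(2) b in force)
        moreover have "?f (tableau_of w) = tableau_of (swap_at n b w)" if "w \<in> LE {} D" for w
          using pi_w[OF that _ b, of n] True word_distinct[OF that] by simp
        moreover have "?f T = T" if "T \<notin> tableau_of ` LE {} D" for T
          using pi_out that 2(1) by simp
        ultimately show ?thesis by blast
      next
        \<comment> \<open>Beyond the last pair of entries there is no generator; the exchange of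
          words is trivial and \<open>id\<close> realizes it.\<close>
        case False
        then have "id (tableau_of w) = tableau_of (swap_at n b w)" if "w \<in> LE {} D" for w
          using word_distinct[OF that] by (simp add: swap_at_short)
        then show ?thesis using cl(2) by (intro bexI[of _ id]) auto
      qed
    qed (use shape s_anti e_anti rows wide gap in auto)
    have out: "f T = T" if "f \<in> ?G" "T \<notin> tableau_of ` LE {} D" for f T
      using cl(1) that 2(1) permutes_not_in[of f ?YT T] by auto
    show ?thesis
    proof (rule alternating_or_symmetric[OF fin cl])
      show "cyc3 a b c \<in> ?G" if "{a, b, c} \<subseteq> ?YT" "distinct [a, b, c]" for a b c
      proof (rule cyc3_in_group)
        show "f T = T" if "f \<in> ?G" "T \<notin> tableau_of ` LE {} D" for f T using out that .
      qed (use that 2(1) in auto)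
    qed
  qed
qed

end
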